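(* Let $\alpha,c,\delta>0$. (a) (Rate of convergence) There exists $\tau_0>0$ such that for every $T>0$ there is a constant $C=C(T,\tau_0)$ such that for every $U_0\in\mathbb H_2$ and every $\tau\in(0,\tau_0]$, $$\|PT^\tau(t)U_0-T(t)PU_0\|_{\mathbb H_0^0}^2\le C\,\tau\,\|U_0\|_{\mathbb H_2}^2$$ uniformly for $t\in[0,T]$. (b) (Strong convergence) Let $U_0\in\mathbb H_0$. Then $$\|PT^\tau(t)U_0-T(t)PU_0\|_{\mathbb H_0^0}\to0\quad\text{as }\tau\to0^+,$$ uniformly for all $t\ge0$.
   Context: Let $\Omega\subset\mathbb R^n$ ($n=2,3$) be a bounded domain with $C^2$ boundary and let $A=-\Delta$ on $L^2(\Omega)$ with $\mathcal D(A)=H_0^1(\Omega)\cap H^2(\Omega)$ (a positive self-adjoint operator with compact resolvent); $\|\cdot\|_2$ is the $L^2(\Omega)$ norm and $\|u\|_{\mathcal D(A^{s})}=\|A^{s}u\|_2$. Put $b^\tau=\delta+\tau c^2$ for $\tau>0$. Spaces: $\mathbb H_0=\mathcal D(A^{1/2})\times\mathcal D(A^{1/2})\times L^2(\Omega)$; $\mathbb H_2=\mathcal D(A)\times\mathcal D(A)\times\mathcal D(A^{1/2})$ with $\|(u,v,w)\|_{\mathbb H_2}^2=\|Au\|_2^2+\|Av\|_2^2+\|A^{1/2}w\|_2^2$; $\mathbb H_0^0=\mathcal D(A^{1/2})\times\mathcal D(A^{1/2})$ with $\|(u,v)\|_{\mathbb H_0^0}^2=\|A^{1/2}u\|_2^2+\|A^{1/2}v\|_2^2$.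 $P:\mathbb H_0\to\mathbb H_0^0$ is the projection $P(u,v,w)=(u,v)$. For each $\tau>0$, $T^\tau(t)$ is the $C_0$-group on $\mathbb H_0$ generated by $\mathcal A^\tau(u,v,w)=(v,\,w,\,-\tau^{-1}A(c^2u+b^\tau v)-\tau^{-1}\alpha w)$ with domain $\{(u,v,w)\in\mathbb H_0: w\in\mathcal D(A^{1/2}),\ c^2u+b^\tau v\in\mathcal D(A)\}$ (first-order form of $\tau u_{ttt}+\alpha u_{tt}+c^2Au+b^\tau Au_t=0$). $T(t)$ is the analytic semigroup on $\mathbb H_0^0$ generated by $\mathcal A(u,v)=(v,\,-\alpha^{-1}A(c^2u+\delta v))$ with domain $\{(u,v)\in\mathbb H_0^0: c^2u+\delta v\in\mathcal D(A^{3/2})\}$ (first-order form of $\alpha u_{tt}+c^2Au+\delta Au_t=0$). *)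

theory Defs
  imports "HOL-Analysis.Analysis"
begin

section \<open>The Hilbert space of square integrable functions\<close>

definition square_integrable :: "('a::euclidean_space \<Rightarrow> real) \<Rightarrow> bool" where
  "square_integrable f \<longleftrightarrow> f \<in> borel_measurable lborel \<and> integrable lborel (\<lambda>x. (f x)\<^sup>2)"

lemma square_integrable_mult:
  assumes "square_integrable f" "square_integrable g"
  shows "integrable lborel (\<lambda>x. f x * g x)"
proof -
  have [measurable]: "f \<in> borel_measurable lborel" "g \<in> borel_measurable lborel"
    and i: "integrable lborel (\<lambda>x. (f x)\<^sup>2 + (g x)\<^sup>2)"
    using assms by (auto simp: square_integrable_def)
  have "norm (f x * g x) \<le> norm ((f x)\<^sup>2 + (g x)\<^sup>2)" for x
  proof -
    have "2 * (\<bar>f x\<bar> * \<bar>g x\<bar>) \<le> (f x)\<^sup>2 + (g x)\<^sup>2"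
      using sum_squares_bound[of "\<bar>f x\<bar>" "\<bar>g x\<bar>"] by simp
    moreover have "0 \<le> \<bar>f x\<bar> * \<bar>g x\<bar>" by simp
    ultimately have "\<bar>f x\<bar> * \<bar>g x\<bar> \<le> (f x)\<^sup>2 + (g x)\<^sup>2" by linarith
    then show ?thesis by (simp add: abs_mult)
  qed
  then show ?thesis
    by (intro Bochner_Integration.integrable_bound[OF i]) auto
qed

lemma square_integrable_zero: "square_integrable (\<lambda>x. 0)"
  by (simp add: square_integrable_def)

lemma square_integrable_add:
  assumes "square_integrable f" "square_integrable g"
  shows "square_integrable (\<lambda>x. f x + g x)"
proof -
  have "integrable lborel (\<lambda>x. (f x)\<^sup>2 + (g x)\<^sup>2 + 2 * (f x * g x))"
    using assms square_integrable_mult[OF assms] by (auto simp: square_integrable_def)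
  then show ?thesis
    using assms by (auto simp: square_integrable_def power2_sum algebra_simps)
qed

lemma square_integrable_scale:
  "square_integrable f \<Longrightarrow> square_integrable (\<lambda>x. r * f x)"
  by (auto simp: square_integrable_def power_mult_distrib)

quotient_type (overloaded) 'a l2 = "'a::euclidean_space \<Rightarrow> real" / partial:
  "\<lambda>f g. square_integrable f \<and> square_integrable g \<and> (AE x in lborel. f x = g x)"
proof (rule part_equivpI)
  show "\<exists>f::'a \<Rightarrow> real. square_integrable f \<and> square_integrable f \<and> (AE x in lborel. f x = f x)"
    using square_integrable_zero by auto
qed (auto simp: symp_def transp_def elim: AE_mp)

instantiation l2 :: (euclidean_space) real_inner
begin

lift_definition zero_l2 :: "'a l2" is "\<lambda>x. 0"
  by (simp add: square_integrable_zero)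

lift_definition plus_l2 :: "'a l2 \<Rightarrow> 'a l2 \<Rightarrow> 'a l2" is "\<lambda>f g x. f x + g x"
  by (auto intro: square_integrable_add)

lift_definition scaleR_l2 :: "real \<Rightarrow> 'a l2 \<Rightarrow> 'a l2" is "\<lambda>r f x. r * f x"
  by (auto intro: square_integrable_scale)

lift_definition inner_l2 :: "'a l2 \<Rightarrow> 'a l2 \<Rightarrow> real" is "\<lambda>f g. LINT x|lborel. f x * g x"
  by (rule integral_cong_AE) (auto simp: square_integrable_def)

definition uminus_l2 :: "'a l2 \<Rightarrow> 'a l2" where "uminus_l2 u = (-1) *\<^sub>R u"
definition minus_l2 :: "'a l2 \<Rightarrow> 'a l2 \<Rightarrow> 'a l2" where "minus_l2 u v = u + - v"
definition norm_l2 :: "'a l2 \<Rightarrow> real" where "norm_l2 u = sqrt (inner u u)"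
definition sgn_l2 :: "'a l2 \<Rightarrow> 'a l2" where "sgn_l2 u = inverse (norm u) *\<^sub>R u"
definition dist_l2 :: "'a l2 \<Rightarrow> 'a l2 \<Rightarrow> real" where "dist_l2 u v = norm (u - v)"
definition uniformity_l2 :: "('a l2 \<times> 'a l2) filter" where
  "uniformity_l2 = (INF e\<in>{0 <..}. principal {(x, y). dist x y < e})"
definition open_l2 :: "'a l2 set \<Rightarrow> bool" where
  "open_l2 U \<longleftrightarrow> (\<forall>x\<in>U. eventually (\<lambda>(x', y). x' = x \<longrightarrow> y \<in> U) uniformity)"

instance
proof
  fix u v w :: "'a l2" and r s :: real
  show "u + v + w = u + (v + w)"
    by transfer (auto intro!: square_integrable_add simp: algebra_simps)
  show "u + v = v + u"
    by transfer (auto intro!: square_integrable_add simp: algebra_simps)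
  show "0 + u = u"
    by transfer auto
  show "- u + u = 0"
    unfolding uminus_l2_def
    by transfer (auto intro!: square_integrable_add square_integrable_scale square_integrable_zero
        simp: square_integrable_def)
  show "u - v = u + - v"
    by (simp add: minus_l2_def)
  show "r *\<^sub>R (u + v) = r *\<^sub>R u + r *\<^sub>R v"
    by transfer (auto intro!: square_integrable_add square_integrable_scale simp: algebra_simps)
  show "(r + s) *\<^sub>R u = r *\<^sub>R u + s *\<^sub>R u"
    by transfer (auto intro!: square_integrable_add square_integrable_scale simp: distrib_right)
  show "r *\<^sub>R s *\<^sub>R u = (r * s) *\<^sub>R u"
    by transfer (auto intro!: square_integrable_scale simp: mult.assoc)
  show "1 *\<^sub>R u = u"
    by transfer auto
  show "inner u v = inner v u"
    by transfer (simp add: mult.commute)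
  show "inner (u + v) w = inner u w + inner v w"
    by transfer (auto simp: distrib_right square_integrable_mult)
  show "inner (r *\<^sub>R u) v = r * inner u v"
    by transfer (simp add: mult.assoc)
  show "0 \<le> inner u u"
    by transfer simp
  show "inner u u = 0 \<longleftrightarrow> u = 0"
  proof transfer
    fix f :: "'a \<Rightarrow> real"
    assume "square_integrable f \<and> square_integrable f \<and> (AE x in lborel. f x = f x)"
    then have f: "square_integrable f" by simp
    have "(LINT x|lborel. f x * f x) = 0 \<longleftrightarrow> (AE x in lborel. f x * f x = 0)"
      by (rule integral_nonneg_eq_0_iff_AE) (auto simp: f square_integrable_mult)
    then show "((LINT x|lborel. f x * f x) = 0) =
        (square_integrable f \<and> square_integrable (\<lambda>x::'a. 0) \<and> (AE x in lborel. f x = 0))"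
      using f by (simp add: square_integrable_zero)
  qed
  show "norm u = sqrt (inner u u)" by (rule norm_l2_def)
  show "sgn u = inverse (norm u) *\<^sub>R u" by (rule sgn_l2_def)
  show "dist u v = norm (u - v)" by (rule dist_l2_def)
  show "uniformity = (INF e\<in>{0 <..}. principal {(x, y :: 'a l2). dist x y < e})"
    by (rule uniformity_l2_def)
next
  fix U :: "'a l2 set"
  show "open U \<longleftrightarrow> (\<forall>x\<in>U. eventually (\<lambda>(x', y). x' = x \<longrightarrow> y \<in> U) uniformity)"
    by (rule open_l2_def)
qed

end

text \<open>\<open>abs_l2 f\<close> is the class of a square integrable function \<open>f\<close>, and \<open>rep_l2 u\<close> is some
  representative of \<open>u\<close>. The space $L^2(\Omega)$ is realised by extension by zero, as the closed
  subspace of those classes on the whole space that vanish almost everywhere off \<open>\<Omega>\<close>.\<close>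

definition L2 :: "'a::euclidean_space set \<Rightarrow> 'a l2 set" where
  "L2 \<Omega> = {u. AE x in lborel. x \<notin> \<Omega> \<longrightarrow> rep_l2 u x = 0}"


section \<open>Bounded domains with twice continuously differentiable boundary\<close>

definition partial_diff :: "'n::finite \<Rightarrow> (real^'n \<Rightarrow> real) \<Rightarrow> real^'n \<Rightarrow> real" where
  "partial_diff i f x = frechet_derivative f (at x) (axis i 1)"

primrec C_class :: "nat \<Rightarrow> (real^'n::finite \<Rightarrow> real) \<Rightarrow> bool" where
  "C_class 0 f \<longleftrightarrow> continuous_on UNIV f"
| "C_class (Suc k) f \<longleftrightarrow> (\<forall>x. f differentiable at x) \<and> (\<forall>i. C_class k (partial_diff i f))"

text \<open>Near each boundary point, after a rigid motion \<open>Q\<close>, the set is the region strictly above the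
  graph of a function \<open>\<gamma>\<close> of the coordinates other than \<open>i\<close>; that \<open>\<gamma>\<close> depends only on these is
  expressed by invariance in the direction \<open>i\<close>.\<close>

definition C2_boundary :: "(real^'n::finite) set \<Rightarrow> bool" where
  "C2_boundary \<Omega> \<longleftrightarrow>
     (\<forall>p\<in>frontier \<Omega>. \<exists>r>0. \<exists>(Q :: real^'n \<Rightarrow> real^'n) i \<gamma>.
        orthogonal_transformation Q \<and> C_class 2 \<gamma> \<and> (\<forall>y s. \<gamma> (y + s *\<^sub>R axis i 1) = \<gamma> y) \<and>
        \<Omega> \<inter> ball p r = {x \<in> ball p r. Q x $ i > \<gamma> (Q x)})"

definition bounded_C2_domain :: "(real^'n::finite) set \<Rightarrow> bool" where
  "bounded_C2_domain \<Omega> \<longleftrightarrow>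
     open \<Omega> \<and> connected \<Omega> \<and> \<Omega> \<noteq> {} \<and> bounded \<Omega> \<and> C2_boundary \<Omega>"


section \<open>Sobolev spaces and the Dirichlet Laplacian\<close>

definition test_function :: "(real^'n::finite) set \<Rightarrow> (real^'n \<Rightarrow> real) \<Rightarrow> bool" where
  "test_function \<Omega> \<phi> \<longleftrightarrow>
     (\<forall>k. C_class k \<phi>) \<and> compact (closure {x. \<phi> x \<noteq> 0}) \<and> closure {x. \<phi> x \<noteq> 0} \<subseteq> \<Omega>"

text \<open>Unbounded operators are represented by their graphs, throughout.\<close>

definition weak_partial :: "(real^'n::finite) set \<Rightarrow> 'n \<Rightarrow> ((real^'n) l2 \<times> (real^'n) l2) set" where
  "weak_partial \<Omega> i = {(u, g). u \<in> L2 \<Omega> \<and> g \<in> L2 \<Omega> \<and>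
     (\<forall>\<phi>. test_function \<Omega> \<phi> \<longrightarrow>
        (LINT x:\<Omega>|lborel. rep_l2 u x * partial_diff i \<phi> x)
          = - (LINT x:\<Omega>|lborel. rep_l2 g x * \<phi> x))}"

definition H1 :: "(real^'n::finite) set \<Rightarrow> (real^'n) l2 set" where
  "H1 \<Omega> = {u \<in> L2 \<Omega>. \<forall>i. u \<in> Domain (weak_partial \<Omega> i)}"

definition H2 :: "(real^'n::finite) set \<Rightarrow> (real^'n) l2 set" where
  "H2 \<Omega> = {u \<in> H1 \<Omega>. \<forall>i g. (u, g) \<in> weak_partial \<Omega> i \<longrightarrow> g \<in> H1 \<Omega>}"

text \<open>The closure of the test functions in the norm of \<open>H1 \<Omega>\<close>.\<close>

definition H10 :: "(real^'n::finite) set \<Rightarrow> (real^'n) l2 set" where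
  "H10 \<Omega> = {u \<in> H1 \<Omega>. \<exists>\<phi> :: nat \<Rightarrow> real^'n \<Rightarrow> real.
     (\<forall>k. test_function \<Omega> (\<phi> k)) \<and>
     (\<lambda>k. abs_l2 (\<phi> k)) \<longlonglongrightarrow> u \<and>
     (\<forall>i g. (u, g) \<in> weak_partial \<Omega> i \<longrightarrow> (\<lambda>k. abs_l2 (partial_diff i (\<phi> k))) \<longlonglongrightarrow> g)}"

definition dirichlet_laplacian ::
    "(real^'n::finite) set \<Rightarrow> ((real^'n) l2 \<times> (real^'n) l2) set" where
  "dirichlet_laplacian \<Omega> = {(u, f). u \<in> H10 \<Omega> \<inter> H2 \<Omega> \<and>
     (\<exists>h. (\<forall>i. (u, h i) \<in> weak_partial \<Omega> i O weak_partial \<Omega> i) \<and> f = - (\<Sum>i\<in>UNIV. h i))}"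


section \<open>Self-adjoint operators and square roots\<close>

definition app :: "('a \<times> 'b) set \<Rightarrow> 'a \<Rightarrow> 'b" where
  "app B x = (THE y. (x, y) \<in> B)"

definition adjoint_on :: "'h::real_inner set \<Rightarrow> ('h \<times> 'h) set \<Rightarrow> ('h \<times> 'h) set" where
  "adjoint_on H B = {(x, y) \<in> H \<times> H. \<forall>(u, v)\<in>B. v \<bullet> x = u \<bullet> y}"

definition self_adjoint_on :: "'h::real_inner set \<Rightarrow> ('h \<times> 'h) set \<Rightarrow> bool" where
  "self_adjoint_on H B \<longleftrightarrow>
     B \<subseteq> H \<times> H \<and> subspace B \<and> single_valued B \<and> H \<subseteq> closure (Domain B) \<and> adjoint_on H B = B"

definition positive_operator :: "('h::real_inner \<times> 'h) set \<Rightarrow> bool" where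
  "positive_operator B \<longleftrightarrow> (\<forall>(u, v)\<in>B. 0 \<le> v \<bullet> u)"

text \<open>\<open>R\<close> is the operator $A^{1/2}$: the unique positive self-adjoint square root of \<open>A\<close>.
  The domain of $A^{3/2}$ is then \<open>Domain (A O R)\<close> (\<open>O\<close> applies \<open>A\<close> first).\<close>

definition is_sqrt_operator :: "'h::real_inner set \<Rightarrow> ('h \<times> 'h) set \<Rightarrow> ('h \<times> 'h) set \<Rightarrow> bool" where
  "is_sqrt_operator H A R \<longleftrightarrow> self_adjoint_on H R \<and> positive_operator R \<and> R O R = A"


section \<open>Strongly continuous groups and semigroups\<close>

text \<open>The underlying normed space is the subspace \<open>X\<close> with the norm \<open>N\<close>, not the norm of the
  ambient type. The time set \<open>J\<close> is \<open>UNIV\<close> for groups and \<open>{0..}\<close> for semigroups.\<close>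

definition C0_on ::
    "real set \<Rightarrow> 'x::real_vector set \<Rightarrow> ('x \<Rightarrow> real) \<Rightarrow> (real \<Rightarrow> 'x \<Rightarrow> 'x) \<Rightarrow> bool" where
  "C0_on J X N S \<longleftrightarrow>
     (\<forall>t\<in>J. \<forall>x\<in>X. S t x \<in> X) \<and>
     (\<forall>t\<in>J. \<forall>x\<in>X. \<forall>y\<in>X. \<forall>a b. S t (a *\<^sub>R x + b *\<^sub>R y) = a *\<^sub>R S t x + b *\<^sub>R S t y) \<and>
     (\<forall>t\<in>J. \<exists>M. \<forall>x\<in>X. N (S t x) \<le> M * N x) \<and>
     (\<forall>x\<in>X. S 0 x = x) \<and>
     (\<forall>s\<in>J. \<forall>t\<in>J. \<forall>x\<in>X. S (s + t) x = S s (S t x)) \<and>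
     (\<forall>x\<in>X. ((\<lambda>t. N (S t x - x)) \<longlongrightarrow> 0) (at 0 within J))"

definition generator_on ::
    "real set \<Rightarrow> 'x::real_vector set \<Rightarrow> ('x \<Rightarrow> real) \<Rightarrow> (real \<Rightarrow> 'x \<Rightarrow> 'x) \<Rightarrow> ('x \<times> 'x) set" where
  "generator_on J X N S =
     {(x, y) \<in> X \<times> X. ((\<lambda>h. N ((1 / h) *\<^sub>R (S h x - x) - y)) \<longlongrightarrow> 0) (at 0 within J)}"

definition C0_group_generated_by ::
    "'x::real_vector set \<Rightarrow> ('x \<Rightarrow> real) \<Rightarrow> ('x \<times> 'x) set \<Rightarrow> (real \<Rightarrow> 'x \<Rightarrow> 'x) \<Rightarrow> bool" where
  "C0_group_generated_by X N G S \<longleftrightarrow> C0_on UNIV X N S \<and> generator_on UNIV X N S = G"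

definition C0_semigroup_generated_by ::
    "'x::real_vector set \<Rightarrow> ('x \<Rightarrow> real) \<Rightarrow> ('x \<times> 'x) set \<Rightarrow> (real \<Rightarrow> 'x \<Rightarrow> 'x) \<Rightarrow> bool" where
  "C0_semigroup_generated_by X N G S \<longleftrightarrow> C0_on {0..} X N S \<and> generator_on {0..} X N S = G"


section \<open>Phase spaces and the two generators\<close>

text \<open>In what follows \<open>H\<close> is the base Hilbert space, \<open>A\<close> the operator and \<open>R\<close> its square root.\<close>

definition HH0 :: "'h set \<Rightarrow> ('h \<times> 'h) set \<Rightarrow> ('h \<times> 'h \<times> 'h) set" where
  "HH0 H R = Domain R \<times> Domain R \<times> H"

definition norm_HH0 :: "('h::real_normed_vector \<times> 'h) set \<Rightarrow> 'h \<times> 'h \<times> 'h \<Rightarrow> real" where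
  "norm_HH0 R = (\<lambda>(u, v, w). sqrt ((norm (app R u))\<^sup>2 + (norm (app R v))\<^sup>2 + (norm w)\<^sup>2))"

definition HH2 :: "('h \<times> 'h) set \<Rightarrow> ('h \<times> 'h) set \<Rightarrow> ('h \<times> 'h \<times> 'h) set" where
  "HH2 A R = Domain A \<times> Domain A \<times> Domain R"

definition norm_HH2 ::
    "('h::real_normed_vector \<times> 'h) set \<Rightarrow> ('h \<times> 'h) set \<Rightarrow> 'h \<times> 'h \<times> 'h \<Rightarrow> real" where
  "norm_HH2 A R =
     (\<lambda>(u, v, w). sqrt ((norm (app A u))\<^sup>2 + (norm (app A v))\<^sup>2 + (norm (app R w))\<^sup>2))"

definition HH00 :: "('h \<times> 'h) set \<Rightarrow> ('h \<times> 'h) set" where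
  "HH00 R = Domain R \<times> Domain R"

definition norm_HH00 :: "('h::real_normed_vector \<times> 'h) set \<Rightarrow> 'h \<times> 'h \<Rightarrow> real" where
  "norm_HH00 R = (\<lambda>(u, v). sqrt ((norm (app R u))\<^sup>2 + (norm (app R v))\<^sup>2))"

definition proj_HH00 :: "'h \<times> 'h \<times> 'h \<Rightarrow> 'h \<times> 'h" where
  "proj_HH00 = (\<lambda>(u, v, w). (u, v))"

definition gen_tau ::
    "'h::real_vector set \<Rightarrow> ('h \<times> 'h) set \<Rightarrow> ('h \<times> 'h) set \<Rightarrow> real \<Rightarrow> real \<Rightarrow> real \<Rightarrow> real \<Rightarrow>
      (('h \<times> 'h \<times> 'h) \<times> ('h \<times> 'h \<times> 'h)) set" where
  "gen_tau H A R \<alpha> c \<delta> \<tau> =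
     (let b = \<delta> + \<tau> * c\<^sup>2 in
      {((u, v, w), (v, w, - ((1 / \<tau>) *\<^sub>R app A (c\<^sup>2 *\<^sub>R u + b *\<^sub>R v)) - (\<alpha> / \<tau>) *\<^sub>R w)) | u v w.
         (u, v, w) \<in> HH0 H R \<and> w \<in> Domain R \<and> c\<^sup>2 *\<^sub>R u + b *\<^sub>R v \<in> Domain A})"

definition gen_limit ::
    "('h::real_vector \<times> 'h) set \<Rightarrow> ('h \<times> 'h) set \<Rightarrow> real \<Rightarrow> real \<Rightarrow> real \<Rightarrow>
      (('h \<times> 'h) \<times> ('h \<times> 'h)) set" where
  "gen_limit A R \<alpha> c \<delta> =
     {((u, v), (v, - ((1 / \<alpha>) *\<^sub>R app A (c\<^sup>2 *\<^sub>R u + \<delta> *\<^sub>R v)))) | u v.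
        (u, v) \<in> HH00 R \<and> c\<^sup>2 *\<^sub>R u + \<delta> *\<^sub>R v \<in> Domain (A O R)}"

end

theory Submission
  imports Defs
begin

text \<open>Everything is an energy estimate. Put \<open>k = c\<^sup>2 / b\<close> with \<open>b = \<delta> + \<tau> c\<^sup>2\<close>. Testing the equation with
  \<open>u\<^sub>t\<^sub>t + k u\<^sub>t\<close> and, with a smaller weight, with \<open>u\<^sub>t\<close> gives a Lyapunov functional \<open>L\<close> with
  \<open>L' \<le> - \<parallel>u\<^sub>t\<^sub>t\<parallel>\<^sup>2 - \<delta> \<parallel>A\<^sup>1\<^sup>/\<^sup>2 u\<^sub>t\<parallel>\<^sup>2\<close>, uniformly for small \<open>\<tau> \<ge> 0\<close>; the value \<open>\<tau> = 0\<close> is the limit equation.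
  The difference \<open>z\<close> of two solutions is tested with \<open>z\<^sub>t\<close>. The term \<open>\<tau> u\<^sub>t\<^sub>t\<^sub>t\<close> is moved under a total
  derivative, and the remainder is of size \<open>\<tau>\<close> times the dissipation, so that the energy of \<open>z\<close> plus a
  multiple of \<open>\<tau> (L + L\<^sub>0)\<close>, where \<open>L\<^sub>0\<close> belongs to the limit equation, is nonincreasing in time. No
  time integral occurs, and the constant does not depend on the length of the time interval. The rate
  follows from this estimate one half power of \<open>A\<close> higher, after smoothing with
  \<open>(I + \<epsilon> A)\<^sup>-\<^sup>1\<close>, which commutes with the equations and tends strongly to the identity; strong
  convergence then follows by density, because the semigroups are bounded uniformly in \<open>\<tau>\<close> and \<open>t\<close>.\<close>

section \<open>The Lyapunov functional\<close>

text \<open>Three obstacles shape the proof. The relaxed equation takes any initial acceleration,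
  while the limit equation determines its own, so the two need not be close at time 0. The
  comparison therefore sees the accelerations only through the dissipation and through \<tau> times
  \<open>w\<close> paired with the velocity difference, which vanishes at time 0. Next, data in
  \<open>HH2\<close> lie in the domain of each relaxed generator, but the limit generator wants a
  combination in the domain of A^(3/2), and along orbits both generators place only a combination of
  \<open>u\<close> and \<open>v\<close>, not each of them, in the domain of A. The resolvent repairs
  both defects without increasing the norms of the data. Composing it with A^(1/2) matters too: the
  comparison estimates the velocity only in the base norm, whereas the claim asks for A^(1/2) of it.
  Finally, the groups and the semigroup are given only by strong continuity and their generators, so
  differentiability of orbits has to be derived; for the semigroup the left derivative needs a bound
  uniform over short times. The operator itself enters through its square root and one number
  \<open>m\<close>, a lower bound from the Poincare inequality.\<close>

lemma nonincreasing_from_zero: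
  fixes f f' :: "real \<Rightarrow> real"
  assumes d: "\<And>t. 0 \<le> t \<Longrightarrow> (f has_real_derivative f' t) (at t within {0..})"
    and le: "\<And>t. 0 \<le> t \<Longrightarrow> f' t \<le> 0" and t: "0 \<le> t"
  shows "f t \<le> f 0"
proof (cases "t = 0")
  case False
  \<comment> \<open>At 0 only a right derivative is available, because the limit semigroup lives on
    nonnegative times. The mean value theorem on [0, t] copes with that.\<close>
  have "\<exists>x\<in>{0<..<t}. f t - f 0 = f' x * (t - 0)"
  proof (rule mvt_simple)
    show "0 < t" using False t by simp
    fix x assume x: "0 \<le> x" "x \<le> t"
    show "(f has_derivative (*) (f' x)) (at x within {0..t})"
      by (rule has_derivative_subset[OF d[OF x(1), unfolded has_field_derivative_def]]) auto
  qed
  then obtain x where "x > 0" "f t - f 0 = f' x * t" by auto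
  moreover have "f' x * t \<le> 0" using le[of x] t \<open>x > 0\<close> by (simp add: mult_nonpos_nonneg)
  ultimately show ?thesis by simp
qed simp

lemma inner_has_real_derivative:
  fixes f g :: "real \<Rightarrow> 'h::real_inner"
  assumes "(f has_vector_derivative f') (at t within S)" "(g has_vector_derivative g') (at t within S)"
  shows "((\<lambda>t. f t \<bullet> g t) has_real_derivative (f t \<bullet> g' + f' \<bullet> g t)) (at t within S)"
  using bounded_bilinear.has_vector_derivative[OF bounded_bilinear_inner assms]
  by (simp add: has_real_derivative_iff_has_vector_derivative)

lemma inner_le_half_sum:
  fixes x y :: "'h::real_inner"
  shows "x \<bullet> y \<le> (x \<bullet> x + y \<bullet> y) / 2" "- (x \<bullet> y) \<le> (x \<bullet> x + y \<bullet> y) / 2"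
  using inner_ge_zero[of "x - y"] inner_ge_zero[of "x + y"]
  by (simp_all add: algebra_simps inner_commute)

section \<open>Parameters, and coercivity of the Lyapunov functional uniformly in the relaxation
  time\<close>

locale mgt_params =
  fixes \<alpha> c \<delta> :: real
  assumes \<alpha>: "\<alpha> > 0" and c: "c > 0" and \<delta>: "\<delta> > 0"
begin

text \<open>Up to this value \<open>\<tau> * (c\<^sup>2 / b)\<close> is at most \<alpha>/2, since b
  is at least \<delta>. Hence the effective damping
  \<open>\<alpha> - \<tau> * (c\<^sup>2 / b)\<close> of the relaxed equation keeps at least half of
  \<alpha>.\<close>

definition tau_max :: real where
  "tau_max = \<alpha> * \<delta> / (2 * c\<^sup>2)"

text \<open>Regrouped, this is (\<tau>/2)|w + k v|^2 + (k/2)(\<alpha> - \<tau> k)|v|^2 + (b/2)|q + k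
  p|^2, the natural energy for the multiplier w + k v. Its derivative along solutions is -(\<alpha>
  - \<tau> k)|w|^2.\<close>

definition damped_energy :: "real \<Rightarrow> 'h::real_inner \<Rightarrow> 'h \<Rightarrow> 'h \<Rightarrow> 'h \<Rightarrow> real" where
  "damped_energy \<tau> v w p q =
     (let b = \<delta> + \<tau> * c\<^sup>2; k = c\<^sup>2 / b in
      \<tau> / 2 * (w \<bullet> w) + \<tau> * k * (w \<bullet> v) + \<alpha> * k / 2 * (v \<bullet> v)
        + b / 2 * ((q + k *\<^sub>R p) \<bullet> (q + k *\<^sub>R p)))"

text \<open>The second bracket belongs to the multiplier v; it decreases at rate b|q|^2 but gains
  \<tau>|w|^2. The weight \<open>2 * (1 + tau_max) / \<alpha>\<close> turns the guaranteed damping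
  \<alpha>/2 into 1 + \<open>tau_max\<close>, which pays for that gain and leaves at least
  |w|^2.\<close>

definition lyapunov :: "real \<Rightarrow> 'h::real_inner \<Rightarrow> 'h \<Rightarrow> 'h \<Rightarrow> 'h \<Rightarrow> real" where
  "lyapunov \<tau> v w p q =
     2 * (1 + tau_max) / \<alpha> * damped_energy \<tau> v w p q
       + (\<tau> * (w \<bullet> v) + \<alpha> / 2 * (v \<bullet> v) + c\<^sup>2 / 2 * (p \<bullet> p))"

lemma tau_max_pos: "tau_max > 0"
  using \<alpha> c \<delta> by (simp add: tau_max_def)

lemma coefficients:
  assumes "0 \<le> \<tau>" "\<tau> \<le> tau_max"
  defines "b \<equiv> \<delta> + \<tau> * c\<^sup>2"
  shows "\<delta> \<le> b" "0 < b" "0 < c\<^sup>2 / b" "c\<^sup>2 / b \<le> c\<^sup>2 / \<delta>" "\<tau> * (c\<^sup>2 / b) \<le> \<alpha> / 2"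
    "b \<le> \<delta> + \<alpha> * \<delta> / 2"
proof -
  show b: "\<delta> \<le> b" using assms by simp
  then show b0: "0 < b" using \<delta> by linarith
  then show "0 < c\<^sup>2 / b" using c by simp
  show k: "c\<^sup>2 / b \<le> c\<^sup>2 / \<delta>" using b \<delta> b0 by (intro divide_left_mono) auto
  have t: "\<tau> * c\<^sup>2 \<le> \<alpha> * \<delta> / 2"
    using assms(2) c by (simp add: tau_max_def field_simps)
  then show "b \<le> \<delta> + \<alpha> * \<delta> / 2" by (simp add: b_def)
  have "\<tau> * (c\<^sup>2 / b) \<le> \<tau> * (c\<^sup>2 / \<delta>)" using k assms(1) by (rule mult_left_mono)
  also have "\<dots> \<le> \<alpha> / 2" using t \<delta> by (simp add: field_simps)
  finally show "\<tau> * (c\<^sup>2 / b) \<le> \<alpha> / 2" .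
qed

text \<open>Completing the square (\<tau>/4)|w + 2 k v|^2 keeps half of the w-term. It costs \<tau>
  k^2 |v|^2, which is at most (\<alpha> k/2)|v|^2, exactly the v-term of the energy.\<close>

lemma damped_energy_ge:
  fixes v w p q :: "'h::real_inner"
  assumes \<tau>: "0 \<le> \<tau>" "\<tau> \<le> tau_max"
  defines "b \<equiv> \<delta> + \<tau> * c\<^sup>2"
  shows "\<tau> / 4 * (w \<bullet> w) + b / 2 * ((q + (c\<^sup>2 / b) *\<^sub>R p) \<bullet> (q + (c\<^sup>2 / b) *\<^sub>R p))
           \<le> damped_energy \<tau> v w p q"
proof -
  define k where "k = c\<^sup>2 / b"
  note co = coefficients[OF \<tau>, folded b_def, folded k_def]
  have "0 \<le> \<tau> / 4 * ((w + (2 * k) *\<^sub>R v) \<bullet> (w + (2 * k) *\<^sub>R v))"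
    using \<tau> by simp
  also have "\<dots> = \<tau> / 4 * (w \<bullet> w) + \<tau> * k * (w \<bullet> v) + (\<tau> * k) * (k * (v \<bullet> v))"
    by (simp add: algebra_simps inner_commute)
  also have "\<dots> \<le> \<tau> / 4 * (w \<bullet> w) + \<tau> * k * (w \<bullet> v) + \<alpha> / 2 * (k * (v \<bullet> v))"
    using co by (intro add_left_mono mult_right_mono) auto
  finally show ?thesis
    by (simp only: damped_energy_def Let_def b_def[symmetric] k_def[symmetric]) (simp add: algebra_simps)
qed

lemma damped_energy_ge_0:
  assumes \<tau>: "0 \<le> \<tau>" "\<tau> \<le> tau_max"
  shows "0 \<le> damped_energy \<tau> v w p q"
  by (rule order_trans[OF _ damped_energy_ge[OF \<tau>]]) (use coefficients[OF \<tau>] \<tau> in auto)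

text \<open>The w-v block completes to the square |\<tau> w + \<alpha> v|^2/(2 \<alpha>). The
  missing \<tau>^2/(2 \<alpha>) |w|^2 is paid by the share \<open>2 * tau_max / \<alpha>\<close> of
  the weight, so the share 2/\<alpha> of the energy survives.\<close>

lemma lyapunov_ge:
  assumes \<tau>: "0 \<le> \<tau>" "\<tau> \<le> tau_max"
  shows "2 / \<alpha> * damped_energy \<tau> v w p q + c\<^sup>2 / 2 * (p \<bullet> p) \<le> lyapunov \<tau> v w p q"
proof -
  let ?E = "damped_energy \<tau> v w p q" and ?m = "tau_max"
  have "\<tau> / 4 * (w \<bullet> w) \<le> ?E"
    by (rule order_trans[OF _ damped_energy_ge[OF \<tau>]]) (use coefficients[OF \<tau>] in auto)
  then have "2 * \<tau> / \<alpha> * (\<tau> / 4 * (w \<bullet> w)) \<le> 2 * ?m / \<alpha> * ?E"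
    using \<tau> \<alpha> damped_energy_ge_0[OF \<tau>]
    by (intro mult_mono) (auto simp: field_simps)
  moreover have "0 \<le> ((\<tau> *\<^sub>R w + \<alpha> *\<^sub>R v) \<bullet> (\<tau> *\<^sub>R w + \<alpha> *\<^sub>R v)) / (2 * \<alpha>)"
    using \<alpha> by simp
  moreover have "((\<tau> *\<^sub>R w + \<alpha> *\<^sub>R v) \<bullet> (\<tau> *\<^sub>R w + \<alpha> *\<^sub>R v)) / (2 * \<alpha>)
      = 2 * \<tau> / \<alpha> * (\<tau> / 4 * (w \<bullet> w)) + \<tau> * (w \<bullet> v) + \<alpha> / 2 * (v \<bullet> v)"
    using \<alpha> by (simp add: inner_add_left inner_add_right inner_commute[of v w] field_simps)
  moreover have "2 * (1 + ?m) / \<alpha> * ?E = 2 / \<alpha> * ?E + 2 * ?m / \<alpha> * ?E"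
    by (simp add: add_divide_distrib distrib_right distrib_left)
  ultimately show ?thesis unfolding lyapunov_def by linarith
qed

text \<open>Control of \<tau>|w|^2, which later absorbs the indefinite term \<tau> (w, z) in the
  comparison of two solutions.\<close>

lemma lyapunov_ge_w:
  assumes \<tau>: "0 \<le> \<tau>" "\<tau> \<le> tau_max"
  shows "\<tau> / (2 * \<alpha>) * (w \<bullet> w) \<le> lyapunov \<tau> v w p q"
proof -
  have "\<tau> / 4 * (w \<bullet> w) \<le> damped_energy \<tau> v w p q"
    by (rule order_trans[OF _ damped_energy_ge[OF \<tau>]]) (use coefficients[OF \<tau>] in auto)
  then have "2 / \<alpha> * (\<tau> / 4 * (w \<bullet> w)) \<le> 2 / \<alpha> * damped_energy \<tau> v w p q"
    using \<alpha> by (intro mult_left_mono) auto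
  moreover have "0 \<le> c\<^sup>2 / 2 * (p \<bullet> p)" by simp
  moreover have "2 / \<alpha> * (\<tau> / 4 * (w \<bullet> w)) = \<tau> / (2 * \<alpha>) * (w \<bullet> w)" by simp
  ultimately show ?thesis using lyapunov_ge[OF \<tau>, of v w p q] by linarith
qed

text \<open>The functional sees \<open>q\<close> only through y = q + k p, but it also controls
  \<open>p\<close>, so \<open>q\<close> is recovered from y - k p. The three constants stem from
  |p|^2, from 2|y|^2, and from 2 k^2 |p|^2 with k at most c^2/\<delta>.\<close>

lemma lyapunov_coercive:
  assumes \<tau>: "0 \<le> \<tau>" "\<tau> \<le> tau_max"
  shows "p \<bullet> p + q \<bullet> q \<le> (2 / c\<^sup>2 + 2 * \<alpha> / \<delta> + 4 * c\<^sup>2 / \<delta>\<^sup>2) * lyapunov \<tau> v w p q"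
proof -
  define b where "b = \<delta> + \<tau> * c\<^sup>2"
  define k where "k = c\<^sup>2 / b"
  define L where "L = lyapunov \<tau> v w p q"
  define y where "y = q + k *\<^sub>R p"
  note co = coefficients[OF \<tau>, folded b_def, folded k_def]
  have E: "b / 2 * (y \<bullet> y) \<le> damped_energy \<tau> v w p q"
    unfolding y_def k_def b_def
    by (rule order_trans[OF _ damped_energy_ge[OF \<tau>]]) (use \<tau> in auto)
  have "\<delta> / 2 * (y \<bullet> y) \<le> b / 2 * (y \<bullet> y)" using co by (intro mult_right_mono) auto
  with E have "2 / \<alpha> * (\<delta> / 2 * (y \<bullet> y)) \<le> 2 / \<alpha> * damped_energy \<tau> v w p q"
    using \<alpha> by (intro mult_left_mono) auto
  then have "\<delta> / \<alpha> * (y \<bullet> y) + c\<^sup>2 / 2 * (p \<bullet> p) \<le> L"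
    using lyapunov_ge[OF \<tau>, of v w p q] by (simp add: L_def)
  moreover have "0 \<le> \<delta> / \<alpha> * (y \<bullet> y)" "0 \<le> c\<^sup>2 / 2 * (p \<bullet> p)" using \<alpha> \<delta> by auto
  ultimately have y: "\<delta> / \<alpha> * (y \<bullet> y) \<le> L" and p: "c\<^sup>2 / 2 * (p \<bullet> p) \<le> L" by linarith+
  have y: "y \<bullet> y \<le> \<alpha> / \<delta> * L" using y \<alpha> \<delta> by (simp add: field_simps)
  have p: "p \<bullet> p \<le> 2 / c\<^sup>2 * L" using p c by (simp add: field_simps)
  have "q \<bullet> q \<le> 2 * (y \<bullet> y) + 2 * (k\<^sup>2 * (p \<bullet> p))"
    using inner_ge_zero[of "y + k *\<^sub>R p"]
    by (simp add: y_def algebra_simps inner_commute power2_eq_square)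
  also have "k\<^sup>2 * (p \<bullet> p) \<le> (c\<^sup>2 / \<delta>)\<^sup>2 * (2 / c\<^sup>2 * L)"
    using co p by (intro mult_mono power_mono) auto
  also have "(c\<^sup>2 / \<delta>)\<^sup>2 * (2 / c\<^sup>2 * L) = 2 * c\<^sup>2 / \<delta>\<^sup>2 * L"
    using c by (simp add: field_simps power2_eq_square)
  finally have "q \<bullet> q \<le> 2 * (y \<bullet> y) + 2 * (2 * c\<^sup>2 / \<delta>\<^sup>2 * L)" by simp
  moreover have "(2 / c\<^sup>2 + 2 * \<alpha> / \<delta> + 4 * c\<^sup>2 / \<delta>\<^sup>2) * L
      = 2 / c\<^sup>2 * L + 2 * (\<alpha> / \<delta> * L) + 2 * (2 * c\<^sup>2 / \<delta>\<^sup>2 * L)"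
    by (simp add: distrib_right)
  ultimately show ?thesis using y p unfolding L_def[symmetric] by linarith
qed

text \<open>Here \<kappa> and \<beta> are the largest values that k = c^2/b and b can take up to
  \<open>tau_max\<close>; each summand bounds one term of the functional.\<close>

definition upper_const :: real where
  "upper_const = (let \<kappa> = c\<^sup>2 / \<delta>; \<beta> = \<delta> + \<alpha> * \<delta> / 2 in
     2 * (1 + tau_max) / \<alpha> * (1 + tau_max * \<kappa>\<^sup>2 + \<alpha> * \<kappa> + \<beta> + \<beta> * \<kappa>\<^sup>2) + (1 + tau_max + \<alpha> + c\<^sup>2))"

lemma upper_const_nonneg: "0 \<le> upper_const"
  using tau_max_pos \<alpha> c \<delta> by (simp add: upper_const_def Let_def)

text \<open>On the right \<open>w\<close> carries the factor \<tau>. At \<tau> = 0 the bound thus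
  ignores the initial acceleration, which for the limit equation is not part of the data.\<close>

lemma lyapunov_le:
  fixes v w p q :: "'h::real_inner"
  assumes \<tau>: "0 \<le> \<tau>" "\<tau> \<le> tau_max"
  shows "lyapunov \<tau> v w p q \<le> upper_const * (\<tau> * (w \<bullet> w) + v \<bullet> v + p \<bullet> p + q \<bullet> q)"
proof -
  define m where "m = tau_max"
  define \<kappa> where "\<kappa> = c\<^sup>2 / \<delta>"
  define \<beta> where "\<beta> = \<delta> + \<alpha> * \<delta> / 2"
  define D where "D = 1 + m * \<kappa>\<^sup>2 + \<alpha> * \<kappa> + \<beta> + \<beta> * \<kappa>\<^sup>2"
  define F where "F = 1 + m + \<alpha> + c\<^sup>2"
  have C: "upper_const = 2 * (1 + m) / \<alpha> * D + F"
    by (simp only: upper_const_def Let_def m_def \<kappa>_def \<beta>_def D_def F_def)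
  have m: "m > 0" using tau_max_pos by (simp add: m_def)
  have \<kappa>: "\<kappa> > 0" "\<beta> > 0" using c \<delta> \<alpha> by (auto simp: \<kappa>_def \<beta>_def add_pos_pos)
  define b where "b = \<delta> + \<tau> * c\<^sup>2"
  define k where "k = c\<^sup>2 / b"
  note co = coefficients[OF \<tau>, folded b_def, folded k_def \<kappa>_def \<beta>_def]
  define S where "S = \<tau> * (w \<bullet> w) + v \<bullet> v + p \<bullet> p + q \<bullet> q"
  have S: "\<tau> * (w \<bullet> w) \<le> S" "v \<bullet> v \<le> S" "p \<bullet> p \<le> S" "q \<bullet> q \<le> S" "0 \<le> S"
    using \<tau> by (auto simp: S_def)
  have k2: "k\<^sup>2 \<le> \<kappa>\<^sup>2" using co by (intro power_mono) auto
  have "\<tau> * k * (w \<bullet> v) = \<tau> * (w \<bullet> (k *\<^sub>R v))" by simp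
  also have "\<dots> \<le> \<tau> * ((w \<bullet> w + (k *\<^sub>R v) \<bullet> (k *\<^sub>R v)) / 2)"
    using \<tau> by (intro mult_left_mono inner_le_half_sum(1))
  also have "\<dots> = \<tau> * (w \<bullet> w) / 2 + (\<tau> * k\<^sup>2) * (v \<bullet> v) / 2"
    by (simp add: algebra_simps power2_eq_square)
  also have "(\<tau> * k\<^sup>2) * (v \<bullet> v) / 2 \<le> (m * \<kappa>\<^sup>2) * S / 2"
    using \<tau> k2 m S by (intro divide_right_mono mult_mono) (auto simp: m_def)
  finally have 1: "\<tau> * k * (w \<bullet> v) \<le> \<tau> * (w \<bullet> w) / 2 + m * \<kappa>\<^sup>2 * S / 2" by simp
  have "\<alpha> * k / 2 * (v \<bullet> v) \<le> \<alpha> * \<kappa> / 2 * S"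
    using S co \<alpha> by (intro mult_mono) auto
  moreover have "(q + k *\<^sub>R p) \<bullet> (q + k *\<^sub>R p) \<le> 2 * (q \<bullet> q) + 2 * (k\<^sup>2 * (p \<bullet> p))"
    using inner_ge_zero[of "q - k *\<^sub>R p"] by (simp add: algebra_simps inner_commute power2_eq_square)
  moreover have "k\<^sup>2 * (p \<bullet> p) \<le> \<kappa>\<^sup>2 * S" using k2 S by (intro mult_mono) auto
  ultimately have 2: "\<alpha> * k / 2 * (v \<bullet> v) \<le> \<alpha> * \<kappa> / 2 * S"
    and 3: "(q + k *\<^sub>R p) \<bullet> (q + k *\<^sub>R p) \<le> 2 * S + 2 * (\<kappa>\<^sup>2 * S)"
    using S by auto
  have "b / 2 * ((q + k *\<^sub>R p) \<bullet> (q + k *\<^sub>R p)) \<le> \<beta> / 2 * (2 * S + 2 * (\<kappa>\<^sup>2 * S))"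
    using 3 co \<kappa> by (intro mult_mono) auto
  then have "damped_energy \<tau> v w p q
     \<le> \<tau> * (w \<bullet> w) + m * \<kappa>\<^sup>2 * S / 2 + \<alpha> * \<kappa> / 2 * S + \<beta> / 2 * (2 * S + 2 * (\<kappa>\<^sup>2 * S))"
    using 1 2 unfolding damped_energy_def Let_def b_def[symmetric] k_def[symmetric] by linarith
  also have "\<dots> \<le> S + m * \<kappa>\<^sup>2 * S + \<alpha> * \<kappa> * S + \<beta> / 2 * (2 * S + 2 * (\<kappa>\<^sup>2 * S))"
    using S m \<kappa> \<alpha> by (intro add_mono) auto
  also have "\<dots> = D * S" by (simp add: D_def algebra_simps)
  finally have E: "damped_energy \<tau> v w p q \<le> D * S" .
  have E': "2 * (1 + m) / \<alpha> * damped_energy \<tau> v w p q \<le> 2 * (1 + m) / \<alpha> * (D * S)"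
    using E m \<alpha> by (intro mult_left_mono) auto
  have "\<tau> * (w \<bullet> v) \<le> \<tau> * ((w \<bullet> w + v \<bullet> v) / 2)"
    using \<tau> by (intro mult_left_mono inner_le_half_sum(1))
  then have "\<tau> * (w \<bullet> v) \<le> (\<tau> * (w \<bullet> w) + \<tau> * (v \<bullet> v)) / 2"
    by (simp add: distrib_left)
  moreover have "\<tau> * (v \<bullet> v) \<le> m * S" using S \<tau> m by (intro mult_mono) (auto simp: m_def)
  moreover have "\<alpha> * (v \<bullet> v) \<le> \<alpha> * S" "c\<^sup>2 * (p \<bullet> p) \<le> c\<^sup>2 * S" using S \<alpha> by (auto intro!: mult_left_mono)
  moreover have "0 \<le> m * S" "0 \<le> \<alpha> * S" "0 \<le> c\<^sup>2 * S" using S m \<alpha> by auto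
  moreover have "\<alpha> / 2 * (v \<bullet> v) = \<alpha> * (v \<bullet> v) / 2" "c\<^sup>2 / 2 * (p \<bullet> p) = c\<^sup>2 * (p \<bullet> p) / 2" by simp_all
  moreover have "x + y + z \<le> S + M + A + K"
    if "x \<le> (w' + v') / 2" "v' \<le> M" "y = a / 2" "a \<le> A" "z = d / 2" "d \<le> K" "w' \<le> S" "0 \<le> S" "0 \<le> M" "0 \<le> A" "0 \<le> K"
    for x y z M A K w' v' a d :: real
    using that by simp
  ultimately have "\<tau> * (w \<bullet> v) + \<alpha> / 2 * (v \<bullet> v) + c\<^sup>2 / 2 * (p \<bullet> p)
      \<le> S + m * S + \<alpha> * S + c\<^sup>2 * S"
    using S by blast
  then have "2 * (1 + m) / \<alpha> * damped_energy \<tau> v w p q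
      + (\<tau> * (w \<bullet> v) + \<alpha> / 2 * (v \<bullet> v) + c\<^sup>2 / 2 * (p \<bullet> p))
      \<le> 2 * (1 + m) / \<alpha> * (D * S) + (S + m * S + \<alpha> * S + c\<^sup>2 * S)"
    by (rule add_mono[OF E'])
  moreover have "(2 * (1 + m) / \<alpha> * D + F) * S
      = 2 * (1 + m) / \<alpha> * (D * S) + (S + m * S + \<alpha> * S + c\<^sup>2 * S)"
    by (simp add: F_def distrib_right)
  ultimately show ?thesis
    by (simp only: lyapunov_def C m_def[symmetric] S_def[symmetric])
qed

end

text \<open>For a solution \<open>u\<close>, here \<open>v = u'\<close>, \<open>w = v'\<close>, \<open>g = w'\<close>, while \<open>p\<close>, \<open>q\<close>, \<open>s\<close> are the images of \<open>u\<close>, \<open>v\<close>, \<open>w\<close>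
  under the square root of \<open>A\<close>, and \<open>a = A (c\<^sup>2 u + b v)\<close>; the operator enters only through \<open>aw\<close> and \<open>av\<close>.
  The case \<open>\<tau> = 0\<close> is the limit equation; there \<open>w\<close> need not be differentiable and
  \<open>g\<close> is irrelevant.\<close>

locale mgt_curve = mgt_params \<alpha> c \<delta> for \<alpha> c \<delta> :: real +
  fixes \<tau> :: real and v w g p q s a :: "real \<Rightarrow> 'h::real_inner"
  assumes \<tau>: "0 \<le> \<tau>" "\<tau> \<le> tau_max"
    and dv: "0 \<le> t \<Longrightarrow> (v has_vector_derivative w t) (at t within {0..})"
    and dw: "0 \<le> t \<Longrightarrow> \<tau> \<noteq> 0 \<Longrightarrow> (w has_vector_derivative g t) (at t within {0..})"
    and dp: "0 \<le> t \<Longrightarrow> (p has_vector_derivative q t) (at t within {0..})"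
    and dq: "0 \<le> t \<Longrightarrow> (q has_vector_derivative s t) (at t within {0..})"
    and eq: "0 \<le> t \<Longrightarrow> \<tau> *\<^sub>R g t + \<alpha> *\<^sub>R w t + a t = 0"
    and aw: "0 \<le> t \<Longrightarrow> a t \<bullet> w t = (c\<^sup>2 *\<^sub>R p t + (\<delta> + \<tau> * c\<^sup>2) *\<^sub>R q t) \<bullet> s t"
    and av: "0 \<le> t \<Longrightarrow> a t \<bullet> v t = (c\<^sup>2 *\<^sub>R p t + (\<delta> + \<tau> * c\<^sup>2) *\<^sub>R q t) \<bullet> q t"
begin

definition lyap :: "real \<Rightarrow> real" where
  "lyap t = lyapunov \<tau> (v t) (w t) (p t) (q t)"

lemma tau_g: "0 \<le> t \<Longrightarrow> \<tau> *\<^sub>R g t = - \<alpha> *\<^sub>R w t - a t"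
proof -
  assume t: "0 \<le> t"
  have "\<tau> *\<^sub>R g t = (\<tau> *\<^sub>R g t + \<alpha> *\<^sub>R w t + a t) - \<alpha> *\<^sub>R w t - a t" by simp
  then show ?thesis unfolding eq[OF t] by simp
qed

text \<open>The equation eliminates \<tau> g, so one formula serves both equations. At \<tau> = 0
  both sides vanish, because the equation then says \<alpha> w + a = 0, and no derivative of
  \<open>w\<close> is taken.\<close>

lemma tau_w_derivative:
  assumes "0 \<le> t" and "(f has_vector_derivative f') (at t within {0..})"
  shows "((\<lambda>t. \<tau> * (w t \<bullet> f t)) has_real_derivative \<tau> * (w t \<bullet> f') + (- \<alpha> *\<^sub>R w t - a t) \<bullet> f t) (at t within {0..})"
proof (cases "\<tau> = 0")
  case True
  then have "- \<alpha> *\<^sub>R w t - a t = 0" using tau_g[OF assms(1)] by simp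
  then show ?thesis unfolding True by simp
next
  case False
  have "((\<lambda>t. \<tau> * (w t \<bullet> f t)) has_real_derivative \<tau> * (w t \<bullet> f' + g t \<bullet> f t)) (at t within {0..})"
    by (rule DERIV_cmult[OF inner_has_real_derivative[OF dw[OF assms(1) False] assms(2)]])
  moreover have "\<tau> * (w t \<bullet> f' + g t \<bullet> f t) = \<tau> * (w t \<bullet> f') + (\<tau> *\<^sub>R g t) \<bullet> f t"
    by (simp add: algebra_simps)
  ultimately show ?thesis by (simp only: tau_g[OF assms(1)])
qed

lemma tau_ww_derivative:
  assumes "0 \<le> t"
  shows "((\<lambda>t. \<tau> * (w t \<bullet> w t)) has_real_derivative 2 * ((- \<alpha> *\<^sub>R w t - a t) \<bullet> w t)) (at t within {0..})"
proof (cases "\<tau> = 0")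
  case True
  then have "- \<alpha> *\<^sub>R w t - a t = 0" using tau_g[OF assms(1)] by simp
  then show ?thesis unfolding True by simp
next
  case False
  have "((\<lambda>t. \<tau> * (w t \<bullet> w t)) has_real_derivative \<tau> * (w t \<bullet> g t + g t \<bullet> w t)) (at t within {0..})"
    by (rule DERIV_cmult[OF inner_has_real_derivative[OF dw[OF assms False] dw[OF assms False]]])
  moreover have "\<tau> * (w t \<bullet> g t + g t \<bullet> w t) = 2 * ((\<tau> *\<^sub>R g t) \<bullet> w t)"
    by (simp add: algebra_simps inner_commute)
  ultimately show ?thesis by (simp only: tau_g[OF assms(1)])
qed

lemma lyap_derivative:
  assumes t: "0 \<le> t"
  obtains d where "(lyap has_real_derivative d) (at t within {0..})"
    "d \<le> - (w t \<bullet> w t) - \<delta> * (q t \<bullet> q t)"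
proof -
  define b where "b = \<delta> + \<tau> * c\<^sup>2"
  define k where "k = c\<^sup>2 / b"
  define m where "m = tau_max"
  note co = coefficients[OF \<tau>, folded b_def, folded k_def]
  have bk: "b * k = c\<^sup>2" using co by (simp add: k_def)
  let ?r = "- \<alpha> *\<^sub>R w t - a t"
  define y where "y t = q t + k *\<^sub>R p t" for t
  have dy: "(y has_vector_derivative s t + k *\<^sub>R q t) (at t within {0..})"
    unfolding y_def
    by (intro has_vector_derivative_add dq t
        bounded_linear.has_vector_derivative[OF bounded_linear_scaleR_right] dp)
  have "lyap = (\<lambda>t. 2 * (1 + m) / \<alpha> * (1 / 2 * (\<tau> * (w t \<bullet> w t)) + k * (\<tau> * (w t \<bullet> v t))
        + \<alpha> * k / 2 * (v t \<bullet> v t) + b / 2 * (y t \<bullet> y t))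
      + (\<tau> * (w t \<bullet> v t) + \<alpha> / 2 * (v t \<bullet> v t) + c\<^sup>2 / 2 * (p t \<bullet> p t)))"
    by (rule ext) (simp only: lyap_def lyapunov_def damped_energy_def Let_def y_def
        m_def[symmetric] b_def[symmetric] k_def[symmetric], simp)
  moreover have "(\<dots> has_real_derivative 2 * (1 + m) / \<alpha> * (1 / 2 * (2 * (?r \<bullet> w t)) + k * (\<tau> * (w t \<bullet> w t) + ?r \<bullet> v t)
        + \<alpha> * k / 2 * (v t \<bullet> w t + w t \<bullet> v t) + b / 2 * (y t \<bullet> (s t + k *\<^sub>R q t) + (s t + k *\<^sub>R q t) \<bullet> y t))
      + ((\<tau> * (w t \<bullet> w t) + ?r \<bullet> v t) + \<alpha> / 2 * (v t \<bullet> w t + w t \<bullet> v t) + c\<^sup>2 / 2 * (p t \<bullet> q t + q t \<bullet> p t)))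
      (at t within {0..})" (is "(_ has_real_derivative ?d) _")
    by (intro DERIV_add DERIV_cmult tau_w_derivative tau_ww_derivative inner_has_real_derivative dv dp dq dy t)
  ultimately have "(lyap has_real_derivative ?d) (at t within {0..})" by (simp only:)
  moreover have "?d \<le> - (w t \<bullet> w t) - \<delta> * (q t \<bullet> q t)"
  proof -
    \<comment> \<open>Since b k = c^2, the vector c^2 p + b q is b y.\<close>
    have aw': "a t \<bullet> w t = b * (y t \<bullet> s t)" and av': "a t \<bullet> v t = b * (y t \<bullet> q t)"
      using aw[OF t] av[OF t] bk by (simp_all add: y_def algebra_simps flip: b_def)
    \<comment> \<open>The multiplier w + k v: its elastic contribution cancels the derivative of
      (b/2)|y|^2, and the mixed w-v terms cancel as well. Only the effective damping
      remains.\<close>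
    have e1: "1 / 2 * (2 * (?r \<bullet> w t)) + k * (\<tau> * (w t \<bullet> w t) + ?r \<bullet> v t)
        + \<alpha> * k / 2 * (v t \<bullet> w t + w t \<bullet> v t) + b / 2 * (y t \<bullet> (s t + k *\<^sub>R q t) + (s t + k *\<^sub>R q t) \<bullet> y t)
        = - (\<alpha> - \<tau> * k) * (w t \<bullet> w t)"
      by (simp add: aw' av' inner_commute[of "s t" "y t"]
          inner_commute[of "q t" "y t"] inner_commute[of "v t" "w t"] algebra_simps)
    have "y t \<bullet> q t = q t \<bullet> q t + k * (p t \<bullet> q t)" by (simp add: y_def inner_add_left)
    then have "a t \<bullet> v t = b * (q t \<bullet> q t) + b * k * (p t \<bullet> q t)" by (simp add: av' algebra_simps)
    \<comment> \<open>The multiplier v: the stress contributes b|q|^2 and c^2 (p, q); the latter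
      cancels the derivative of (c^2/2)|p|^2.\<close>
    then have e2: "(\<tau> * (w t \<bullet> w t) + ?r \<bullet> v t) + \<alpha> / 2 * (v t \<bullet> w t + w t \<bullet> v t)
        + c\<^sup>2 / 2 * (p t \<bullet> q t + q t \<bullet> p t) = \<tau> * (w t \<bullet> w t) - b * (q t \<bullet> q t)"
      by (simp add: bk inner_commute[of "q t" "p t"] inner_commute[of "v t" "w t"] algebra_simps)
    \<comment> \<open>The weight times \<alpha>/2 is 1 + m, and m is at least \<tau>; this is where
      the coefficient 1 of the dissipation |w|^2 comes from.\<close>
    have "\<alpha> / 2 \<le> \<alpha> - \<tau> * k" using co by linarith
    then have "2 * (1 + m) / \<alpha> * (\<alpha> / 2) \<le> 2 * (1 + m) / \<alpha> * (\<alpha> - \<tau> * k)"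
      using \<alpha> tau_max_pos by (intro mult_left_mono) (auto simp: m_def)
    moreover have "2 * (1 + m) / \<alpha> * (\<alpha> / 2) = 1 + m" using \<alpha> by simp
    moreover have "\<tau> \<le> m" using \<tau> by (simp add: m_def)
    ultimately have "1 \<le> 2 * (1 + m) / \<alpha> * (\<alpha> - \<tau> * k) - \<tau>" by linarith
    then have f1: "1 * (w t \<bullet> w t) \<le> (2 * (1 + m) / \<alpha> * (\<alpha> - \<tau> * k) - \<tau>) * (w t \<bullet> w t)"
      by (intro mult_right_mono) auto
    have f2: "\<delta> * (q t \<bullet> q t) \<le> b * (q t \<bullet> q t)" using co by (intro mult_right_mono) auto
    have e3: "2 * (1 + m) / \<alpha> * (- (\<alpha> - \<tau> * k) * (w t \<bullet> w t)) + (\<tau> * (w t \<bullet> w t) - b * (q t \<bullet> q t))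
        = - ((2 * (1 + m) / \<alpha> * (\<alpha> - \<tau> * k) - \<tau>) * (w t \<bullet> w t)) - b * (q t \<bullet> q t)"
      by (simp only: left_diff_distrib)
    show ?thesis unfolding e1 e2 e3
      by (rule diff_mono[OF le_imp_neg_le[OF f1[unfolded mult_1]] f2])
  qed
  ultimately show thesis using that by blast
qed

lemma lyap_le_initial:
  assumes t: "0 \<le> t"
  shows "lyap t \<le> lyap 0"
proof -
  have "\<exists>d. (lyap has_real_derivative d) (at t within {0..}) \<and> d \<le> 0" if t: "0 \<le> t" for t
  proof -
    obtain d where "(lyap has_real_derivative d) (at t within {0..})"
      "d \<le> - (w t \<bullet> w t) - \<delta> * (q t \<bullet> q t)" using lyap_derivative[OF t] .
    moreover have "0 \<le> w t \<bullet> w t" "0 \<le> \<delta> * (q t \<bullet> q t)" using \<delta> by auto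
    ultimately show ?thesis by (intro exI[of _ d]) linarith
  qed
  then obtain d where "\<And>t. 0 \<le> t \<Longrightarrow> (lyap has_real_derivative d t) (at t within {0..}) \<and> d t \<le> 0"
    by metis
  then show ?thesis using nonincreasing_from_zero[of lyap d t] t by blast
qed

end

lemma (in mgt_curve) lyap_nonneg: "0 \<le> lyap t"
  using lyapunov_ge_w[OF \<tau>, of "w t" "v t" "p t" "q t"] \<tau> \<alpha>
  by (intro order_trans[OF _ lyapunov_ge_w[OF \<tau>, of "w t" "v t" "p t" "q t", folded lyap_def]]) auto

section \<open>Comparison of a relaxed solution with a limit solution\<close>

locale mgt_pair =
  m: mgt_curve \<alpha> c \<delta> \<tau> v w g p q s a + l: mgt_curve \<alpha> c \<delta> 0 v\<^sub>0 w\<^sub>0 g\<^sub>0 p\<^sub>0 q\<^sub>0 s\<^sub>0 a\<^sub>0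
  for \<alpha> c \<delta> \<tau> :: real and v w g p q s a v\<^sub>0 w\<^sub>0 g\<^sub>0 p\<^sub>0 q\<^sub>0 s\<^sub>0 a\<^sub>0 :: "real \<Rightarrow> 'h::real_inner" +
  assumes init: "v 0 = v\<^sub>0 0" "p 0 = p\<^sub>0 0"
    and cross: "0 \<le> t \<Longrightarrow> a t \<bullet> v\<^sub>0 t = (c\<^sup>2 *\<^sub>R p t + (\<delta> + \<tau> * c\<^sup>2) *\<^sub>R q t) \<bullet> q\<^sub>0 t"
      "0 \<le> t \<Longrightarrow> a\<^sub>0 t \<bullet> v t = (c\<^sup>2 *\<^sub>R p\<^sub>0 t + \<delta> *\<^sub>R q\<^sub>0 t) \<bullet> q t"
begin

text \<open>The first two terms are the energy of the limit equation for the difference. Adding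
  \<tau> (w, z) replaces the uncontrolled \<tau> (w', z) by \<tau> (w, w -
  \<open>w\<^sub>0\<close>), which needs only what the dissipation of the two functionals
  controls.\<close>

lemma difference_derivative:
  assumes t: "0 \<le> t"
  obtains d where "((\<lambda>t. \<alpha> / 2 * ((v t - v\<^sub>0 t) \<bullet> (v t - v\<^sub>0 t)) + c\<^sup>2 / 2 * ((p t - p\<^sub>0 t) \<bullet> (p t - p\<^sub>0 t))
        + \<tau> * (w t \<bullet> (v t - v\<^sub>0 t))) has_real_derivative d) (at t within {0..})"
    "d \<le> \<tau> * (2 * (w t \<bullet> w t) + w\<^sub>0 t \<bullet> w\<^sub>0 t + \<alpha> * c\<^sup>2 / 8 * (q t \<bullet> q t))"
proof -
  define z where "z t = v t - v\<^sub>0 t" for t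
  define y where "y t = p t - p\<^sub>0 t" for t
  define x where "x = q t - q\<^sub>0 t"
  have dz: "(z has_vector_derivative w t - w\<^sub>0 t) (at t within {0..})"
    unfolding z_def by (intro has_vector_derivative_diff m.dv l.dv t)
  have dy: "(y has_vector_derivative x) (at t within {0..})"
    unfolding y_def x_def by (intro has_vector_derivative_diff m.dp l.dp t)
  let ?d = "\<alpha> / 2 * (z t \<bullet> (w t - w\<^sub>0 t) + (w t - w\<^sub>0 t) \<bullet> z t) + c\<^sup>2 / 2 * (y t \<bullet> x + x \<bullet> y t)
        + (\<tau> * (w t \<bullet> (w t - w\<^sub>0 t)) + (- \<alpha> *\<^sub>R w t - a t) \<bullet> z t)"
  have "((\<lambda>t. \<alpha> / 2 * (z t \<bullet> z t) + c\<^sup>2 / 2 * (y t \<bullet> y t) + \<tau> * (w t \<bullet> z t)) has_real_derivative ?d) (at t within {0..})"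
    by (intro DERIV_add DERIV_cmult m.tau_w_derivative inner_has_real_derivative dz dy t)
  moreover have "?d \<le> \<tau> * (2 * (w t \<bullet> w t) + w\<^sub>0 t \<bullet> w\<^sub>0 t + \<alpha> * c\<^sup>2 / 8 * (q t \<bullet> q t))"
  proof -
    have "\<alpha> *\<^sub>R w\<^sub>0 t = - a\<^sub>0 t"
      using l.eq[OF t] by (simp add: add_eq_0_iff2)
    then have w0: "\<alpha> * (w\<^sub>0 t \<bullet> z t) = - (a\<^sub>0 t \<bullet> z t)"
      by (metis inner_minus_left inner_scaleR_left)
    \<comment> \<open>The coefficient b exceeds \<delta> by \<tau> c^2; this leaves the second
      source of error, the term with \<open>q t\<close>. The identities \<open>cross\<close> supply
      the mixed pairings.\<close>
    have "(a t - a\<^sub>0 t) \<bullet> z t = (c\<^sup>2 *\<^sub>R y t + \<delta> *\<^sub>R x + (\<tau> * c\<^sup>2) *\<^sub>R q t) \<bullet> x"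
      using m.av[OF t] l.av[OF t] cross[OF t]
      by (simp add: z_def x_def y_def inner_diff_left inner_diff_right inner_add_left algebra_simps)
    then have e: "?d = \<tau> * (w t \<bullet> (w t - w\<^sub>0 t)) - \<delta> * (x \<bullet> x) - \<tau> * c\<^sup>2 * (q t \<bullet> x)"
      using w0 by (simp add: inner_diff_left inner_diff_right inner_add_left inner_add_right
          inner_commute[of "z t" "w t"] inner_commute[of "z t" "w\<^sub>0 t"] inner_commute[of x "y t"] field_simps)
    have "w t \<bullet> (w t - w\<^sub>0 t) \<le> 2 * (w t \<bullet> w t) + w\<^sub>0 t \<bullet> w\<^sub>0 t"
    proof -
      have "x - y \<le> 2 * x + z" if "0 \<le> x" "0 \<le> z" "- y \<le> (x + z) / 2" for x y z :: real
        using that by simp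
      then show ?thesis
        unfolding inner_diff_right using inner_le_half_sum(2)[of "w t" "w\<^sub>0 t"] inner_ge_zero by blast
    qed
    then have 1: "\<tau> * (w t \<bullet> (w t - w\<^sub>0 t)) \<le> \<tau> * (2 * (w t \<bullet> w t) + w\<^sub>0 t \<bullet> w\<^sub>0 t)"
      using m.\<tau> by (intro mult_left_mono)
    \<comment> \<open>The shift that completes the square in \<delta>|x|^2 + \<tau> c^2 (q, x). The
      remainder \<delta> r^2 |q|^2 carries \<tau>^2; spending one factor through \<tau> c^2 \<le>
      \<alpha> \<delta>/2 gives \<tau> \<alpha> c^2/8.\<close>
    define r where "r = \<tau> * c\<^sup>2 / (2 * \<delta>)"
    have "0 \<le> \<delta> * ((x + r *\<^sub>R q t) \<bullet> (x + r *\<^sub>R q t))" using m.\<delta> by simp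
    also have "\<dots> = \<delta> * (x \<bullet> x) + 2 * \<delta> * r * (q t \<bullet> x) + \<delta> * r * r * (q t \<bullet> q t)"
      by (simp add: inner_add_left inner_add_right inner_commute[of x "q t"] algebra_simps)
    also have "2 * \<delta> * r = \<tau> * c\<^sup>2" using m.\<delta> by (simp add: r_def)
    finally have 2: "- \<delta> * (x \<bullet> x) - \<tau> * c\<^sup>2 * (q t \<bullet> x) \<le> \<delta> * r * r * (q t \<bullet> q t)" by simp
    have "\<tau> * c\<^sup>2 \<le> \<alpha> * \<delta> / 2" using m.\<tau> m.c by (simp add: m.tau_max_def field_simps)
    then have "\<tau> * c\<^sup>2 * (\<tau> * c\<^sup>2) \<le> \<alpha> * \<delta> / 2 * (\<tau> * c\<^sup>2)"
      using m.\<tau> by (intro mult_right_mono) auto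
    then have "\<delta> * r * r \<le> \<tau> * (\<alpha> * c\<^sup>2 / 8)"
      using m.\<delta> by (simp add: r_def field_simps power2_eq_square)
    then have "\<delta> * r * r * (q t \<bullet> q t) \<le> \<tau> * (\<alpha> * c\<^sup>2 / 8) * (q t \<bullet> q t)"
      by (intro mult_right_mono) auto
    then show ?thesis unfolding e using 1 2 by (simp add: distrib_left mult.assoc)
  qed
  ultimately show thesis using that unfolding z_def y_def by blast
qed

text \<open>The constant K is chosen so that K times the joint dissipation |w|^2 + \<delta>|q|^2 +
  \<open>|w\<^sub>0|\<close>^2 dominates the right side of \<open>difference_derivative\<close>
  divided by \<tau>. Hence Z + K \<tau> (sum of both functionals) cannot grow.\<close>

lemma difference_bound:
  assumes t: "0 \<le> t"
  shows "\<alpha> / 4 * ((v t - v\<^sub>0 t) \<bullet> (v t - v\<^sub>0 t)) + c\<^sup>2 / 2 * ((p t - p\<^sub>0 t) \<bullet> (p t - p\<^sub>0 t))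
     \<le> (2 + \<alpha> * c\<^sup>2 / (8 * \<delta>)) * \<tau> * (m.lyap 0 + l.lyap 0)"
proof -
  define K where "K = 2 + \<alpha> * c\<^sup>2 / (8 * \<delta>)"
  define Z where "Z t = \<alpha> / 2 * ((v t - v\<^sub>0 t) \<bullet> (v t - v\<^sub>0 t)) + c\<^sup>2 / 2 * ((p t - p\<^sub>0 t) \<bullet> (p t - p\<^sub>0 t))
        + \<tau> * (w t \<bullet> (v t - v\<^sub>0 t))" for t
  define M where "M t = Z t + K * \<tau> * (m.lyap t + l.lyap t)" for t
  have K: "K \<ge> 2" "K * \<delta> \<ge> \<alpha> * c\<^sup>2 / 8" using m.\<alpha> m.\<delta> by (auto simp: K_def distrib_right)
  have "\<exists>d. (M has_real_derivative d) (at t within {0..}) \<and> d \<le> 0" if t: "0 \<le> t" for t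
  proof -
    obtain d\<^sub>1 where d1: "(m.lyap has_real_derivative d\<^sub>1) (at t within {0..})"
      "d\<^sub>1 \<le> - (w t \<bullet> w t) - \<delta> * (q t \<bullet> q t)" using m.lyap_derivative[OF t] .
    obtain d\<^sub>2 where d2: "(l.lyap has_real_derivative d\<^sub>2) (at t within {0..})"
      "d\<^sub>2 \<le> - (w\<^sub>0 t \<bullet> w\<^sub>0 t) - \<delta> * (q\<^sub>0 t \<bullet> q\<^sub>0 t)" using l.lyap_derivative[OF t] .
    obtain d where d: "(Z has_real_derivative d) (at t within {0..})"
      "d \<le> \<tau> * (2 * (w t \<bullet> w t) + w\<^sub>0 t \<bullet> w\<^sub>0 t + \<alpha> * c\<^sup>2 / 8 * (q t \<bullet> q t))"
      unfolding Z_def using difference_derivative[OF t] .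
    have "0 \<le> \<delta> * (q\<^sub>0 t \<bullet> q\<^sub>0 t)" using m.\<delta> by simp
    then have "K * (d\<^sub>1 + d\<^sub>2) \<le> K * (- (w t \<bullet> w t) - \<delta> * (q t \<bullet> q t) - (w\<^sub>0 t \<bullet> w\<^sub>0 t))"
      using d1 d2 K by (intro mult_left_mono) auto
    also have "\<dots> = - (K * (w t \<bullet> w t)) - (K * \<delta>) * (q t \<bullet> q t) - K * (w\<^sub>0 t \<bullet> w\<^sub>0 t)"
      by (simp add: algebra_simps)
    also have "\<dots> \<le> - (2 * (w t \<bullet> w t)) - \<alpha> * c\<^sup>2 / 8 * (q t \<bullet> q t) - 1 * (w\<^sub>0 t \<bullet> w\<^sub>0 t)"
      using K by (intro diff_mono le_imp_neg_le mult_right_mono) auto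
    finally have "\<tau> * (K * (d\<^sub>1 + d\<^sub>2)) \<le> \<tau> * (- (2 * (w t \<bullet> w t)) - \<alpha> * c\<^sup>2 / 8 * (q t \<bullet> q t) - 1 * (w\<^sub>0 t \<bullet> w\<^sub>0 t))"
      using m.\<tau> by (intro mult_left_mono)
    then have "d + K * \<tau> * (d\<^sub>1 + d\<^sub>2) \<le> 0"
      using d(2) by (simp add: algebra_simps)
    moreover have "(M has_real_derivative (d + K * \<tau> * (d\<^sub>1 + d\<^sub>2))) (at t within {0..})"
      unfolding M_def by (intro DERIV_add DERIV_cmult d d1 d2)
    ultimately show ?thesis by blast
  qed
  then obtain d where "\<And>t. 0 \<le> t \<Longrightarrow> (M has_real_derivative d t) (at t within {0..}) \<and> d t \<le> 0"
    by metis
  then have "M t \<le> M 0" using nonincreasing_from_zero[of M d t] t by blast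
  \<comment> \<open>The mismatch of the initial accelerations is invisible here: \<open>w\<close> is
    multiplied by the velocity difference, which starts from 0.\<close>
  moreover have "Z 0 = 0" by (simp add: Z_def init)
  moreover have "\<alpha> / 4 * ((v t - v\<^sub>0 t) \<bullet> (v t - v\<^sub>0 t)) + c\<^sup>2 / 2 * ((p t - p\<^sub>0 t) \<bullet> (p t - p\<^sub>0 t)) \<le> M t"
  proof -
    define z where "z = v t - v\<^sub>0 t"
    have "\<tau> / (2 * \<alpha>) * (w t \<bullet> w t) \<le> m.lyap t + l.lyap t"
      using add_mono[OF m.lyapunov_ge_w[OF m.\<tau>, of "w t" "v t" "p t" "q t", folded m.lyap_def] l.lyap_nonneg[of t]]
      unfolding add_0_right .
    then have "\<tau> * (\<tau> / (2 * \<alpha>) * (w t \<bullet> w t)) \<le> \<tau> * (m.lyap t + l.lyap t)"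
      using m.\<tau> by (intro mult_left_mono)
    then have "2 * (\<tau> * (\<tau> / (2 * \<alpha>) * (w t \<bullet> w t))) \<le> K * (\<tau> * (m.lyap t + l.lyap t))"
      by (rule mult_mono[OF K(1)]) (use K m.\<tau> m.\<alpha> in auto)
    then have 1: "\<tau> * \<tau> / \<alpha> * (w t \<bullet> w t) \<le> K * \<tau> * (m.lyap t + l.lyap t)"
      by (simp add: mult_ac)
    \<comment> \<open>Half of (\<alpha>/2)|z|^2 is given up to absorb \<tau> (w, z). The leftover
      (\<tau>^2/\<alpha>)|w|^2 is covered by the functional, where K \<ge> 2 is used a second
      time.\<close>
    have "0 \<le> \<alpha> / 4 * ((z + (2 * \<tau> / \<alpha>) *\<^sub>R w t) \<bullet> (z + (2 * \<tau> / \<alpha>) *\<^sub>R w t))"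
      using m.\<alpha> by simp
    also have "\<dots> = \<alpha> / 4 * (z \<bullet> z) + \<tau> * (w t \<bullet> z) + \<tau> * \<tau> / \<alpha> * (w t \<bullet> w t)"
      using m.\<alpha> by (simp add: inner_add_left inner_add_right inner_commute[of z "w t"] field_simps)
    finally show ?thesis using 1 unfolding M_def Z_def z_def[symmetric] by simp
  qed
  ultimately show ?thesis by (simp add: M_def K_def)
qed

end

section \<open>Self-adjoint operators and their resolvents\<close>

text \<open>A chain rule for bounded linear maps that are linear only on a subspace of the type: it
  suffices that the remainder of \<open>g\<close> is dominated by that of \<open>f\<close>. It
  serves for the resolvent and for the inverse of the square root.\<close>

lemma has_vector_derivative_dominated:
  fixes f :: "real \<Rightarrow> 'a::real_normed_vector" and g :: "real \<Rightarrow> 'b::real_normed_vector"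
  assumes f: "(f has_vector_derivative f') (at t within S)"
    and le: "\<And>s. s \<in> S \<Longrightarrow> norm (g s - g t - (s - t) *\<^sub>R g') \<le> B * norm (f s - f t - (s - t) *\<^sub>R f')"
  shows "(g has_vector_derivative g') (at t within S)"
proof -
  let ?F = "\<lambda>s. B * norm ((1 / norm (s - t)) *\<^sub>R (f s - (f t + (s - t) *\<^sub>R f')))"
  have "((\<lambda>s. (1 / norm (s - t)) *\<^sub>R (g s - (g t + (s - t) *\<^sub>R g'))) \<longlongrightarrow> 0) (at t within S)"
  proof (rule Lim_null_comparison)
    show "\<forall>\<^sub>F s in at t within S. norm ((1 / norm (s - t)) *\<^sub>R (g s - (g t + (s - t) *\<^sub>R g'))) \<le> ?F s"
      unfolding eventually_at_filter
    proof (intro always_eventually allI impI)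
      fix s assume "s \<in> S"
      then have "1 / norm (s - t) * norm (g s - g t - (s - t) *\<^sub>R g')
          \<le> 1 / norm (s - t) * (B * norm (f s - f t - (s - t) *\<^sub>R f'))"
        by (intro mult_left_mono le) auto
      then show "norm ((1 / norm (s - t)) *\<^sub>R (g s - (g t + (s - t) *\<^sub>R g'))) \<le> ?F s"
        by (simp add: diff_diff_eq)
    qed
    have "((\<lambda>s. (1 / norm (s - t)) *\<^sub>R (f s - (f t + (s - t) *\<^sub>R f'))) \<longlongrightarrow> 0) (at t within S)"
      using f by (simp add: has_vector_derivative_def has_derivative_within)
    then have "((\<lambda>s. norm ((1 / norm (s - t)) *\<^sub>R (f s - (f t + (s - t) *\<^sub>R f')))) \<longlongrightarrow> 0) (at t within S)"
      by (rule tendsto_norm_zero)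
    then show "(?F \<longlongrightarrow> 0) (at t within S)" by (rule tendsto_mult_right_zero)
  qed
  then show ?thesis
    by (simp add: has_vector_derivative_def has_derivative_within bounded_linear_scaleR_left)
qed

text \<open>Only the subspace is complete, not the type. A minimising sequence is Cauchy by the
  parallelogram law, since midpoints stay in \<open>K\<close> and cannot beat the infimum d.\<close>

lemma orthogonal_projection_exists:
  fixes K :: "'k::real_inner set"
  assumes K: "subspace K" "complete K"
  obtains p where "p \<in> K" "\<And>k. k \<in> K \<Longrightarrow> (z - p) \<bullet> k = 0"
proof -
  define d where "d = (INF k\<in>K. (norm (z - k))\<^sup>2)"
  have ne: "K \<noteq> {}" using subspace_0[OF K(1)] by blast
  have bb: "bdd_below ((\<lambda>k. (norm (z - k))\<^sup>2) ` K)" by (rule bdd_belowI2[of _ 0]) simp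
  have dle: "d \<le> (norm (z - k))\<^sup>2" if "k \<in> K" for k
    unfolding d_def by (rule cINF_lower[OF bb that])
  have "\<exists>x. x \<in> K \<and> (norm (z - x))\<^sup>2 < d + inverse (real (Suc n))" for n
  proof -
    have "d < d + inverse (real (Suc n))" by simp
    then show ?thesis unfolding d_def using cINF_less_iff[OF ne bb] by blast
  qed
  then obtain x where x: "\<And>n. x n \<in> K" "\<And>n. (norm (z - x n))\<^sup>2 < d + inverse (real (Suc n))"
    by metis
  have par: "(norm (x n - x m))\<^sup>2 \<le> 2 * inverse (real (Suc n)) + 2 * inverse (real (Suc m))" for n m
  proof -
    have "(1/2) *\<^sub>R (x n + x m) \<in> K" using K x by (intro subspace_scale subspace_add)
    then have "d \<le> (norm (z - (1/2) *\<^sub>R (x n + x m)))\<^sup>2" by (rule dle)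
    moreover have "(norm (x n - x m))\<^sup>2 + 4 * (norm (z - (1/2) *\<^sub>R (x n + x m)))\<^sup>2
        = 2 * (norm (z - x n))\<^sup>2 + 2 * (norm (z - x m))\<^sup>2"
    proof -
      define a b where "a = z - x n" and "b = z - x m"
      have "2 *\<^sub>R (z - (1/2) *\<^sub>R (x n + x m)) = a + b"
        by (simp add: a_def b_def scaleR_2 scaleR_diff_right)
      then have "(norm (a + b))\<^sup>2 = 4 * (norm (z - (1/2) *\<^sub>R (x n + x m)))\<^sup>2"
        by (metis norm_scaleR power_mult_distrib abs_numeral power2_eq_square mult_2 numeral_Bit0 mult_numeral_1)
      moreover have "x n - x m = b - a" by (simp add: a_def b_def)
      moreover have "(norm (b - a))\<^sup>2 + (norm (a + b))\<^sup>2 = 2 * (norm a)\<^sup>2 + 2 * (norm b)\<^sup>2"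
        unfolding power2_norm_eq_inner inner_add_left inner_add_right inner_diff_left inner_diff_right by simp
      ultimately show ?thesis by (simp only: a_def b_def)
    qed
    ultimately show ?thesis using x(2)[of n] x(2)[of m] by linarith
  qed
  have "Cauchy x"
  proof (rule CauchyI)
    fix e :: real assume e: "0 < e"
    then obtain M where M: "inverse (real (Suc M)) < e\<^sup>2 / 4"
      using reals_Archimedean[of "e\<^sup>2 / 4"] by auto
    have "norm (x m - x n) < e" if "m \<ge> M" "n \<ge> M" for m n
    proof -
      have "inverse (real (Suc m)) \<le> inverse (real (Suc M))" "inverse (real (Suc n)) \<le> inverse (real (Suc M))"
        using that by auto
      then have "(norm (x m - x n))\<^sup>2 < e\<^sup>2" using par[of m n] M by linarith
      then show ?thesis using e by (simp add: power2_less_imp_less)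
    qed
    then show "\<exists>M. \<forall>m\<ge>M. \<forall>n\<ge>M. norm (x m - x n) < e" by blast
  qed
  then obtain p where p: "p \<in> K" "x \<longlonglongrightarrow> p"
    using K(2) x(1) unfolding complete_def by blast
  have "(\<lambda>n. (norm (z - x n))\<^sup>2) \<longlonglongrightarrow> (norm (z - p))\<^sup>2"
    by (intro tendsto_intros p)
  moreover have "(\<lambda>n. d + inverse (real (Suc n))) \<longlonglongrightarrow> d + 0"
    by (intro tendsto_intros LIMSEQ_inverse_real_of_nat)
  ultimately have "(norm (z - p))\<^sup>2 \<le> d + 0"
    by (rule LIMSEQ_le) (use x(2) in \<open>auto intro: less_imp_le\<close>)
  then have pd: "(norm (z - p))\<^sup>2 \<le> d" by simp
  have "(z - p) \<bullet> k = 0" if k: "k \<in> K" for k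
  proof (cases "k = 0")
    case False
    \<comment> \<open>The step length that minimises the distance along \<open>k\<close>. Unless the
      inner product is 0, it would lead below d.\<close>
    define a where "a = ((z - p) \<bullet> k) / (k \<bullet> k)"
    have "p + a *\<^sub>R k \<in> K" using K p k by (intro subspace_add subspace_scale)
    then have "(norm (z - p))\<^sup>2 \<le> (norm (z - (p + a *\<^sub>R k)))\<^sup>2" by (rule order_trans[OF pd dle])
    also have "\<dots> = (norm ((z - p) - a *\<^sub>R k))\<^sup>2" by (simp add: diff_diff_eq)
    also have "\<dots> = (norm (z - p))\<^sup>2 - 2 * a * ((z - p) \<bullet> k) + a\<^sup>2 * (k \<bullet> k)"
      unfolding power2_norm_eq_inner
      by (simp add: inner_diff_left[of "z - p" "a *\<^sub>R k"] inner_diff_right[of _ "z - p" "a *\<^sub>R k"]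
          inner_commute[of k "z - p"] power2_eq_square right_diff_distrib)
    also have "a\<^sup>2 * (k \<bullet> k) = a * ((z - p) \<bullet> k)" using False by (simp add: a_def power2_eq_square)
    finally have "a * ((z - p) \<bullet> k) \<le> 0" by simp
    then have "((z - p) \<bullet> k)\<^sup>2 / (k \<bullet> k) \<le> 0" by (simp add: a_def power2_eq_square)
    moreover have "0 < k \<bullet> k" using False by simp
    ultimately have "((z - p) \<bullet> k)\<^sup>2 \<le> 0" by (simp add: divide_le_0_iff)
    then show ?thesis by simp
  qed simp
  with p(1) that show thesis by blast
qed

section \<open>Calculus with a self-adjoint graph on a complete subspace\<close>

locale self_adjoint_operator =
  fixes H :: "'h::real_inner set" and R :: "('h \<times> 'h) set"
  assumes subspace_H: "subspace H" and complete_H: "complete H" and self_adjoint: "self_adjoint_on H R"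
begin

abbreviation D where "D \<equiv> Domain R"
abbreviation r where "r \<equiv> app R"

lemma R_subset: "R \<subseteq> H \<times> H" and R_subspace: "subspace R" and R_single: "single_valued R"
  and R_dense: "H \<subseteq> closure D" and R_adjoint: "adjoint_on H R = R"
  using self_adjoint by (auto simp: self_adjoint_on_def)

lemma r_eq: "(x, y) \<in> R \<Longrightarrow> r x = y"
  unfolding app_def using R_single by (intro the_equality) (auto simp: single_valued_def)

lemma r_in: "x \<in> D \<Longrightarrow> (x, r x) \<in> R"
  using r_eq by blast

lemma D_H: "x \<in> D \<Longrightarrow> x \<in> H" and r_H: "x \<in> D \<Longrightarrow> r x \<in> H"
  using R_subset r_in by auto

lemma r_lin:
  assumes "x \<in> D" "y \<in> D"
  shows "a *\<^sub>R x + b *\<^sub>R y \<in> D" "r (a *\<^sub>R x + b *\<^sub>R y) = a *\<^sub>R r x + b *\<^sub>R r y"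
proof -
  have "a *\<^sub>R (x, r x) + b *\<^sub>R (y, r y) \<in> R"
    using assms r_in R_subspace by (intro subspace_add subspace_scale)
  then have "(a *\<^sub>R x + b *\<^sub>R y, a *\<^sub>R r x + b *\<^sub>R r y) \<in> R" by simp
  then show "a *\<^sub>R x + b *\<^sub>R y \<in> D" "r (a *\<^sub>R x + b *\<^sub>R y) = a *\<^sub>R r x + b *\<^sub>R r y"
    using r_eq by auto
qed

lemma subspace_D: "subspace D"
  using r_lin(1)[of _ _ 1 1] r_lin(1)[of _ _ _ 0] subspace_0[OF R_subspace]
  by (intro subspaceI) (auto simp: zero_prod_def)

lemma r_diff: "x \<in> D \<Longrightarrow> y \<in> D \<Longrightarrow> r (x - y) = r x - r y"
  and r_add: "x \<in> D \<Longrightarrow> y \<in> D \<Longrightarrow> r (x + y) = r x + r y"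
  and r_scale: "x \<in> D \<Longrightarrow> r (a *\<^sub>R x) = a *\<^sub>R r x"
  using r_lin(2)[of x y 1 "-1"] r_lin(2)[of x y 1 1] r_lin(2)[of x x a 0] by simp_all

lemma r_sym: "x \<in> D \<Longrightarrow> y \<in> D \<Longrightarrow> r x \<bullet> y = x \<bullet> r y"
proof -
  assume "x \<in> D" "y \<in> D"
  then have "(y, r y) \<in> adjoint_on H R" "(x, r x) \<in> R" using r_in R_adjoint by auto
  then show ?thesis by (auto simp: adjoint_on_def)
qed

text \<open>The maximality half of self-adjointness: a weak identity against all \<open>u\<close>
  already puts \<open>x\<close> into the domain. Every gain of regularity below rests on it;
  \<open>r_sym\<close> is the other half.\<close>

lemma r_adjointI:
  assumes "x \<in> H" "y \<in> H" "\<And>u. u \<in> D \<Longrightarrow> r u \<bullet> x = u \<bullet> y"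
  shows "x \<in> D" "r x = y"
proof -
  have "(x, y) \<in> adjoint_on H R"
    using assms r_eq by (auto simp: adjoint_on_def)
  then have "(x, y) \<in> R" by (simp add: R_adjoint)
  then show "x \<in> D" "r x = y" using r_eq by auto
qed

text \<open>Adjoints are closed: the symmetry identity tested with a fixed \<open>u\<close> survives
  the limit.\<close>

lemma r_closed:
  assumes "\<And>n. x n \<in> D" "x \<longlonglongrightarrow> a" "(\<lambda>n. r (x n)) \<longlonglongrightarrow> b"
  shows "a \<in> D" "r a = b"
proof -
  have cl: "closed H" by (rule complete_imp_closed[OF complete_H])
  have aH: "a \<in> H"
    by (rule closed_sequentially[OF cl D_H[OF assms(1)] assms(2)])
  have bH: "b \<in> H"
    by (rule closed_sequentially[OF cl r_H[OF assms(1)] assms(3)])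
  have "r u \<bullet> a = u \<bullet> b" if u: "u \<in> D" for u
  proof (rule LIMSEQ_unique)
    show "(\<lambda>n. r u \<bullet> x n) \<longlonglongrightarrow> r u \<bullet> a" by (intro tendsto_intros assms)
    have "(\<lambda>n. u \<bullet> r (x n)) \<longlonglongrightarrow> u \<bullet> b" by (intro tendsto_intros assms)
    then show "(\<lambda>n. r u \<bullet> x n) \<longlonglongrightarrow> u \<bullet> b" using r_sym[OF u assms(1)] by simp
  qed
  then show "a \<in> D" "r a = b" using r_adjointI[OF aH bH] by simp_all
qed

section \<open>The resolvent of the squared operator: existence, bounds, strong convergence to the
  identity\<close>

definition J :: "real \<Rightarrow> 'h \<Rightarrow> 'h" where
  "J \<epsilon> h = (SOME x. x \<in> D \<and> r x \<in> D \<and> x + \<epsilon> *\<^sub>R r (r x) = h)"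

text \<open>The orthogonal projection of \<open>(h, 0)\<close> onto the graph of \<open>\<surd>\<epsilon> R\<close> has first component
  \<open>(I + \<epsilon> R\<^sup>2)\<^sup>-\<^sup>1 h\<close>.\<close>

lemma resolvent_exists:
  assumes \<epsilon>: "\<epsilon> > 0" and h: "h \<in> H"
  shows "\<exists>x. x \<in> D \<and> r x \<in> D \<and> x + \<epsilon> *\<^sub>R r (r x) = h"
proof -
  define e where "e = sqrt \<epsilon>"
  have e: "e > 0" "e * e = \<epsilon>" using \<epsilon> by (auto simp: e_def)
  define K where "K = (\<lambda>x. (x, e *\<^sub>R r x)) ` D"
  have "subspace K"
  proof (rule subspaceI)
    have "r 0 = 0" using r_scale[of 0 0] subspace_0[OF subspace_D] by simp
    then show "0 \<in> K" using subspace_0[OF subspace_D] by (force simp: K_def zero_prod_def)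
    fix x y assume "x \<in> K" "y \<in> K"
    then obtain x' y' where "x = (x', e *\<^sub>R r x')" "y = (y', e *\<^sub>R r y')" "x' \<in> D" "y' \<in> D"
      by (auto simp: K_def)
    then show "x + y \<in> K"
      using subspace_add[OF subspace_D] unfolding K_def
      by (intro image_eqI[of _ _ "x' + y'"]) (simp_all add: r_add scaleR_right_distrib)
  next
    fix a x assume "x \<in> K"
    then obtain x' where "x = (x', e *\<^sub>R r x')" "x' \<in> D" by (auto simp: K_def)
    then show "a *\<^sub>R x \<in> K"
      using subspace_scale[OF subspace_D] unfolding K_def
      by (intro image_eqI[of _ _ "a *\<^sub>R x'"]) (simp_all add: r_scale)
  qed
  moreover have "complete K"
    unfolding complete_def
  proof (intro allI impI)
    fix f assume "(\<forall>n. f n \<in> K) \<and> Cauchy f"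
    then have f: "\<And>n. f n \<in> K" and C: "Cauchy f" by auto
    define x where "x n = fst (f n)" for n
    have x: "x n \<in> D" "f n = (x n, e *\<^sub>R r (x n))" for n
      using f[of n] by (auto simp: K_def x_def)
    have C1: "Cauchy x" unfolding x_def by (rule Cauchy_fst[OF C])
    have "Cauchy (\<lambda>n. e *\<^sub>R r (x n))" using Cauchy_snd[OF C] x(2) by simp
    then have "Cauchy (\<lambda>n. (1 / e) *\<^sub>R (e *\<^sub>R r (x n)))"
      by (rule bounded_linear.Cauchy[OF bounded_linear_scaleR_right])
    then have C2: "Cauchy (\<lambda>n. r (x n))" using e by simp
    obtain a where a: "x \<longlonglongrightarrow> a" using C1 x(1) D_H complete_H unfolding complete_def by blast
    obtain b where b: "(\<lambda>n. r (x n)) \<longlonglongrightarrow> b" using C2 x(1) r_H complete_H unfolding complete_def by meson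
    have "f = (\<lambda>n. (x n, e *\<^sub>R r (x n)))" using x(2) by auto
    then have "f \<longlonglongrightarrow> (a, e *\<^sub>R b)" using a b by (simp add: tendsto_Pair tendsto_scaleR)
    moreover have "(a, e *\<^sub>R b) \<in> K" using r_closed[OF x(1) a b] by (auto simp: K_def)
    ultimately show "\<exists>l\<in>K. f \<longlonglongrightarrow> l" by blast
  qed
  ultimately obtain k where k: "k \<in> K" "\<And>l. l \<in> K \<Longrightarrow> ((h, 0) - k) \<bullet> l = 0"
    using orthogonal_projection_exists[of K "(h, 0)"] by metis
  obtain x where x: "x \<in> D" "k = (x, e *\<^sub>R r x)" using k(1) by (auto simp: K_def)
  \<comment> \<open>Orthogonality to the scaled graph is the weak form of the resolvent equation;
    \<open>r_adjointI\<close> then makes it strong. Taking e as the root of \<epsilon> produces the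
    factor \<epsilon> = e e in the inner product.\<close>
  have "r u \<bullet> r x = u \<bullet> ((1 / \<epsilon>) *\<^sub>R (h - x))" if u: "u \<in> D" for u
  proof -
    have "((h, 0) - k) \<bullet> (u, e *\<^sub>R r u) = 0"
      unfolding K_def using u by (intro k(2)[unfolded K_def] imageI)
    then have "(h - x) \<bullet> u = (e * e) * (r x \<bullet> r u)" by (simp add: x(2) inner_prod_def)
    then have "u \<bullet> (h - x) = \<epsilon> * (r u \<bullet> r x)" by (simp only: e(2) inner_commute)
    then show ?thesis using \<epsilon> by simp
  qed
  moreover have "(1 / \<epsilon>) *\<^sub>R (h - x) \<in> H"
    using subspace_H h D_H[OF x(1)] by (intro subspace_scale subspace_diff)
  ultimately have 1: "r x \<in> D" and "r (r x) = (1 / \<epsilon>) *\<^sub>R (h - x)"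
    using r_adjointI[OF r_H[OF x(1)]] by blast+
  then have "\<epsilon> *\<^sub>R r (r x) = h - x" using \<epsilon> by simp
  then have "x + \<epsilon> *\<^sub>R r (r x) = h" by (simp only: add.commute[of x] diff_add_cancel)
  then show ?thesis using x(1) 1 by (intro exI[of _ x] conjI)
qed

lemma
  assumes \<epsilon>: "\<epsilon> > 0" and h: "h \<in> H"
  shows J_D: "J \<epsilon> h \<in> D" and rJ_D: "r (J \<epsilon> h) \<in> D"
    and J_eq: "J \<epsilon> h + \<epsilon> *\<^sub>R r (r (J \<epsilon> h)) = h"
proof -
  have *: "J \<epsilon> h \<in> D \<and> r (J \<epsilon> h) \<in> D \<and> J \<epsilon> h + \<epsilon> *\<^sub>R r (r (J \<epsilon> h)) = h"
    unfolding J_def by (rule someI_ex[OF resolvent_exists[OF \<epsilon> h]])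
  show "J \<epsilon> h \<in> D" "r (J \<epsilon> h) \<in> D" "J \<epsilon> h + \<epsilon> *\<^sub>R r (r (J \<epsilon> h)) = h"
    using * by blast+
qed

lemma J_eq': "\<epsilon> > 0 \<Longrightarrow> h \<in> H \<Longrightarrow> \<epsilon> *\<^sub>R r (r (J \<epsilon> h)) = h - J \<epsilon> h"
  by (metis J_eq add_diff_cancel_left')

text \<open>Pairing the equation with \<open>x\<close> gives |x|^2 + \<epsilon>|r x|^2 = (h, x). It
  is stated for any solution \<open>x\<close>, so that it also yields uniqueness.\<close>

lemma resolvent_norms:
  assumes \<epsilon>: "\<epsilon> > 0" and x: "x \<in> D" "r x \<in> D" and h: "x + \<epsilon> *\<^sub>R r (r x) = h"
  shows "norm x \<le> norm h" "\<epsilon> * (norm (r x))\<^sup>2 \<le> (norm h)\<^sup>2"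
proof -
  have e: "(norm x)\<^sup>2 + \<epsilon> * (norm (r x))\<^sup>2 = h \<bullet> x"
    using r_sym[OF x(2) x(1)] unfolding h[symmetric] by (simp add: inner_add_left power2_norm_eq_inner)
  then have le: "(norm x)\<^sup>2 + \<epsilon> * (norm (r x))\<^sup>2 \<le> norm h * norm x"
    using norm_cauchy_schwarz[of h x] by simp
  moreover have p: "0 \<le> \<epsilon> * (norm (r x))\<^sup>2" using \<epsilon> by simp
  ultimately have "norm x * norm x \<le> norm h * norm x" by (simp add: power2_eq_square)
  then show 1: "norm x \<le> norm h" by (cases "x = 0") simp_all
  have "norm h * norm x \<le> norm h * norm h" using 1 by (intro mult_left_mono) auto
  moreover have "0 \<le> (norm x)\<^sup>2" by simp
  ultimately show "\<epsilon> * (norm (r x))\<^sup>2 \<le> (norm h)\<^sup>2" using le unfolding power2_eq_square[of "norm h"] by linarith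
qed

lemma J_unique:
  assumes \<epsilon>: "\<epsilon> > 0" and x: "x \<in> D" "r x \<in> D" and h: "x + \<epsilon> *\<^sub>R r (r x) = h"
  shows "J \<epsilon> h = x"
proof -
  have hH: "h \<in> H" unfolding h[symmetric] using x D_H r_H subspace_H by (intro subspace_add subspace_scale) auto
  let ?y = "J \<epsilon> h"
  note y = J_D[OF \<epsilon> hH] rJ_D[OF \<epsilon> hH] J_eq[OF \<epsilon> hH]
  have 1: "r (?y - x) = r ?y - r x" using y x by (simp only: r_diff)
  have 2: "r (r (?y - x)) = r (r ?y) - r (r x)" unfolding 1 using y x by (simp only: r_diff)
  have "norm (?y - x) \<le> norm (0::'h)"
  proof (rule resolvent_norms(1)[OF \<epsilon>])
    show "?y - x \<in> D" "r (?y - x) \<in> D"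
      unfolding 1 using y x by (simp_all only: subspace_diff[OF subspace_D])
    have "?y - x + \<epsilon> *\<^sub>R r (r (?y - x)) = (?y + \<epsilon> *\<^sub>R r (r ?y)) - (x + \<epsilon> *\<^sub>R r (r x))"
      unfolding 2 by (simp add: scaleR_diff_right)
    then show "?y - x + \<epsilon> *\<^sub>R r (r (?y - x)) = 0" unfolding y h by simp
  qed
  then show ?thesis by simp
qed

lemma J_lin:
  assumes \<epsilon>: "\<epsilon> > 0" and h: "h \<in> H" "k \<in> H"
  shows "J \<epsilon> (a *\<^sub>R h + b *\<^sub>R k) = a *\<^sub>R J \<epsilon> h + b *\<^sub>R J \<epsilon> k"
proof (rule J_unique[OF \<epsilon>])
  note x = J_D[OF \<epsilon> h(1)] rJ_D[OF \<epsilon> h(1)] and y = J_D[OF \<epsilon> h(2)] rJ_D[OF \<epsilon> h(2)]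
  show "a *\<^sub>R J \<epsilon> h + b *\<^sub>R J \<epsilon> k \<in> D" by (rule r_lin(1)[OF x(1) y(1)])
  show "r (a *\<^sub>R J \<epsilon> h + b *\<^sub>R J \<epsilon> k) \<in> D"
    unfolding r_lin(2)[OF x(1) y(1)] by (rule r_lin(1)[OF x(2) y(2)])
  have "a *\<^sub>R (J \<epsilon> h + \<epsilon> *\<^sub>R r (r (J \<epsilon> h))) + b *\<^sub>R (J \<epsilon> k + \<epsilon> *\<^sub>R r (r (J \<epsilon> k))) = a *\<^sub>R h + b *\<^sub>R k"
    by (simp only: J_eq[OF \<epsilon> h(1)] J_eq[OF \<epsilon> h(2)])
  moreover have "a *\<^sub>R J \<epsilon> h + b *\<^sub>R J \<epsilon> k + \<epsilon> *\<^sub>R (a *\<^sub>R r (r (J \<epsilon> h)) + b *\<^sub>R r (r (J \<epsilon> k)))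
      = a *\<^sub>R (J \<epsilon> h + \<epsilon> *\<^sub>R r (r (J \<epsilon> h))) + b *\<^sub>R (J \<epsilon> k + \<epsilon> *\<^sub>R r (r (J \<epsilon> k)))"
    by (simp add: algebra_simps)
  ultimately show "a *\<^sub>R J \<epsilon> h + b *\<^sub>R J \<epsilon> k + \<epsilon> *\<^sub>R r (r (a *\<^sub>R J \<epsilon> h + b *\<^sub>R J \<epsilon> k)) = a *\<^sub>R h + b *\<^sub>R k"
    by (simp only: r_lin(2)[OF x(1) y(1)] r_lin(2)[OF x(2) y(2)])
qed

lemma J_H: "\<epsilon> > 0 \<Longrightarrow> h \<in> H \<Longrightarrow> J \<epsilon> h \<in> H"
  using J_D D_H by blast

lemma J_diff: "\<epsilon> > 0 \<Longrightarrow> h \<in> H \<Longrightarrow> k \<in> H \<Longrightarrow> J \<epsilon> (h - k) = J \<epsilon> h - J \<epsilon> k"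
  using J_lin[of \<epsilon> h k 1 "-1"] by simp

lemma norm_J_le: "\<epsilon> > 0 \<Longrightarrow> h \<in> H \<Longrightarrow> norm (J \<epsilon> h) \<le> norm h"
  using resolvent_norms(1) J_D rJ_D J_eq by blast

text \<open>The bound blows up as \<epsilon> tends to 0. It serves only to carry derivatives through
  \<open>r\<close> after \<open>J \<epsilon>\<close> at fixed \<epsilon>, never in an energy
  estimate.\<close>

lemma norm_rJ_le:
  assumes "\<epsilon> > 0" "h \<in> H" shows "norm (r (J \<epsilon> h)) \<le> (1 / sqrt \<epsilon>) * norm h"
proof -
  have "\<epsilon> * (norm (r (J \<epsilon> h)))\<^sup>2 \<le> (norm h)\<^sup>2"
    using resolvent_norms(2) J_D rJ_D J_eq assms by blast
  then have "sqrt (\<epsilon> * (norm (r (J \<epsilon> h)))\<^sup>2) \<le> norm h"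
    by (intro real_le_lsqrt) auto
  then show ?thesis using assms(1) by (simp add: real_sqrt_mult pos_le_divide_eq mult.commute)
qed

text \<open>The resolvent equation writes \<open>r (r (J \<epsilon> x))\<close> as a combination of
  \<open>x\<close> and \<open>J \<epsilon> x\<close>, both in the domain. So \<open>r\<close> may be
  applied to the whole equation, and uniqueness identifies \<open>r (J \<epsilon> x)\<close>. The
  gain over \<open>x\<close> is two powers of \<open>r\<close>.\<close>

lemma
  assumes \<epsilon>: "\<epsilon> > 0" and x: "x \<in> D"
  shows J_commute: "J \<epsilon> (r x) = r (J \<epsilon> x)" and rrJ_D: "r (r (J \<epsilon> x)) \<in> D"
proof -
  note xH = D_H[OF x]
  let ?y = "J \<epsilon> x"
  have e: "r (r ?y) = (1 / \<epsilon>) *\<^sub>R x + (- 1 / \<epsilon>) *\<^sub>R ?y"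
  proof -
    have "\<epsilon> *\<^sub>R r (r ?y) = x - ?y" by (rule J_eq'[OF \<epsilon> xH])
    then have "(1 / \<epsilon>) *\<^sub>R (\<epsilon> *\<^sub>R r (r ?y)) = (1 / \<epsilon>) *\<^sub>R (x - ?y)" by simp
    then show ?thesis using \<epsilon> by (simp add: scaleR_diff_right)
  qed
  show rr: "r (r ?y) \<in> D" unfolding e by (rule r_lin(1)[OF x J_D[OF \<epsilon> xH]])
  show "J \<epsilon> (r x) = r ?y"
  proof (rule J_unique[OF \<epsilon> rJ_D[OF \<epsilon> xH] rr])
    have "r (1 *\<^sub>R ?y + \<epsilon> *\<^sub>R r (r ?y)) = 1 *\<^sub>R r ?y + \<epsilon> *\<^sub>R r (r (r ?y))"
      by (rule r_lin(2)[OF J_D[OF \<epsilon> xH] rr])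
    then show "r ?y + \<epsilon> *\<^sub>R r (r (r ?y)) = r x" by (simp add: J_eq[OF \<epsilon> xH])
  qed
qed

text \<open>With y = J x, |x - y|^2 = \<epsilon> (x - y, r (r y)) = \<epsilon> (r x - r y, r y)
  \<le> \<epsilon> |r x|^2; the last step drops |r y|^2 and uses that \<open>J\<close> commutes with
  \<open>r\<close> and contracts.\<close>

lemma norm_diff_J_le:
  assumes \<epsilon>: "\<epsilon> > 0" and x: "x \<in> D"
  shows "norm (x - J \<epsilon> x) \<le> sqrt \<epsilon> * norm (r x)"
proof (rule power2_le_imp_le)
  note xH = D_H[OF x]
  let ?y = "J \<epsilon> x"
  note y = J_D[OF \<epsilon> xH] rJ_D[OF \<epsilon> xH]
  have "x - ?y = \<epsilon> *\<^sub>R r (r ?y)" by (rule J_eq'[OF \<epsilon> xH, symmetric])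
  then have e: "(norm (x - ?y))\<^sup>2 = \<epsilon> * ((x - ?y) \<bullet> r (r ?y))" by (metis inner_scaleR_right power2_norm_eq_inner)
  have "(x - ?y) \<bullet> r (r ?y) = (r x - r ?y) \<bullet> r ?y"
    using r_sym[of "x - ?y" "r ?y"] x y subspace_diff[OF subspace_D] by (simp add: r_diff)
  also have "\<dots> \<le> r x \<bullet> r ?y" by (simp add: inner_diff_left)
  also have "\<dots> \<le> norm (r x) * norm (r ?y)" by (rule norm_cauchy_schwarz)
  also have "\<dots> \<le> norm (r x) * norm (r x)"
    using norm_J_le[OF \<epsilon> r_H[OF x]] J_commute[OF \<epsilon> x] by (intro mult_left_mono) auto
  finally have "\<epsilon> * ((x - ?y) \<bullet> r (r ?y)) \<le> \<epsilon> * (norm (r x) * norm (r x))"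
    using \<epsilon> by (intro mult_left_mono) auto
  then show "(norm (x - ?y))\<^sup>2 \<le> (sqrt \<epsilon> * norm (r x))\<^sup>2"
    using \<epsilon> unfolding e by (simp add: power_mult_distrib power2_eq_square[of "norm (r x)"])
qed (use \<epsilon> in auto)

text \<open>Convergence on the dense domain extends to \<open>H\<close> because the resolvents are
  contractions.\<close>

lemma J_tendsto:
  assumes h: "h \<in> H"
  shows "((\<lambda>\<epsilon>. J \<epsilon> h) \<longlongrightarrow> h) (at_right 0)"
proof (rule tendstoI)
  fix e :: real assume e: "0 < e"
  then obtain x where x: "x \<in> D" "dist x h < e / 3"
    using R_dense h unfolding closure_approachable subset_eq by (meson divide_pos_pos zero_less_numeral)
  have "((\<lambda>\<epsilon>. sqrt \<epsilon> * norm (r x)) \<longlongrightarrow> sqrt 0 * norm (r x)) (at_right 0)" by (intro tendsto_intros)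
  then have "\<forall>\<^sub>F \<epsilon> in at_right 0. sqrt \<epsilon> * norm (r x) < e / 3"
    using e by (intro order_tendstoD) auto
  moreover have "\<forall>\<^sub>F \<epsilon> in at_right (0::real). 0 < \<epsilon>" by (simp add: eventually_at_right_less)
  ultimately show "\<forall>\<^sub>F \<epsilon> in at_right 0. dist (J \<epsilon> h) h < e"
  proof eventually_elim
    case (elim \<epsilon>)
    have "J \<epsilon> h - h = J \<epsilon> (h - x) - (x - J \<epsilon> x) + (x - h)"
      using J_diff[OF elim(2) h D_H[OF x(1)]] by simp
    also have "norm \<dots> \<le> norm (J \<epsilon> (h - x)) + norm (x - J \<epsilon> x) + norm (x - h)"
      by (rule order_trans[OF norm_triangle_ineq add_right_mono[OF norm_triangle_ineq4]])
    also have "norm (J \<epsilon> (h - x)) \<le> norm (h - x)"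
      using subspace_diff[OF subspace_H h D_H[OF x(1)]] by (rule norm_J_le[OF elim(2)])
    finally show ?case
      using norm_diff_J_le[OF elim(2) x(1)] x(2) elim(1) by (simp add: dist_norm norm_minus_commute)
  qed
qed

end

section \<open>Completeness of the space of square integrable functions\<close>

lemma rep_l2_square_integrable: "square_integrable (rep_l2 u)"
  using Quotient3_rep_reflp[OF Quotient3_l2, of u] by simp

lemma abs_rep_l2: "abs_l2 (rep_l2 u) = u"
  by (rule Quotient3_abs_rep[OF Quotient3_l2])

lemma rep_abs_l2: "square_integrable f \<Longrightarrow> AE x in lborel. rep_l2 (abs_l2 f) x = f x"
  using Quotient3_rep_abs[OF Quotient3_l2, of f] by simp

lemma inner_abs_l2:
  "square_integrable f \<Longrightarrow> square_integrable g \<Longrightarrow> abs_l2 f \<bullet> abs_l2 g = (LINT x|lborel. f x * g x)"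
  by (rule inner_l2.abs_eq) auto

lemma inner_l2_eq: "u \<bullet> abs_l2 f = (LINT x|lborel. rep_l2 u x * f x)" if "square_integrable f"
  using inner_abs_l2[OF rep_l2_square_integrable that, of u] by (simp add: abs_rep_l2)

lemma plus_abs_l2:
  "square_integrable f \<Longrightarrow> square_integrable g \<Longrightarrow> abs_l2 f + abs_l2 g = abs_l2 (\<lambda>x. f x + g x)"
  by (rule plus_l2.abs_eq) auto

lemma scaleR_abs_l2: "square_integrable f \<Longrightarrow> a *\<^sub>R abs_l2 f = abs_l2 (\<lambda>x. a * f x)"
  by (rule scaleR_l2.abs_eq) auto

lemma square_integrable_diff:
  "square_integrable f \<Longrightarrow> square_integrable g \<Longrightarrow> square_integrable (\<lambda>x. f x - g x)"
  using square_integrable_add[OF _ square_integrable_scale[of g "-1"], of f] by simp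

lemma diff_abs_l2:
  assumes "square_integrable f" "square_integrable g"
  shows "abs_l2 f - abs_l2 g = abs_l2 (\<lambda>x. f x - g x)"
proof -
  have "abs_l2 f - abs_l2 g = abs_l2 f + (-1) *\<^sub>R abs_l2 g" by simp
  also have "\<dots> = abs_l2 (\<lambda>x. f x - g x)"
    unfolding scaleR_abs_l2[OF assms(2)] plus_abs_l2[OF assms(1) square_integrable_scale[OF assms(2)]]
    by simp
  finally show ?thesis .
qed

lemma norm_abs_l2: "square_integrable f \<Longrightarrow> (norm (abs_l2 f))\<^sup>2 = (LINT x|lborel. (f x)\<^sup>2)"
  by (simp add: power2_norm_eq_inner inner_abs_l2) (simp add: power2_eq_square)

lemma nn_integral_abs_l2:
  "square_integrable f \<Longrightarrow> (\<integral>\<^sup>+x. ennreal ((f x)\<^sup>2) \<partial>lborel) = ennreal ((norm (abs_l2 f))\<^sup>2)"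
  unfolding norm_abs_l2 by (rule nn_integral_eq_integral) (auto simp: square_integrable_def)

lemma nn_integral_diff_abs_l2:
  assumes "square_integrable f" "square_integrable g"
  shows "(\<integral>\<^sup>+x. ennreal ((f x - g x)\<^sup>2) \<partial>lborel) = ennreal ((norm (abs_l2 f - abs_l2 g))\<^sup>2)"
  unfolding diff_abs_l2[OF assms] by (rule nn_integral_abs_l2[OF square_integrable_diff[OF assms]])

text \<open>The rate 4^(-n) is fast enough that squared increments remain summable after
  multiplication by 4^n.\<close>

lemma Cauchy_rapid_subseq:
  fixes X :: "nat \<Rightarrow> 'a::metric_space"
  assumes X: "Cauchy X"
  obtains k where "strict_mono k" "\<And>n m. n \<le> m \<Longrightarrow> dist (X (k n)) (X (k m)) < (1/4) ^ n"
proof -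
  have "\<exists>N. \<forall>m\<ge>N. \<forall>m'\<ge>N. dist (X m) (X m') < (1/4) ^ n" for n
    using X unfolding Cauchy_def by simp
  then obtain N where N: "\<And>n m m'. m \<ge> N n \<Longrightarrow> m' \<ge> N n \<Longrightarrow> dist (X m) (X m') < (1/4) ^ n"
    by metis
  \<comment> \<open>The sum makes k n at least N n, and the summand n makes k strictly
    increasing.\<close>
  define k where "k n = n + (\<Sum>i\<le>n. N i)" for n
  have "N n \<le> k n" for n
  proof -
    have "N n \<le> (\<Sum>i\<le>n. N i)" by (intro member_le_sum) auto
    then show ?thesis by (simp add: k_def)
  qed
  moreover have sm: "strict_mono k"
    by (rule strict_monoI_Suc) (simp add: k_def)
  moreover have "k n \<le> k m" if "n \<le> m" for n m
    using sm that by (simp add: strict_mono_less_eq)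
  ultimately have "dist (X (k n)) (X (k m)) < (1/4) ^ n" if "n \<le> m" for n m
    using N[OF _ order_trans, of n "k n" "k n" "k m"] that by blast
  with sm show thesis by (rule that)
qed

text \<open>The squared increments, weighted by 4^n, have integrals at most 4^(-n). So the weighted
  series is finite almost everywhere, its terms are bounded by some B there, and each increment is
  at most sqrt B times 2^(-n).\<close>

lemma AE_convergent_rapid:
  fixes f :: "nat \<Rightarrow> 'a::euclidean_space \<Rightarrow> real"
  assumes f: "\<And>n. square_integrable (f n)"
    and d: "\<And>n. norm (abs_l2 (f (Suc n)) - abs_l2 (f n)) \<le> (1/4) ^ n"
  shows "AE x in lborel. convergent (\<lambda>n. f n x)"
proof -
  have [measurable]: "f n \<in> borel_measurable borel" for n using f[of n] by (simp add: square_integrable_def)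
  let ?a = "\<lambda>n x. 4 ^ n * (f (Suc n) x - f n x)\<^sup>2"
  have "(\<integral>\<^sup>+x. ennreal (?a n x) \<partial>lborel) \<le> ennreal ((1/4) ^ n)" for n
  proof -
    have "(\<integral>\<^sup>+x. ennreal (?a n x) \<partial>lborel) = (\<integral>\<^sup>+x. ennreal (4 ^ n) * ennreal ((f (Suc n) x - f n x)\<^sup>2) \<partial>lborel)"
      by (simp add: ennreal_mult)
    also have "\<dots> = ennreal (4 ^ n) * (\<integral>\<^sup>+x. ennreal ((f (Suc n) x - f n x)\<^sup>2) \<partial>lborel)"
      by (intro nn_integral_cmult) measurable
    also have "\<dots> = ennreal (4 ^ n) * ennreal ((norm (abs_l2 (f (Suc n)) - abs_l2 (f n)))\<^sup>2)"
      by (simp only: nn_integral_diff_abs_l2[OF f f])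
    also have "\<dots> = ennreal (4 ^ n * (norm (abs_l2 (f (Suc n)) - abs_l2 (f n)))\<^sup>2)"
      by (simp add: ennreal_mult)
    also have "4 ^ n * (norm (abs_l2 (f (Suc n)) - abs_l2 (f n)))\<^sup>2 \<le> 4 ^ n * ((1/4) ^ n)\<^sup>2"
      by (intro mult_left_mono power_mono d) auto
    also have "4 ^ n * ((1/4) ^ n)\<^sup>2 = (1/4::real) ^ n"
      by (simp add: power2_eq_square power_divide)
    finally show ?thesis by (simp add: ennreal_leI)
  qed
  then have "(\<Sum>n. \<integral>\<^sup>+x. ennreal (?a n x) \<partial>lborel) \<le> (\<Sum>n. ennreal ((1/4) ^ n))"
    by (intro suminf_le) auto
  also have "\<dots> = ennreal (\<Sum>n. (1/4) ^ n)"
    by (intro suminf_ennreal2) (auto intro: summable_geometric)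
  also have "\<dots> < \<infinity>" by simp
  finally have "(\<integral>\<^sup>+x. (\<Sum>n. ennreal (?a n x)) \<partial>lborel) < \<infinity>"
    by (subst nn_integral_suminf) auto
  then have "AE x in lborel. (\<Sum>n. ennreal (?a n x)) \<noteq> \<infinity>"
    by (intro nn_integral_PInf_AE) auto
  then show ?thesis
  proof (rule AE_mp, intro AE_I2 impI)
    fix x assume fin: "(\<Sum>n. ennreal (?a n x)) \<noteq> \<infinity>"
    have "summable (\<lambda>n. ?a n x)"
      using fin by (intro summable_suminf_not_top) auto
    then have lim: "(\<lambda>n. ?a n x) \<longlonglongrightarrow> 0" by (rule summable_LIMSEQ_zero)
    then obtain B where B: "\<And>n. \<bar>?a n x\<bar> \<le> B"
      using convergent_imp_Bseq[OF convergentI[OF lim]] by (auto simp: Bseq_def)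
    have "summable (\<lambda>n. f (Suc n) x - f n x)"
    proof (rule summable_comparison_test')
      show "summable (\<lambda>n. sqrt B * (1/2) ^ n)"
        by (intro summable_mult summable_geometric) simp
      fix n :: nat
      define y where "y = f (Suc n) x - f n x"
      have "(2::real) ^ n * 2 ^ n = 4 ^ n" by (simp flip: power_mult_distrib)
      then have "(2 ^ n * y)\<^sup>2 = 4 ^ n * y\<^sup>2" by (simp add: power2_eq_square)
      also have "\<dots> \<le> B" using B[of n] by (simp add: y_def)
      finally have "sqrt ((2 ^ n * y)\<^sup>2) \<le> sqrt B" by (rule real_sqrt_le_mono)
      then have "2 ^ n * \<bar>y\<bar> \<le> sqrt B" by (simp add: abs_mult)
      then show "norm (f (Suc n) x - f n x) \<le> sqrt B * (1/2) ^ n"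
        by (simp add: power_divide pos_le_divide_eq mult.commute flip: y_def)
    qed
    then have "convergent (\<lambda>n. f 0 x + (\<Sum>i<n. f (Suc i) x - f i x))"
      by (intro convergent_add convergent_const) (simp add: summable_iff_convergent)
    moreover have "(\<Sum>i<n. f (Suc i) x - f i x) = f n x - f 0 x" for n
      by (rule sum_lessThan_telescope)
    ultimately show "convergent (\<lambda>n. f n x)" by simp
  qed
qed

text \<open>Riesz-Fischer. A rapid subsequence converges pointwise to \<open>g\<close>; Fatou's
  lemma for f m - f n as m grows bounds the norm of g - f n and, with n = 0, shows that
  \<open>g\<close> is square integrable.\<close>

lemma complete_l2: "complete (UNIV :: 'a::euclidean_space l2 set)"
  unfolding complete_def
proof (intro allI impI, elim conjE)
  fix X :: "nat \<Rightarrow> 'a l2" assume X: "Cauchy X"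
  obtain k where k: "strict_mono k" and d: "\<And>n m. n \<le> m \<Longrightarrow> dist (X (k n)) (X (k m)) < (1/4) ^ n"
    using Cauchy_rapid_subseq[OF X] by metis
  define f where "f n = rep_l2 (X (k n))" for n
  have f: "square_integrable (f n)" "abs_l2 (f n) = X (k n)" for n
    by (auto simp: f_def rep_l2_square_integrable abs_rep_l2)
  have [measurable]: "f n \<in> borel_measurable borel" for n using f(1)[of n] by (simp add: square_integrable_def)
  define g where "g x = lim (\<lambda>n. f n x)" for x
  have [measurable]: "g \<in> borel_measurable borel" unfolding g_def by measurable
  have "AE x in lborel. convergent (\<lambda>n. f n x)"
  proof (rule AE_convergent_rapid[OF f(1)])
    fix n show "norm (abs_l2 (f (Suc n)) - abs_l2 (f n)) \<le> (1/4) ^ n"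
      using d[of n "Suc n"] by (simp only: f(2) dist_norm norm_minus_commute less_imp_le le_SucI order_refl)
  qed
  then have lim: "AE x in lborel. (\<lambda>n. f n x) \<longlonglongrightarrow> g x"
    by (auto simp: g_def convergent_LIMSEQ_iff)
  have le: "(\<integral>\<^sup>+x. ennreal ((g x - f n x)\<^sup>2) \<partial>lborel) \<le> ennreal (((1/4) ^ n)\<^sup>2)" for n
  proof -
    have "(\<integral>\<^sup>+x. ennreal ((g x - f n x)\<^sup>2) \<partial>lborel)
        = (\<integral>\<^sup>+x. liminf (\<lambda>m. ennreal ((f m x - f n x)\<^sup>2)) \<partial>lborel)"
    proof (rule nn_integral_cong_AE, use lim in eventually_elim)
      fix x assume "(\<lambda>n. f n x) \<longlonglongrightarrow> g x"
      then have "(\<lambda>m. ennreal ((f m x - f n x)\<^sup>2)) \<longlonglongrightarrow> ennreal ((g x - f n x)\<^sup>2)"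
        by (intro tendsto_intros)
      then show "ennreal ((g x - f n x)\<^sup>2) = liminf (\<lambda>m. ennreal ((f m x - f n x)\<^sup>2))"
        by (rule lim_imp_Liminf[OF sequentially_bot, symmetric])
    qed
    also have "\<dots> \<le> liminf (\<lambda>m. \<integral>\<^sup>+x. ennreal ((f m x - f n x)\<^sup>2) \<partial>lborel)"
      by (intro nn_integral_liminf) measurable
    also have "\<dots> \<le> ennreal (((1/4) ^ n)\<^sup>2)"
    proof (rule Liminf_le)
      show "\<forall>\<^sub>F m in sequentially. (\<integral>\<^sup>+x. ennreal ((f m x - f n x)\<^sup>2) \<partial>lborel) \<le> ennreal (((1/4) ^ n)\<^sup>2)"
        using eventually_ge_at_top[of n]
      proof eventually_elim
        case (elim m)
        have "(\<integral>\<^sup>+x. ennreal ((f m x - f n x)\<^sup>2) \<partial>lborel) = ennreal ((norm (X (k m) - X (k n)))\<^sup>2)"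
          by (simp only: nn_integral_diff_abs_l2[OF f(1) f(1)] f(2))
        also have "\<dots> \<le> ennreal (((1/4) ^ n)\<^sup>2)"
          using d[OF elim] by (intro ennreal_leI power_mono) (auto simp: dist_norm norm_minus_commute)
        finally show ?case .
      qed
    qed simp
    finally show ?thesis .
  qed
  have gf: "square_integrable (\<lambda>x. g x - f n x)" for n
    unfolding square_integrable_def
  proof
    have "(\<integral>\<^sup>+x. ennreal ((g x - f n x)\<^sup>2) \<partial>lborel) < \<infinity>"
      by (rule le_less_trans[OF le]) simp
    then show "integrable lborel (\<lambda>x. (g x - f n x)\<^sup>2)"
      by (intro integrableI_nonneg) auto
  qed measurable
  have g: "square_integrable g"
    using square_integrable_add[OF gf[of 0] f(1)[of 0]] by simp
  have "norm (abs_l2 g - X (k n)) \<le> (1/4) ^ n" for n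
  proof -
    have "ennreal ((norm (abs_l2 g - X (k n)))\<^sup>2) \<le> ennreal (((1/4) ^ n)\<^sup>2)"
      using le[of n] by (simp only: nn_integral_diff_abs_l2[OF g f(1)] f(2))
    then have "(norm (abs_l2 g - X (k n)))\<^sup>2 \<le> ((1/4) ^ n)\<^sup>2"
      by (subst (asm) ennreal_le_iff) auto
    then show ?thesis by (rule power2_le_imp_le) simp
  qed
  then have "\<forall>\<^sub>F n in sequentially. norm (X (k n) - abs_l2 g) \<le> (1/4) ^ n"
    by (simp only: norm_minus_commute eventually_True)
  then have "(\<lambda>n. X (k n) - abs_l2 g) \<longlonglongrightarrow> 0"
    by (rule Lim_null_comparison) (rule LIMSEQ_power_zero, simp)
  then have "(X \<circ> k) \<longlonglongrightarrow> abs_l2 g"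
    unfolding o_def by (rule LIM_zero_cancel)
  then have "X \<longlonglongrightarrow> abs_l2 g"
    by (rule Cauchy_converges_subseq[OF X k, unfolded o_def[symmetric]])
  then show "\<exists>l\<in>UNIV. X \<longlonglongrightarrow> l" by blast
qed

text \<open>Representatives are chosen, so \<open>rep_l2\<close> is linear only almost
  everywhere.\<close>

lemma subspace_L2: "subspace (L2 \<Omega>)"
proof (rule subspaceI)
  have "AE x in lborel. rep_l2 (0::'a l2) x = 0"
    using rep_abs_l2[OF square_integrable_zero] by (simp add: zero_l2.abs_eq)
  then show "0 \<in> L2 \<Omega>" by (auto simp: L2_def)
  fix u v :: "'a l2" assume "u \<in> L2 \<Omega>" "v \<in> L2 \<Omega>"
  moreover have "AE x in lborel. rep_l2 (u + v) x = rep_l2 u x + rep_l2 v x"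
    using rep_abs_l2[OF square_integrable_add[OF rep_l2_square_integrable rep_l2_square_integrable], of u v]
    by (simp add: rep_l2_square_integrable abs_rep_l2 flip: plus_abs_l2)
  ultimately show "u + v \<in> L2 \<Omega>" unfolding L2_def by auto
next
  fix c and u :: "'a l2" assume "u \<in> L2 \<Omega>"
  moreover have "AE x in lborel. rep_l2 (c *\<^sub>R u) x = c * rep_l2 u x"
    using rep_abs_l2[OF square_integrable_scale[OF rep_l2_square_integrable], of c u]
    by (simp add: rep_l2_square_integrable abs_rep_l2 flip: scaleR_abs_l2)
  ultimately show "c *\<^sub>R u \<in> L2 \<Omega>" unfolding L2_def by auto
qed

text \<open>Off \<Omega> each \<open>X n\<close> vanishes, so the part of \<open>u\<close> living
  there has norm at most that of u - X n, which tends to 0.\<close>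

lemma closed_L2:
  assumes [measurable]: "\<Omega> \<in> sets borel"
  shows "closed (L2 \<Omega>)"
  unfolding closed_sequential_limits
proof (intro allI impI, elim conjE)
  fix X and u :: "'a l2" assume X: "\<forall>n. X n \<in> L2 \<Omega>" and lim: "X \<longlonglongrightarrow> u"
  let ?f = "\<lambda>x. indicator (- \<Omega>) x * rep_l2 u x"
  have [measurable]: "rep_l2 v \<in> borel_measurable borel" for v :: "'a l2"
    using rep_l2_square_integrable[of v] by (simp add: square_integrable_def)
  have i: "integrable lborel (\<lambda>x. (rep_l2 v x)\<^sup>2)" for v :: "'a l2"
    using rep_l2_square_integrable[of v] by (simp add: square_integrable_def)
  have fi: "integrable lborel (\<lambda>x. (?f x)\<^sup>2)"
    by (rule Bochner_Integration.integrable_bound[OF i[of u]]) (auto simp: indicator_def)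
  have "(LINT x|lborel. (?f x)\<^sup>2) \<le> (norm (u - X n))\<^sup>2" for n
  proof -
    have e: "(norm (u - X n))\<^sup>2 = (LINT x|lborel. (rep_l2 u x - rep_l2 (X n) x)\<^sup>2)"
      using norm_abs_l2[OF square_integrable_diff[OF rep_l2_square_integrable rep_l2_square_integrable], of u "X n"]
      by (simp add: rep_l2_square_integrable abs_rep_l2 flip: diff_abs_l2)
    have "integrable lborel (\<lambda>x. (rep_l2 u x - rep_l2 (X n) x)\<^sup>2)"
      using square_integrable_diff[OF rep_l2_square_integrable rep_l2_square_integrable, of u "X n"]
      by (simp add: square_integrable_def)
    moreover have "AE x in lborel. (?f x)\<^sup>2 \<le> (rep_l2 u x - rep_l2 (X n) x)\<^sup>2"
    proof -
      have "AE x in lborel. x \<notin> \<Omega> \<longrightarrow> rep_l2 (X n) x = 0" using X by (simp add: L2_def)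
      then show ?thesis by eventually_elim (auto simp: indicator_def)
    qed
    ultimately show ?thesis unfolding e using fi by (intro integral_mono_AE) auto
  qed
  moreover have "(\<lambda>n. (norm (u - X n))\<^sup>2) \<longlonglongrightarrow> (norm (u - u))\<^sup>2"
    by (intro tendsto_intros lim)
  ultimately have "(LINT x|lborel. (?f x)\<^sup>2) \<le> (norm (u - u))\<^sup>2"
    by (intro LIMSEQ_le_const[of "\<lambda>n. (norm (u - X n))\<^sup>2"]) auto
  then have "(LINT x|lborel. (?f x)\<^sup>2) = 0"
    by (intro antisym integral_nonneg_AE) auto
  then have "AE x in lborel. (?f x)\<^sup>2 = 0"
    using integral_nonneg_eq_0_iff_AE[OF fi] by auto
  then show "u \<in> L2 \<Omega>" unfolding L2_def by (auto simp: indicator_def)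
qed

lemma complete_L2: "\<Omega> \<in> sets borel \<Longrightarrow> complete (L2 \<Omega>)"
  using complete_closed_subset[OF closed_L2 _ complete_l2] by blast

section \<open>The Poincare inequality\<close>

lemma partial_diff_eq: "(f has_derivative f') (at x) \<Longrightarrow> partial_diff i f x = f' (axis i 1)"
  unfolding partial_diff_def using frechet_derivative_at[of f f' x] by simp

lemma partial_diff_add:
  assumes "f differentiable at x" "g differentiable at x"
  shows "partial_diff i (\<lambda>y. f y + g y) x = partial_diff i f x + partial_diff i g x"
proof -
  obtain f' g' where "(f has_derivative f') (at x)" "(g has_derivative g') (at x)"
    using assms by (auto simp: differentiable_def)
  from this has_derivative_add[OF this] show ?thesis
    by (simp only: partial_diff_eq)
qed

lemma partial_diff_coord_mult:
  assumes "f differentiable at x"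
  shows "partial_diff j (\<lambda>y. y $ i * f y) x = (if i = j then f x else 0) + x $ i * partial_diff j f x"
proof -
  obtain f' where f: "(f has_derivative f') (at x)"
    using assms by (auto simp: differentiable_def)
  have "((\<lambda>y. y $ i * f y) has_derivative (\<lambda>h. x $ i * f' h + h $ i * f x)) (at x)"
    by (rule has_derivative_mult[OF bounded_linear_imp_has_derivative[OF bounded_linear_vec_nth] f])
  then show ?thesis by (simp add: partial_diff_eq[OF f] partial_diff_eq axis_def)
qed

lemma C_class_Suc_le: "C_class (Suc k) f \<Longrightarrow> C_class k f"
proof (induction k arbitrary: f)
  case 0
  then show ?case
    by (auto intro!: continuous_at_imp_continuous_on differentiable_imp_continuous_within)
qed auto

lemma C_class_zero: "C_class k (\<lambda>x::real^'n::finite. 0)"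
proof (induction k)
  case (Suc k)
  have "partial_diff i (\<lambda>x. 0) = (\<lambda>x. 0)" for i :: "'n::finite"
    by (rule ext) (simp add: partial_diff_eq[OF has_derivative_const])
  with Suc show ?case by simp
qed simp

lemma C_class_add: "C_class k f \<Longrightarrow> C_class k g \<Longrightarrow> C_class k (\<lambda>x. f x + g x)"
proof (induction k arbitrary: f g)
  case (Suc k)
  then have "partial_diff i (\<lambda>x. f x + g x) = (\<lambda>x. partial_diff i f x + partial_diff i g x)" for i
    by (auto intro!: partial_diff_add)
  with Suc show ?case by (auto intro: differentiable_add)
qed (auto intro: continuous_on_add)

lemma C_class_coord_mult: "C_class k f \<Longrightarrow> C_class k (\<lambda>x. x $ i * f x)"
proof (induction k arbitrary: f)
  case 0
  then have "continuous_on UNIV f" by simp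
  then have "continuous_on UNIV (\<lambda>x. x $ i * f x)"
    by (intro continuous_on_mult continuous_on_component continuous_on_id)
  then show ?case by simp
next
  case (Suc k)
  have d: "f differentiable at x" for x using Suc.prems by simp
  have "partial_diff j (\<lambda>x. x $ i * f x) = (\<lambda>x. (if i = j then f x else 0) + x $ i * partial_diff j f x)" for j
    by (rule ext) (rule partial_diff_coord_mult[OF d])
  moreover have "C_class k (\<lambda>x. (if i = j then f x else 0) + x $ i * partial_diff j f x)" for j
    using Suc C_class_Suc_le[OF Suc.prems] C_class_zero by (cases "i = j") (auto intro!: C_class_add)
  moreover have "(\<lambda>x. x $ i * f x) differentiable at x" for x
    using d by (intro differentiable_mult) (auto intro: bounded_linear_imp_differentiable bounded_linear_vec_nth)
  ultimately show ?case by simp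
qed

lemma test_function_coord_mult:
  assumes "test_function \<Omega> \<phi>" shows "test_function \<Omega> (\<lambda>x. x $ i * \<phi> x)"
proof -
  have s: "closure {x. x $ i * \<phi> x \<noteq> 0} \<subseteq> closure {x. \<phi> x \<noteq> 0}"
    by (rule closure_mono) auto
  moreover from this have "compact (closure {x. x $ i * \<phi> x \<noteq> 0})"
    using assms compact_Int_closed[of "closure {x. \<phi> x \<noteq> 0}" "closure {x. x $ i * \<phi> x \<noteq> 0}"]
    by (simp add: test_function_def Int_absorb1)
  ultimately show ?thesis using assms C_class_coord_mult unfolding test_function_def by blast
qed

lemma square_integrable_compact_support:
  fixes f :: "'a::euclidean_space \<Rightarrow> real"
  assumes f: "continuous_on UNIV f" and K: "compact K" "\<And>x. x \<notin> K \<Longrightarrow> f x = 0"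
  shows "square_integrable f"
proof -
  have "integrable lborel (\<lambda>x. indicator K x *\<^sub>R (f x)\<^sup>2)"
    by (rule borel_integrable_compact[OF K(1)]) (intro continuous_intros continuous_on_subset[OF f] subset_UNIV)
  moreover have "(\<lambda>x. indicator K x *\<^sub>R (f x)\<^sup>2) = (\<lambda>x. (f x)\<^sup>2)"
    using K(2) by (force simp: indicator_def)
  ultimately show ?thesis
    using f by (simp add: square_integrable_def borel_measurable_continuous_onI)
qed

lemma test_function_square_integrable:
  assumes "test_function \<Omega> \<phi>"
  shows "square_integrable \<phi>" "square_integrable (partial_diff i \<phi>)"
proof -
  let ?K = "closure {x. \<phi> x \<noteq> 0}"
  have K: "compact ?K" and C: "C_class k \<phi>" for k using assms by (auto simp: test_function_def)
  have z: "\<phi> x = 0" if "x \<notin> ?K" for x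
    using that closure_subset[of "{x. \<phi> x \<noteq> 0}"] by blast
  show "square_integrable \<phi>"
    by (rule square_integrable_compact_support[OF C[of 0, unfolded C_class.simps(1)] K z])
  \<comment> \<open>Off its support the function vanishes on a whole open set, hence so does its
    derivative.\<close>
  have "partial_diff i \<phi> x = 0" if x: "x \<notin> ?K" for x
  proof -
    have "(\<phi> has_derivative (\<lambda>h. 0)) (at x)"
    proof (rule has_derivative_transform_within_open[OF has_derivative_const])
      show "open (- ?K)" "x \<in> - ?K" using x by auto
      show "0 = \<phi> y" if "y \<in> - ?K" for y using z[of y] that by simp
    qed
    then show ?thesis by (rule partial_diff_eq)
  qed
  moreover have "continuous_on UNIV (partial_diff i \<phi>)"
    using C[of 1] by simp
  ultimately show "square_integrable (partial_diff i \<phi>)"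
    using square_integrable_compact_support[OF _ K] by blast
qed

text \<open>Extension by zero turns integrals over \<Omega> into inner products, so the definition
  of weak derivatives can be passed to limits.\<close>

lemma L2_set_integral:
  assumes [measurable]: "\<Omega> \<in> sets borel" and u: "u \<in> L2 \<Omega>" and f: "square_integrable f"
  shows "(LINT x:\<Omega>|lborel. rep_l2 u x * f x) = u \<bullet> abs_l2 f"
proof -
  have [measurable]: "f \<in> borel_measurable borel" "rep_l2 u \<in> borel_measurable borel"
    using f rep_l2_square_integrable[of u] by (simp_all add: square_integrable_def)
  have "(LINT x|lborel. indicator \<Omega> x *\<^sub>R (rep_l2 u x * f x)) = (LINT x|lborel. rep_l2 u x * f x)"
  proof (rule integral_cong_AE)
    have "AE x in lborel. x \<notin> \<Omega> \<longrightarrow> rep_l2 u x = 0" using u by (simp add: L2_def)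
    then show "AE x in lborel. indicator \<Omega> x *\<^sub>R (rep_l2 u x * f x) = rep_l2 u x * f x"
      by eventually_elim (auto simp: indicator_def)
  qed measurable
  then show ?thesis by (simp add: set_lebesgue_integral_def inner_l2_eq[OF f])
qed

lemma weak_partial_inner:
  assumes \<Omega>: "\<Omega> \<in> sets borel" and ug: "(u, g) \<in> weak_partial \<Omega> i" and \<phi>: "test_function \<Omega> \<phi>"
  shows "u \<bullet> abs_l2 (partial_diff i \<phi>) = - (g \<bullet> abs_l2 \<phi>)"
proof -
  have "u \<in> L2 \<Omega>" "g \<in> L2 \<Omega>" "(LINT x:\<Omega>|lborel. rep_l2 u x * partial_diff i \<phi> x)
          = - (LINT x:\<Omega>|lborel. rep_l2 g x * \<phi> x)"
    using ug \<phi> by (auto simp: weak_partial_def)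
  then show ?thesis using \<Omega> test_function_square_integrable[OF \<phi>] by (simp add: L2_set_integral)
qed

text \<open>The indicator makes multiplication by a coordinate a bounded operator on the whole space
  when \<Omega> is bounded.\<close>

definition coord_mult :: "(real^'n::finite) set \<Rightarrow> 'n \<Rightarrow> (real^'n) l2 \<Rightarrow> (real^'n) l2" where
  "coord_mult \<Omega> i u = abs_l2 (\<lambda>x. indicator \<Omega> x * x $ i * rep_l2 u x)"

lemma square_integrable_coord_mult:
  fixes \<Omega> :: "(real^'n::finite) set"
  assumes [measurable]: "\<Omega> \<in> sets borel" and M: "\<And>x. x \<in> \<Omega> \<Longrightarrow> norm x \<le> M" and f: "square_integrable f"
  shows "square_integrable (\<lambda>x. indicator \<Omega> x * x $ i * f x)"
    "(LINT x|lborel. (indicator \<Omega> x * x $ i * f x)\<^sup>2) \<le> M\<^sup>2 * (LINT x|lborel. (f x)\<^sup>2)"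
proof -
  have [measurable]: "f \<in> borel_measurable borel" "(\<lambda>x::real^'n. x $ i) \<in> borel_measurable borel"
    using f by (auto simp: square_integrable_def
        intro!: borel_measurable_continuous_onI continuous_on_component continuous_on_id)
  have i: "integrable lborel (\<lambda>x. M\<^sup>2 * (f x)\<^sup>2)" using f by (simp add: square_integrable_def)
  have le: "(indicator \<Omega> x * x $ i * f x)\<^sup>2 \<le> M\<^sup>2 * (f x)\<^sup>2" for x
  proof (cases "x \<in> \<Omega>")
    case True
    have "\<bar>x $ i\<bar> \<le> M" using M[OF True] component_le_norm_cart[of x i] by simp
    then have "(x $ i)\<^sup>2 \<le> M\<^sup>2" by (metis abs_ge_zero power2_abs power_mono)
    with True show ?thesis by (simp add: power_mult_distrib mult_right_mono)
  qed simp
  have i2: "integrable lborel (\<lambda>x. (indicator \<Omega> x * x $ i * f x)\<^sup>2)"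
    by (rule Bochner_Integration.integrable_bound[OF i]) (auto simp: le)
  then show "square_integrable (\<lambda>x. indicator \<Omega> x * x $ i * f x)"
    by (simp add: square_integrable_def)
  have "(LINT x|lborel. (indicator \<Omega> x * x $ i * f x)\<^sup>2) \<le> (LINT x|lborel. M\<^sup>2 * (f x)\<^sup>2)"
    by (rule integral_mono[OF i2 i le])
  then show "(LINT x|lborel. (indicator \<Omega> x * x $ i * f x)\<^sup>2) \<le> M\<^sup>2 * (LINT x|lborel. (f x)\<^sup>2)" by simp
qed

lemma norm_coord_mult_le:
  assumes \<Omega>: "\<Omega> \<in> sets borel" and M: "\<And>x. x \<in> \<Omega> \<Longrightarrow> norm x \<le> M" and "0 \<le> M"
  shows "norm (coord_mult \<Omega> i u) \<le> M * norm u"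
proof (rule power2_le_imp_le)
  note s = square_integrable_coord_mult[OF \<Omega> M rep_l2_square_integrable[of u], of i]
  show "(norm (coord_mult \<Omega> i u))\<^sup>2 \<le> (M * norm u)\<^sup>2"
    using s norm_abs_l2[OF s(1)] norm_abs_l2[OF rep_l2_square_integrable[of u]]
    by (simp add: coord_mult_def abs_rep_l2 power_mult_distrib)
qed (use assms in simp)

lemma coord_mult_inner:
  assumes \<Omega>: "\<Omega> \<in> sets borel" and M: "\<And>x. x \<in> \<Omega> \<Longrightarrow> norm x \<le> M"
    and f: "square_integrable f" and u: "u \<in> L2 \<Omega>" and xf: "square_integrable (\<lambda>x. x $ i * f x)"
  shows "coord_mult \<Omega> i u \<bullet> abs_l2 f = u \<bullet> abs_l2 (\<lambda>x. x $ i * f x)"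
proof -
  have "coord_mult \<Omega> i u \<bullet> abs_l2 f = (LINT x|lborel. indicator \<Omega> x * x $ i * rep_l2 u x * f x)"
    unfolding coord_mult_def
    by (intro inner_abs_l2 square_integrable_coord_mult[OF \<Omega> M] rep_l2_square_integrable f)
  also have "\<dots> = (LINT x:\<Omega>|lborel. rep_l2 u x * (x $ i * f x))"
    by (simp add: set_lebesgue_integral_def mult_ac)
  also have "\<dots> = u \<bullet> abs_l2 (\<lambda>x. x $ i * f x)" by (rule L2_set_integral[OF \<Omega> u xf])
  finally show ?thesis .
qed

lemma coord_mult_sym:
  assumes \<Omega>: "\<Omega> \<in> sets borel" and M: "\<And>x. x \<in> \<Omega> \<Longrightarrow> norm x \<le> M"
  shows "coord_mult \<Omega> i u \<bullet> v = u \<bullet> coord_mult \<Omega> i v"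
proof -
  have "coord_mult \<Omega> i u \<bullet> abs_l2 (rep_l2 v) = (LINT x|lborel. indicator \<Omega> x * x $ i * rep_l2 u x * rep_l2 v x)"
    unfolding coord_mult_def
    by (intro inner_abs_l2 square_integrable_coord_mult[OF \<Omega> M] rep_l2_square_integrable)
  also have "\<dots> = u \<bullet> coord_mult \<Omega> i v"
    unfolding coord_mult_def
    by (subst inner_l2_eq[OF square_integrable_coord_mult(1)[OF \<Omega> M rep_l2_square_integrable]]) (simp_all add: mult_ac)
  finally show ?thesis by (simp add: abs_rep_l2)
qed

text \<open>Testing the weak derivative with \<open>x\<^sub>i \<phi>\<close> and letting \<open>\<phi> \<rightarrow> u\<close> gives
  \<open>\<parallel>u\<parallel>\<^sup>2 = - 2 \<langle>x\<^sub>i u, \<partial>\<^sub>i u\<rangle>\<close>.\<close>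

lemma poincare_H10:
  fixes \<Omega> :: "(real^'n::finite) set"
  assumes \<Omega>: "\<Omega> \<in> sets borel" and M: "\<And>x. x \<in> \<Omega> \<Longrightarrow> norm x \<le> M" "0 \<le> M"
    and u: "u \<in> H10 \<Omega>" and g: "(u, g) \<in> weak_partial \<Omega> i"
  shows "norm u \<le> 2 * M * norm g"
proof -
  obtain \<phi> :: "nat \<Rightarrow> real^'n \<Rightarrow> real" where \<phi>: "\<And>k. test_function \<Omega> (\<phi> k)" and lim: "(\<lambda>k. abs_l2 (\<phi> k)) \<longlonglongrightarrow> u"
    and lim': "(\<lambda>k. abs_l2 (partial_diff i (\<phi> k))) \<longlonglongrightarrow> g"
    using u g by (auto simp: H10_def)
  have uL: "u \<in> L2 \<Omega>" and gL: "g \<in> L2 \<Omega>" using g by (auto simp: weak_partial_def)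
  let ?X = "coord_mult \<Omega> i"
  have e: "u \<bullet> abs_l2 (\<phi> k) + ?X u \<bullet> abs_l2 (partial_diff i (\<phi> k)) = - (?X g \<bullet> abs_l2 (\<phi> k))" for k
  proof -
    note t = test_function_coord_mult[OF \<phi>[of k], of i]
    note s = test_function_square_integrable[OF \<phi>[of k]] and st = test_function_square_integrable[OF t]
    have d: "\<phi> k differentiable at x" for x
      using \<phi>[of k] C_class.simps(2)[of 0 "\<phi> k"] unfolding test_function_def by blast
    have pd: "partial_diff i (\<lambda>x. x $ i * \<phi> k x) = (\<lambda>x. \<phi> k x + x $ i * partial_diff i (\<phi> k) x)"
      by (rule ext) (simp add: partial_diff_coord_mult[OF d])
    have x: "square_integrable (\<lambda>x. x $ i * partial_diff i (\<phi> k) x)"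
      using square_integrable_diff[OF st(2)[of i] s(1)] by (simp add: pd)
    have "u \<bullet> abs_l2 (partial_diff i (\<lambda>x. x $ i * \<phi> k x)) = u \<bullet> abs_l2 (\<phi> k) + u \<bullet> abs_l2 (\<lambda>x. x $ i * partial_diff i (\<phi> k) x)"
      unfolding pd by (simp add: inner_add_right flip: plus_abs_l2[OF s(1) x])
    then show ?thesis
      using weak_partial_inner[OF \<Omega> g t] coord_mult_inner[OF \<Omega> M(1) s(2) uL x]
        coord_mult_inner[OF \<Omega> M(1) s(1) gL st(1)] by simp
  qed
  have "(\<lambda>k. u \<bullet> abs_l2 (\<phi> k) + ?X u \<bullet> abs_l2 (partial_diff i (\<phi> k))) \<longlonglongrightarrow> u \<bullet> u + ?X u \<bullet> g"
    by (intro tendsto_intros lim lim')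
  moreover have "(\<lambda>k. - (?X g \<bullet> abs_l2 (\<phi> k))) \<longlonglongrightarrow> - (?X g \<bullet> u)"
    by (intro tendsto_intros lim)
  ultimately have "u \<bullet> u + ?X u \<bullet> g = - (?X g \<bullet> u)"
    unfolding e by (rule LIMSEQ_unique)
  then have "u \<bullet> u = - 2 * (?X u \<bullet> g)"
    using coord_mult_sym[OF \<Omega> M(1), where i = i and u = g and v = u] inner_commute[of g "?X u"] by linarith
  also have "\<dots> \<le> 2 * (norm (?X u) * norm g)"
    using abs_le_D2[OF Cauchy_Schwarz_ineq2[of "?X u" g]] by linarith
  also have "\<dots> \<le> 2 * (M * norm u * norm g)"
    by (intro mult_left_mono mult_right_mono norm_coord_mult_le[OF \<Omega> M]) auto
  also have "\<dots> = norm u * (2 * M * norm g)" by (simp add: mult_ac)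
  finally have "norm u * norm u \<le> norm u * (2 * M * norm g)"
    by (simp only: dot_square_norm power2_eq_square)
  then show ?thesis using M(2) by (cases "u = 0") auto
qed

text \<open>Integration by parts without boundary terms: \<open>u\<close> is a limit of test
  functions in the norm that includes first derivatives.\<close>

lemma weak_partial_self:
  fixes \<Omega> :: "(real^'n::finite) set"
  assumes \<Omega>: "\<Omega> \<in> sets borel" and u: "u \<in> H10 \<Omega>"
    and g: "(u, g) \<in> weak_partial \<Omega> i" and h: "(g, h) \<in> weak_partial \<Omega> i"
  shows "h \<bullet> u = - (g \<bullet> g)"
proof -
  obtain \<phi> :: "nat \<Rightarrow> real^'n \<Rightarrow> real" where \<phi>: "\<And>k. test_function \<Omega> (\<phi> k)" and lim: "(\<lambda>k. abs_l2 (\<phi> k)) \<longlonglongrightarrow> u"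
    and lim': "(\<lambda>k. abs_l2 (partial_diff i (\<phi> k))) \<longlonglongrightarrow> g"
    using u g by (auto simp: H10_def)
  have "(\<lambda>k. g \<bullet> abs_l2 (partial_diff i (\<phi> k))) \<longlonglongrightarrow> g \<bullet> g" by (intro tendsto_intros lim')
  moreover have "(\<lambda>k. - (h \<bullet> abs_l2 (\<phi> k))) \<longlonglongrightarrow> - (h \<bullet> u)" by (intro tendsto_intros lim)
  ultimately have "g \<bullet> g = - (h \<bullet> u)"
    unfolding weak_partial_inner[OF \<Omega> h \<phi>] by (rule LIMSEQ_unique)
  then show ?thesis by simp
qed

text \<open>Pairing with \<open>u\<close> gives the sum of the squared norms of the partial
  derivatives. With \<Omega> inside the ball of radius M, the Poincare constant is 2 M, whence m =
  1/(2 M)^2.\<close>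

lemma dirichlet_laplacian_coercive:
  fixes \<Omega> :: "(real^'n::finite) set"
  assumes "bounded_C2_domain \<Omega>"
  obtains m where "m > 0" "\<And>u f. (u, f) \<in> dirichlet_laplacian \<Omega> \<Longrightarrow> m * (norm u)\<^sup>2 \<le> f \<bullet> u"
proof -
  have \<Omega>: "\<Omega> \<in> sets borel" and "bounded \<Omega>" using assms by (auto simp: bounded_C2_domain_def)
  then obtain M where M: "M > 0" "\<And>x. x \<in> \<Omega> \<Longrightarrow> norm x \<le> M" by (auto simp: bounded_pos)
  show thesis
  proof
    show "0 < 1 / (2 * M)\<^sup>2" using M by simp
    fix u f assume "(u, f) \<in> dirichlet_laplacian \<Omega>"
    then obtain h where u: "u \<in> H10 \<Omega>" and h: "\<And>i. (u, h i) \<in> weak_partial \<Omega> i O weak_partial \<Omega> i"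
      and f: "f = - (\<Sum>i\<in>UNIV. h i)"
      by (auto simp: dirichlet_laplacian_def)
    obtain g where g: "\<And>i. (u, g i) \<in> weak_partial \<Omega> i" "\<And>i. (g i, h i) \<in> weak_partial \<Omega> i"
    proof -
    have "\<forall>i. \<exists>y. (u, y) \<in> weak_partial \<Omega> i \<and> (y, h i) \<in> weak_partial \<Omega> i"
      using h by auto
    then show ?thesis using that by metis
  qed
    have "f \<bullet> u = (\<Sum>i\<in>UNIV. g i \<bullet> g i)"
      unfolding f by (simp add: inner_sum_left weak_partial_self[OF \<Omega> u g] sum_negf)
    \<comment> \<open>One coordinate direction is enough for the Poincare inequality;
      \<open>undefined\<close> is just some index.\<close>
    also have "\<dots> \<ge> g undefined \<bullet> g undefined" by (rule member_le_sum) auto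
    finally have "(norm (g undefined))\<^sup>2 \<le> f \<bullet> u" by (simp add: power2_norm_eq_inner)
    moreover have "(norm u)\<^sup>2 \<le> (2 * M * norm (g undefined))\<^sup>2"
      using poincare_H10[OF \<Omega> M(2) less_imp_le[OF M(1)] u g(1)] by (intro power_mono) auto
    then have "(norm u)\<^sup>2 \<le> (norm (g undefined))\<^sup>2 * (2 * M)\<^sup>2"
      by (simp only: power_mult_distrib mult.commute)
    then have "1 / (2 * M)\<^sup>2 * (norm u)\<^sup>2 \<le> (norm (g undefined))\<^sup>2"
      using M(1) by (simp add: pos_divide_le_eq)
    ultimately show "1 / (2 * M)\<^sup>2 * (norm u)\<^sup>2 \<le> f \<bullet> u" by linarith
  qed
qed

section \<open>Orbits of groups and semigroups\<close>

lemma has_vector_derivativeI_quotient: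
  fixes f :: "real \<Rightarrow> 'a::real_normed_vector"
  assumes "((\<lambda>s. norm ((1 / (s - t)) *\<^sub>R (f s - f t) - D)) \<longlongrightarrow> 0) (at t within S)"
  shows "(f has_vector_derivative D) (at t within S)"
proof -
  have "((\<lambda>s. norm ((1 / norm (s - t)) *\<^sub>R (f s - (f t + (s - t) *\<^sub>R D)))) \<longlongrightarrow> 0) (at t within S)"
  proof (rule Lim_transform_eventually[OF assms])
    have "norm ((1 / (s - t)) *\<^sub>R (f s - f t) - D) = norm ((1 / norm (s - t)) *\<^sub>R (f s - (f t + (s - t) *\<^sub>R D)))"
      if "s \<noteq> t" for s
    proof -
      have "(1 / (s - t)) *\<^sub>R (f s - f t) - D = (1 / (s - t)) *\<^sub>R (f s - (f t + (s - t) *\<^sub>R D))"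
        using that by (simp add: scaleR_diff_right diff_diff_eq scaleR_add_right)
      then show ?thesis by simp
    qed
    then show "\<forall>\<^sub>F s in at t within S. norm ((1 / (s - t)) *\<^sub>R (f s - f t) - D)
        = norm ((1 / norm (s - t)) *\<^sub>R (f s - (f t + (s - t) *\<^sub>R D)))"
      unfolding eventually_at_filter by (intro always_eventually) simp
  qed
  then show ?thesis
    unfolding has_vector_derivative_def has_derivative_within
    by (intro conjI bounded_linear_scaleR_left, rule tendsto_norm_zero_cancel)
qed

text \<open>The norm \<open>N\<close> is not the norm of the ambient type. A linear \<Phi> with
  \<open>N x = norm (\<Phi> x)\<close> transports the space to one where the usual notions of limit
  and derivative apply.\<close>

locale normed_by =
  fixes X :: "'x::real_vector set" and N :: "'x \<Rightarrow> real" and \<Phi> :: "'x \<Rightarrow> 'k::real_normed_vector"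
  assumes subspace_X: "subspace X"
    and \<Phi>_lin: "x \<in> X \<Longrightarrow> y \<in> X \<Longrightarrow> \<Phi> (a *\<^sub>R x + b *\<^sub>R y) = a *\<^sub>R \<Phi> x + b *\<^sub>R \<Phi> y"
    and N_eq: "x \<in> X \<Longrightarrow> N x = norm (\<Phi> x)"
begin

lemma X_diff: "x \<in> X \<Longrightarrow> y \<in> X \<Longrightarrow> x - y \<in> X"
  and X_add: "x \<in> X \<Longrightarrow> y \<in> X \<Longrightarrow> x + y \<in> X"
  and X_scale: "x \<in> X \<Longrightarrow> a *\<^sub>R x \<in> X"
  using subspace_X by (auto intro: subspace_add subspace_scale subspace_diff)

lemma \<Phi>_diff: "x \<in> X \<Longrightarrow> y \<in> X \<Longrightarrow> \<Phi> (x - y) = \<Phi> x - \<Phi> y"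
  and \<Phi>_add: "x \<in> X \<Longrightarrow> y \<in> X \<Longrightarrow> \<Phi> (x + y) = \<Phi> x + \<Phi> y"
  and \<Phi>_scale: "x \<in> X \<Longrightarrow> \<Phi> (a *\<^sub>R x) = a *\<^sub>R \<Phi> x"
  using \<Phi>_lin[of x y 1 "-1"] \<Phi>_lin[of x y 1 1] \<Phi>_lin[of x x a 0] by simp_all

lemma N_quotient:
  "x \<in> X \<Longrightarrow> y \<in> X \<Longrightarrow> z \<in> X \<Longrightarrow> N (a *\<^sub>R (x - y) - z) = norm (a *\<^sub>R (\<Phi> x - \<Phi> y) - \<Phi> z)"
  by (simp add: N_eq X_diff X_scale \<Phi>_diff \<Phi>_scale)

lemma N_nonneg: "x \<in> X \<Longrightarrow> 0 \<le> N x"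
  by (simp add: N_eq)

context
  fixes J and S :: "real \<Rightarrow> 'x \<Rightarrow> 'x"
  assumes C0: "C0_on J X N S"
begin

lemma S_X: "t \<in> J \<Longrightarrow> x \<in> X \<Longrightarrow> S t x \<in> X"
  and S_lin: "t \<in> J \<Longrightarrow> x \<in> X \<Longrightarrow> y \<in> X \<Longrightarrow> S t (a *\<^sub>R x + b *\<^sub>R y) = a *\<^sub>R S t x + b *\<^sub>R S t y"
  and S_bounded: "t \<in> J \<Longrightarrow> \<exists>M. \<forall>x\<in>X. N (S t x) \<le> M * N x"
  and S_0: "x \<in> X \<Longrightarrow> S 0 x = x"
  and S_add: "s \<in> J \<Longrightarrow> t \<in> J \<Longrightarrow> x \<in> X \<Longrightarrow> S (s + t) x = S s (S t x)"
  and S_tendsto: "x \<in> X \<Longrightarrow> ((\<lambda>t. N (S t x - x)) \<longlongrightarrow> 0) (at 0 within J)"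
  using C0 unfolding C0_on_def by blast+

lemma S_diff: "t \<in> J \<Longrightarrow> x \<in> X \<Longrightarrow> y \<in> X \<Longrightarrow> S t (x - y) = S t x - S t y"
  and S_scale: "t \<in> J \<Longrightarrow> x \<in> X \<Longrightarrow> S t (a *\<^sub>R x) = a *\<^sub>R S t x"
  and S_plus: "t \<in> J \<Longrightarrow> x \<in> X \<Longrightarrow> y \<in> X \<Longrightarrow> S t (x + y) = S t x + S t y"
  using S_lin[of t x y 1 "-1"] S_lin[of t x x a 0] S_lin[of t x y 1 1] by simp_all

lemma S_bound_nonneg:
  assumes "t \<in> J"
  obtains M where "0 \<le> M" "\<And>x. x \<in> X \<Longrightarrow> N (S t x) \<le> M * N x"
proof -
  obtain M where M: "\<And>x. x \<in> X \<Longrightarrow> N (S t x) \<le> M * N x" using S_bounded[OF assms] by blast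
  have "N (S t x) \<le> \<bar>M\<bar> * N x" if "x \<in> X" for x
    by (rule order_trans[OF M[OF that] mult_right_mono[OF abs_ge_self N_nonneg[OF that]]])
  then show thesis by (intro that[of "\<bar>M\<bar>"]) auto
qed

lemma generator_orbit:
  assumes xy: "(x, y) \<in> generator_on J X N S" and t: "t \<in> J" and J: "J = UNIV \<or> J = {0..}"
  shows "(S t x, S t y) \<in> generator_on J X N S"
proof -
  have x: "x \<in> X" and y: "y \<in> X" and lim: "((\<lambda>h. N ((1 / h) *\<^sub>R (S h x - x) - y)) \<longlongrightarrow> 0) (at 0 within J)"
    using xy by (auto simp: generator_on_def)
  obtain M where M: "0 \<le> M" "\<And>x. x \<in> X \<Longrightarrow> N (S t x) \<le> M * N x" using S_bound_nonneg[OF t] by blast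
  have "((\<lambda>h. N ((1 / h) *\<^sub>R (S h (S t x) - S t x) - S t y)) \<longlongrightarrow> 0) (at 0 within J)"
  proof (rule Lim_null_comparison)
    show "((\<lambda>h. M * N ((1 / h) *\<^sub>R (S h x - x) - y)) \<longlongrightarrow> 0) (at 0 within J)"
      by (rule tendsto_mult_right_zero[OF lim])
    have "norm (N ((1 / h) *\<^sub>R (S h (S t x) - S t x) - S t y)) \<le> M * N ((1 / h) *\<^sub>R (S h x - x) - y)"
      if h: "h \<in> J" for h
    proof -
      have "S h (S t x) = S t (S h x)"
        using S_add[OF h t x] S_add[OF t h x] by (simp add: add.commute)
      then have "(1 / h) *\<^sub>R (S h (S t x) - S t x) - S t y = S t ((1 / h) *\<^sub>R (S h x - x) - y)"
        using S_X[OF h x] x y t by (simp add: S_diff S_scale X_diff X_scale)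
      moreover have "(1 / h) *\<^sub>R (S h x - x) - y \<in> X" by (intro X_diff X_scale S_X h x y)
      ultimately show ?thesis using M(2) N_nonneg[OF S_X[OF t]] by simp
    qed
    then show "\<forall>\<^sub>F h in at 0 within J. norm (N ((1 / h) *\<^sub>R (S h (S t x) - S t x) - S t y)) \<le> M * N ((1 / h) *\<^sub>R (S h x - x) - y)"
      unfolding eventually_at_filter by (intro always_eventually) blast
  qed
  then show ?thesis using S_X[OF t] x y by (simp add: generator_on_def)
qed

end

text \<open>A group admits negative increments, so the derivative at t is that at 0 of the orbit
  starting from \<open>S t x\<close>, translated.\<close>

lemma group_orbit_derivative:
  assumes C0: "C0_on UNIV X N S" and xy: "(x, y) \<in> generator_on UNIV X N S"
  shows "((\<lambda>t. \<Phi> (S t x)) has_vector_derivative \<Phi> (S t y)) (at t)"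
proof -
  note S = S_X[OF C0 UNIV_I]
  have x: "x \<in> X" "y \<in> X" using xy by (auto simp: generator_on_def)
  have "((\<lambda>h. N ((1 / h) *\<^sub>R (S h (S t x) - S t x) - S t y)) \<longlongrightarrow> 0) (at 0)"
    using generator_orbit[OF C0 xy] by (simp add: generator_on_def)
  then have "((\<lambda>s. N ((1 / (s - t)) *\<^sub>R (S (s - t) (S t x) - S t x) - S t y)) \<longlongrightarrow> 0) (at t)"
    using LIM_offset[of _ _ 0 "- t"] by fastforce
  moreover have "N ((1 / (s - t)) *\<^sub>R (S (s - t) (S t x) - S t x) - S t y)
      = norm ((1 / (s - t)) *\<^sub>R (\<Phi> (S s x) - \<Phi> (S t x)) - \<Phi> (S t y))" for s
  proof -
    have "S (s - t) (S t x) = S s x" using S_add[OF C0 UNIV_I UNIV_I x(1), of "s - t" t] by simp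
    then show ?thesis by (simp add: N_quotient S x)
  qed
  ultimately show ?thesis by (intro has_vector_derivativeI_quotient) simp
qed

text \<open>\<Phi> is not assumed injective. Since the Baire argument takes place in the image of
  \<Phi>, the norm of the orbit must depend on \<Phi> x alone.\<close>

lemma S_cong:
  assumes C0: "C0_on J X N S" and t: "t \<in> J" and x: "x \<in> X" "y \<in> X" "\<Phi> x = \<Phi> y"
  shows "N (S t x) = N (S t y)"
proof -
  obtain M where "N (S t (x - y)) \<le> M * N (x - y)"
    using S_bounded[OF C0 t] X_diff[OF x(1,2)] by blast
  then have "norm (\<Phi> (S t x) - \<Phi> (S t y)) \<le> 0"
    using x by (simp add: S_diff[OF C0 t] N_eq X_diff S_X[OF C0 t] \<Phi>_diff)
  then show ?thesis using x by (simp add: N_eq S_X[OF C0 t])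
qed

text \<open>Baire's theorem, applied to the sets of vectors whose orbit is bounded by \<open>k\<close> up to time \<open>1 / (k + 1)\<close>.\<close>

lemma semigroup_locally_bounded:
  assumes C0: "C0_on {0..} X N S" and complete: "complete (\<Phi> ` X)"
  shows "\<exists>\<eta> M. \<eta> > 0 \<and> 0 \<le> M \<and> (\<forall>h x. 0 \<le> h \<longrightarrow> h \<le> \<eta> \<longrightarrow> x \<in> X \<longrightarrow> N (S h x) \<le> M * N x)"
proof -
  note SX = S_X[OF C0]
  define G where "G k = {x \<in> X. \<forall>h. 0 \<le> h \<longrightarrow> h \<le> inverse (real (Suc k)) \<longrightarrow> N (S h x) \<le> real k}" for k
  interpret Y: Metric_space "\<Phi> ` X" dist
    by unfold_locales (auto simp: dist_commute dist_triangle)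
  have mcomplete: Y.mcomplete
    unfolding Y.mcomplete_def
  proof (intro allI impI)
    fix \<sigma> assume "Y.MCauchy \<sigma>"
    then have \<sigma>: "\<forall>n. \<sigma> n \<in> \<Phi> ` X" "Cauchy \<sigma>" by (auto simp: Y.MCauchy_def Cauchy_def)
    then obtain l where l: "l \<in> \<Phi> ` X" "\<sigma> \<longlonglongrightarrow> l"
      using complete[unfolded complete_def, THEN spec, of \<sigma>] by (elim impE bexE conjI)
    have "limitin Y.mtopology \<sigma> l sequentially"
      unfolding Y.limitin_metric using l(1) \<sigma>(1) tendstoD[OF l(2)] by simp
    then show "\<exists>l. limitin Y.mtopology \<sigma> l sequentially" by blast
  qed
  have closed: "closedin Y.mtopology (\<Phi> ` G k)" for k
    unfolding Y.metric_closedin_iff_sequentially_closed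
  proof (intro conjI allI impI)
    show "\<Phi> ` G k \<subseteq> \<Phi> ` X" by (auto simp: G_def)
    fix \<sigma> l assume "range \<sigma> \<subseteq> \<Phi> ` G k \<and> limitin Y.mtopology \<sigma> l sequentially"
    then have \<sigma>: "range \<sigma> \<subseteq> \<Phi> ` G k" and lim: "limitin Y.mtopology \<sigma> l sequentially" by blast+
    obtain x where x: "x \<in> X" "l = \<Phi> x" using lim by (auto simp: Y.limitin_metric)
    have "\<forall>n. \<exists>y. y \<in> G k \<and> \<sigma> n = \<Phi> y" using \<sigma> by blast
    then obtain y where y: "\<And>n. y n \<in> G k" "\<And>n. \<sigma> n = \<Phi> (y n)" by metis
    have yX: "y n \<in> X" for n using y(1)[of n] by (simp add: G_def)
    have "\<sigma> \<longlonglongrightarrow> l"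
    proof (rule tendstoI)
      fix e :: real assume "0 < e"
      then have "\<forall>\<^sub>F n in sequentially. \<sigma> n \<in> \<Phi> ` X \<and> dist (\<sigma> n) l < e" using lim by (simp add: Y.limitin_metric)
      then show "\<forall>\<^sub>F n in sequentially. dist (\<sigma> n) l < e" by (rule eventually_mono) simp
    qed
    have "N (S h x) \<le> real k" if h: "0 \<le> h" "h \<le> inverse (real (Suc k))" for h
    proof -
      have hJ: "h \<in> {0..}" using h by simp
      \<comment> \<open>Continuity of the single operator \<open>S h\<close> lets the bound pass to
        the limit; C may depend on h.\<close>
      obtain C where C: "\<And>z. z \<in> X \<Longrightarrow> N (S h z) \<le> C * N z" using S_bounded[OF C0 hJ] by blast
      have "N (S h x) \<le> real k + C * norm (l - \<sigma> n)" for n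
      proof -
        have "norm (\<Phi> (S h x)) \<le> norm (\<Phi> (S h (y n))) + norm (\<Phi> (S h x) - \<Phi> (S h (y n)))"
          using norm_triangle_ineq[of "\<Phi> (S h (y n))" "\<Phi> (S h x) - \<Phi> (S h (y n))"] by simp
        moreover have "N (S h (y n)) \<le> real k" using y(1)[of n] h by (simp add: G_def)
        moreover have "N (S h (x - y n)) \<le> C * N (x - y n)" by (rule C[OF X_diff[OF x(1) yX]])
        ultimately show ?thesis
          using x yX by (simp add: S_diff[OF C0 hJ] N_eq X_diff SX[OF hJ] \<Phi>_diff y(2))
      qed
      moreover have "(\<lambda>n. real k + C * norm (l - \<sigma> n)) \<longlonglongrightarrow> real k + C * norm (l - l)"
        by (intro tendsto_intros \<open>\<sigma> \<longlonglongrightarrow> l\<close>)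
      ultimately have "N (S h x) \<le> real k + C * norm (l - l)"
        by (intro LIMSEQ_le_const[of "\<lambda>n. real k + C * norm (l - \<sigma> n)"]) auto
      then show ?thesis by simp
    qed
    then show "l \<in> \<Phi> ` G k" using x by (auto simp: G_def)
  qed
  have "x \<in> (\<Union>k. G k)" if x: "x \<in> X" for x
  proof -
    have "\<forall>\<^sub>F t in at 0 within {0..}. N (S t x - x) < 1"
      using S_tendsto[OF C0 x] by (intro order_tendstoD) auto
    then obtain d where d: "d > 0" "\<And>t. 0 \<le> t \<Longrightarrow> t \<noteq> 0 \<Longrightarrow> t < d \<Longrightarrow> N (S t x - x) < 1"
      unfolding eventually_at by (auto simp: dist_real_def)
    obtain k where k: "inverse (real (Suc k)) < d" "N x + 1 \<le> real k"
    proof -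
      obtain a where a: "inverse (real (Suc a)) < d" using reals_Archimedean[OF d(1)] by blast
      obtain b where b: "N x + 1 \<le> real b" using real_arch_simple by blast
      show thesis by (rule that[of "max a b"], rule le_less_trans[OF _ a], simp, rule order_trans[OF b], simp)
    qed
    have "N (S h x) \<le> real k" if h: "0 \<le> h" "h \<le> inverse (real (Suc k))" for h
    proof (cases "h = 0")
      case True
      then show ?thesis using k(2) by (simp add: S_0[OF C0 x])
    next
      case False
      have "S h x \<in> X" using SX x h by simp
      moreover have "N (S h x - x) < 1" using d(2)[OF h(1) False] h(2) k(1) by simp
      moreover have "norm (\<Phi> (S h x)) \<le> norm (\<Phi> (S h x) - \<Phi> x) + norm (\<Phi> x)"
        using norm_triangle_ineq[of "\<Phi> (S h x) - \<Phi> x" "\<Phi> x"] by simp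
      ultimately show ?thesis using k(2) x by (simp add: N_eq X_diff \<Phi>_diff)
    qed
    then show ?thesis using x by (auto simp: G_def)
  qed
  moreover have "G k \<subseteq> X" for k by (auto simp: G_def)
  ultimately have "(\<Union>k. G k) = X" by blast
  then have "\<Union> (range (\<lambda>k. \<Phi> ` G k)) = \<Phi> ` X" by (simp flip: image_UN)
  moreover have "\<Phi> 0 \<in> Y.mtopology interior_of (\<Phi> ` X)"
    using interior_of_topspace[of Y.mtopology] subspace_0[OF subspace_X] by simp
  ultimately have "Y.mtopology interior_of \<Union> (range (\<lambda>k. \<Phi> ` G k)) \<noteq> {}" by auto
  moreover have "Y.mtopology interior_of \<Union> (range (\<lambda>k. \<Phi> ` G k)) = {}" if "\<And>k. Y.mtopology interior_of (\<Phi> ` G k) = {}"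
    by (rule Y.metric_Baire_category_alt[OF mcomplete]) (use closed that in auto)
  ultimately obtain k where "Y.mtopology interior_of (\<Phi> ` G k) \<noteq> {}" by blast
  then obtain y where "y \<in> Y.mtopology interior_of (\<Phi> ` G k)" by blast
  then obtain \<rho> where \<rho>: "y \<in> \<Phi> ` X" "\<rho> > 0" "Y.mball y \<rho> \<subseteq> \<Phi> ` G k"
    unfolding Y.in_interior_of_mball by blast
  obtain x\<^sub>0 where x0: "x\<^sub>0 \<in> X" "y = \<Phi> x\<^sub>0" using \<rho>(1) by blast
  have ball: "N (S h x) \<le> real k" if x: "x \<in> X" "norm (\<Phi> x - \<Phi> x\<^sub>0) < \<rho>" and h: "0 \<le> h" "h \<le> inverse (real (Suc k))" for x h
  proof -
    have "\<Phi> x \<in> Y.mball y \<rho>" using x x0 by (simp add: dist_norm norm_minus_commute)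
    then obtain z where "z \<in> G k" "\<Phi> x = \<Phi> z" using \<rho>(3) by blast
    then show ?thesis using S_cong[OF C0 _ x(1), of h z] h by (simp add: G_def)
  qed
  have "N (S h z) \<le> 4 * real k / \<rho> * N z" if h: "0 \<le> h" "h \<le> inverse (real (Suc k))" and z: "z \<in> X" for h z
  proof (cases "N z = 0")
    case True
    have "h \<in> {0..}" using h by simp
    then show ?thesis using S_bounded[OF C0] True z by fastforce
  next
    case False
    then have Nz: "0 < N z" using N_nonneg[OF z] by simp
    \<comment> \<open>The scaling moves \<open>x\<^sub>0\<close> by half the radius in the direction
      of z. Both ends lie in the ball, so subtracting their orbits gives a N (S h z) \<le> 2
      k.\<close>
    define a where "a = \<rho> / (2 * N z)"
    have hJ: "h \<in> {0..}" and a: "0 < a" using h Nz \<rho>(2) by (simp_all add: a_def)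
    note w = X_add[OF x0(1) X_scale[OF z, of a]]
    have "norm (\<Phi> (x\<^sub>0 + a *\<^sub>R z) - \<Phi> x\<^sub>0) = a * N z"
      using a by (simp add: \<Phi>_add \<Phi>_scale N_eq x0 z X_scale)
    also have "\<dots> < \<rho>" using Nz \<rho>(2) by (simp add: a_def)
    finally have "N (S h (x\<^sub>0 + a *\<^sub>R z)) \<le> real k" by (rule ball[OF w _ h])
    moreover have "N (S h x\<^sub>0) \<le> real k" using \<rho>(2) by (intro ball x0 h) simp
    moreover have "norm (a *\<^sub>R \<Phi> (S h z)) \<le> norm (\<Phi> (S h x\<^sub>0) + a *\<^sub>R \<Phi> (S h z)) + norm (\<Phi> (S h x\<^sub>0))"
      using norm_triangle_ineq4[of "\<Phi> (S h x\<^sub>0) + a *\<^sub>R \<Phi> (S h z)" "\<Phi> (S h x\<^sub>0)"] by simp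
    ultimately have "a * N (S h z) \<le> 2 * real k"
      using a by (simp add: S_plus[OF C0 hJ] S_scale[OF C0 hJ] N_eq SX[OF hJ] x0 z X_add X_scale \<Phi>_add \<Phi>_scale)
    then show ?thesis using \<rho>(2) Nz by (simp add: a_def field_simps)
  qed
  moreover have "0 < inverse (real (Suc k))" "0 \<le> 4 * real k / \<rho>" using \<rho>(2) by simp_all
  ultimately show ?thesis by blast
qed

text \<open>For s < t the quotient carries the factor \<open>S s\<close>, with s varying.
  \<open>C0_on\<close> bounds only each single operator, so the left derivative needs the bound of
  \<open>semigroup_locally_bounded\<close>.\<close>

lemma semigroup_orbit_derivative:
  assumes C0: "C0_on {0..} X N S" and complete: "complete (\<Phi> ` X)"
    and xy: "(x, y) \<in> generator_on {0..} X N S" and t: "0 \<le> t"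
  shows "((\<lambda>t. \<Phi> (S t x)) has_vector_derivative \<Phi> (S t y)) (at t within {0..})"
proof -
  note SX = S_X[OF C0]
  have x: "x \<in> X" and y: "y \<in> X" and lim: "((\<lambda>h. N ((1 / h) *\<^sub>R (S h x - x) - y)) \<longlongrightarrow> 0) (at 0 within {0..})"
    using xy by (auto simp: generator_on_def)
  \<comment> \<open>The quotient error plus the continuity error of the orbit of y; the second
    summand arises on the left side, where \<open>S t y = S s (S h y)\<close>.\<close>
  define \<rho> where "\<rho> h = N ((1 / h) *\<^sub>R (S h x - x) - y) + N (S h y - y)" for h
  have \<rho>: "(\<rho> \<longlongrightarrow> 0) (at 0 within {0..})"
    unfolding \<rho>_def using tendsto_add[OF lim S_tendsto[OF C0 y]] by simp
  have "filterlim (\<lambda>s. \<bar>s - t\<bar>) (at 0 within {0..}) (at t within {0..})"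
  proof (subst filterlim_at, rule conjI)
    show "\<forall>\<^sub>F s in at t within {0..}. \<bar>s - t\<bar> \<in> {0..} \<and> \<bar>s - t\<bar> \<noteq> 0"
      unfolding eventually_at_filter by (intro always_eventually) simp
    have "((\<lambda>s. \<bar>s - t\<bar>) \<longlongrightarrow> \<bar>t - t\<bar>) (at t within {0..})" by (intro tendsto_intros)
    then show "((\<lambda>s. \<bar>s - t\<bar>) \<longlongrightarrow> 0) (at t within {0..})" by simp
  qed
  then have \<rho>': "((\<lambda>s. \<rho> \<bar>s - t\<bar>) \<longlongrightarrow> 0) (at t within {0..})"
    using \<rho> by (rule filterlim_compose[rotated])
  obtain \<eta> M where \<eta>: "\<eta> > 0" and M: "0 \<le> M" "\<And>h x. 0 \<le> h \<Longrightarrow> h \<le> \<eta> \<Longrightarrow> x \<in> X \<Longrightarrow> N (S h x) \<le> M * N x"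
    using semigroup_locally_bounded[OF C0 complete] by blast
  \<comment> \<open>For s in [t - e, t], \<open>S s\<close> factors as \<open>S (t - e)\<close>
    after an operator with time at most \<eta>, so one constant serves all these s. The minimum
    keeps t - e nonnegative.\<close>
  define e where "e = min \<eta> t"
  have e: "0 \<le> e" "e \<le> \<eta>" "e \<le> t" using \<eta> t by (auto simp: e_def)
  obtain C where C: "0 \<le> C" "\<And>x. x \<in> X \<Longrightarrow> N (S (t - e) x) \<le> C * N x"
    using S_bound_nonneg[OF C0, of "t - e"] e by auto
  obtain C' where C': "0 \<le> C'" "\<And>x. x \<in> X \<Longrightarrow> N (S t x) \<le> C' * N x"
    using S_bound_nonneg[OF C0, of t] t by auto
  have near: "N (S s z) \<le> C * M * N z" if s: "t - e \<le> s" "s \<le> t" and z: "z \<in> X" for s z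
  proof -
    have "S s z = S (t - e) (S (s - (t - e)) z)"
      using S_add[OF C0 _ _ z, of "t - e" "s - (t - e)"] s e by simp
    moreover have "N (S (s - (t - e)) z) \<le> M * N z" using M(2) s e z by simp
    moreover have "S (s - (t - e)) z \<in> X" using SX s z by simp
    ultimately have "N (S s z) \<le> C * N (S (s - (t - e)) z)" using C(2) by simp
    also have "\<dots> \<le> C * (M * N z)"
      using \<open>N (S (s - (t - e)) z) \<le> M * N z\<close> C(1) by (rule mult_left_mono)
    finally show ?thesis by (simp add: mult.assoc)
  qed
  define B where "B = max C' (C * M)"
  have est: "norm (N ((1 / (s - t)) *\<^sub>R (S s x - S t x) - S t y)) \<le> B * \<rho> \<bar>s - t\<bar>"
    if s: "0 \<le> s" "s \<noteq> t" "t - \<eta> < s" for s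
  proof (cases "t < s")
    case True
    define h where "h = s - t"
    have h: "0 < h" "s = t + h" "\<bar>s - t\<bar> = h" "s - t = h" using True by (auto simp: h_def)
    have "S (t + h) x = S t (S h x)" by (rule S_add[OF C0 _ _ x]) (use t h(1) in auto)
    then have "S s x = S t (S h x)" by (simp only: h(2))
    then have eq: "(1 / h) *\<^sub>R (S s x - S t x) - S t y = S t ((1 / h) *\<^sub>R (S h x - x) - y)"
    proof -
      have tJ: "t \<in> {0..}" "h \<in> {0..}" using t h by auto
      show ?thesis
        using SX[OF tJ(2) x] x y tJ(1) \<open>S s x = _\<close> by (simp only: S_diff[OF C0] S_scale[OF C0] X_diff X_scale)
    qed
    have X: "(1 / h) *\<^sub>R (S h x - x) - y \<in> X" "S h y - y \<in> X" using h by (auto intro!: X_diff X_scale SX x y)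
    have "N (S t ((1 / h) *\<^sub>R (S h x - x) - y)) \<le> C' * N ((1 / h) *\<^sub>R (S h x - x) - y)" by (rule C'(2)[OF X(1)])
    also have "\<dots> \<le> B * \<rho> h"
      unfolding \<rho>_def B_def using C'(1) N_nonneg[OF X(1)] N_nonneg[OF X(2)] by (intro mult_mono) auto
    finally show ?thesis
      unfolding h(3) unfolding h(4) eq using N_nonneg[OF SX[OF _ X(1)], of t] t by simp
  next
    case False
    define h where "h = t - s"
    have h: "0 < h" "s = t - h" "\<bar>s - t\<bar> = h" "s - t = - h" using False s by (auto simp: h_def)
    have hs: "t - e \<le> s" using s by (auto simp: e_def)
    have X: "(1 / h) *\<^sub>R (S h x - x) - y \<in> X" "S h y - y \<in> X" using h by (auto intro!: X_diff X_scale SX x y)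
    have "S t x = S s (S h x)" "S t y = S s (S h y)"
      using S_add[OF C0 _ _ x, of s h] S_add[OF C0 _ _ y, of s h] s(1) h(1) by (simp_all add: h(2))
    then have eq: "(1 / (s - t)) *\<^sub>R (S s x - S t x) - S t y = S s ((1 / h) *\<^sub>R (S h x - x) - y) - S s (S h y - y)"
    proof -
      have sJ: "s \<in> {0..}" "h \<in> {0..}" using s h by auto
      have "(1 / (s - t)) *\<^sub>R (S s x - S t x) - S t y = (1 / h) *\<^sub>R (S s (S h x) - S s x) - S s (S h y)"
        using \<open>S t x = _\<close> \<open>S t y = _\<close> h(1) by (simp add: h(4) scaleR_diff_right)
      also have "\<dots> = S s ((1 / h) *\<^sub>R (S h x - x)) - S s (S h y)"
        using SX[OF sJ(2)] x y sJ(1) by (simp only: S_diff[OF C0] S_scale[OF C0] X_diff)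
      also have "\<dots> = S s ((1 / h) *\<^sub>R (S h x - x) - y) - S s (S h y - y)"
        using SX[OF sJ(2)] x y sJ(1) by (simp add: S_diff[OF C0 sJ(1)] X_diff X_scale)
      finally show ?thesis .
    qed
    have sX: "S s ((1 / h) *\<^sub>R (S h x - x) - y) \<in> X" "S s (S h y - y) \<in> X"
      using SX X s by auto
    have "N ((1 / (s - t)) *\<^sub>R (S s x - S t x) - S t y) \<le> N (S s ((1 / h) *\<^sub>R (S h x - x) - y)) + N (S s (S h y - y))"
      unfolding eq using sX by (simp add: N_eq X_diff \<Phi>_diff norm_triangle_ineq4)
    also have "\<dots> \<le> C * M * N ((1 / h) *\<^sub>R (S h x - x) - y) + C * M * N (S h y - y)"
      using near[OF hs] False X by (intro add_mono) auto
    also have "\<dots> = C * M * \<rho> h" by (simp add: \<rho>_def distrib_left)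
    also have "\<dots> \<le> B * \<rho> h"
      unfolding \<rho>_def B_def using N_nonneg[OF X(1)] N_nonneg[OF X(2)] by (intro mult_right_mono) auto
    finally show ?thesis using N_nonneg[OF X_diff[OF sX]] by (simp add: eq h(3))
  qed
  have "((\<lambda>s. N ((1 / (s - t)) *\<^sub>R (S s x - S t x) - S t y)) \<longlongrightarrow> 0) (at t within {0..})"
  proof (rule Lim_null_comparison)
    show "((\<lambda>s. B * \<rho> \<bar>s - t\<bar>) \<longlongrightarrow> 0) (at t within {0..})" by (rule tendsto_mult_right_zero[OF \<rho>'])
    show "\<forall>\<^sub>F s in at t within {0..}. norm (N ((1 / (s - t)) *\<^sub>R (S s x - S t x) - S t y)) \<le> B * \<rho> \<bar>s - t\<bar>"
      unfolding eventually_at using \<eta> est by (intro exI[of _ \<eta>]) (auto simp: dist_real_def)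
  qed
  then have "((\<lambda>s. norm ((1 / (s - t)) *\<^sub>R (\<Phi> (S s x) - \<Phi> (S t x)) - \<Phi> (S t y))) \<longlongrightarrow> 0) (at t within {0..})"
  proof (rule Lim_transform_eventually)
    show "\<forall>\<^sub>F s in at t within {0..}. N ((1 / (s - t)) *\<^sub>R (S s x - S t x) - S t y)
        = norm ((1 / (s - t)) *\<^sub>R (\<Phi> (S s x) - \<Phi> (S t x)) - \<Phi> (S t y))"
      unfolding eventually_at_filter using SX x y t
      by (intro always_eventually) (auto intro!: N_quotient)
  qed
  then show ?thesis by (rule has_vector_derivativeI_quotient)
qed

end

section \<open>Regularised solutions\<close>

locale coercive_operator = self_adjoint_operator H R for H :: "'h::real_inner set" and R +
  fixes m :: real
  assumes m: "m > 0" and coercive: "x \<in> D \<Longrightarrow> r x \<in> D \<Longrightarrow> m * (norm x)\<^sup>2 \<le> r (r x) \<bullet> x"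
begin

text \<open>Coercivity is assumed only on the domain of the squared operator. Smoothing reaches all
  of \<open>D\<close>, since \<open>r (J \<epsilon> x) = J \<epsilon> (r x)\<close> is bounded by
  \<open>r x\<close>.\<close>

lemma poincare:
  assumes x: "x \<in> D"
  shows "norm x \<le> (1 / sqrt m) * norm (r x)"
proof -
  have "m * (norm (J \<epsilon> x))\<^sup>2 \<le> (norm (r x))\<^sup>2" if \<epsilon>: "0 < \<epsilon>" for \<epsilon>
  proof -
    note J = J_D[OF \<epsilon> D_H[OF x]] rJ_D[OF \<epsilon> D_H[OF x]]
    have "m * (norm (J \<epsilon> x))\<^sup>2 \<le> (norm (r (J \<epsilon> x)))\<^sup>2"
      using coercive[OF J] r_sym[OF J(2) J(1)] by (simp add: power2_norm_eq_inner)
    also have "\<dots> = (norm (J \<epsilon> (r x)))\<^sup>2" by (simp only: J_commute[OF \<epsilon> x])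
    also have "\<dots> \<le> (norm (r x))\<^sup>2" by (intro power_mono norm_J_le[OF \<epsilon> r_H[OF x]] norm_ge_zero)
    finally show ?thesis .
  qed
  then have ev: "\<forall>\<^sub>F \<epsilon> in at_right 0. m * (norm (J \<epsilon> x))\<^sup>2 \<le> (norm (r x))\<^sup>2"
    by (simp add: eventually_at_filter)
  have "((\<lambda>\<epsilon>. m * (norm (J \<epsilon> x))\<^sup>2) \<longlongrightarrow> m * (norm x)\<^sup>2) (at_right 0)"
    by (intro tendsto_intros J_tendsto D_H x)
  then have "m * (norm x)\<^sup>2 \<le> (norm (r x))\<^sup>2"
    by (rule tendsto_upperbound[OF _ ev]) simp
  then have "sqrt (m * (norm x)\<^sup>2) \<le> norm (r x)" by (intro real_le_lsqrt) auto
  then show ?thesis using m by (simp add: real_sqrt_mult pos_le_divide_eq mult.commute)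
qed

lemma poincare_sq: "x \<in> D \<Longrightarrow> x \<bullet> x \<le> (1 / m) * (r x \<bullet> r x)"
  using power_mono[OF poincare norm_ge_zero, of x 2] m
  by (simp add: power_mult_distrib power_divide power2_norm_eq_inner)

end

locale mgt_problem = coercive_operator H R m + mgt_params \<alpha> c \<delta>
  for H :: "'h::real_inner set" and R m \<alpha> c \<delta>
begin

abbreviation smooth\<^sub>1 where "smooth\<^sub>1 \<epsilon> f \<equiv> \<lambda>t::real. r (J \<epsilon> (f t))"
abbreviation smooth\<^sub>2 where "smooth\<^sub>2 \<epsilon> f \<equiv> \<lambda>t::real. r (r (J \<epsilon> (f t)))"

text \<open>Differentiability is required in the phase space norms, that is for
  \<open>r (u t)\<close>, \<open>r (v t)\<close> and \<open>w t\<close>, because that is what orbits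
  deliver. The value \<tau> = 0 gives the limit equation, where \<open>w\<close> need not be
  differentiable.\<close>

definition solution :: "real \<Rightarrow> (real \<Rightarrow> 'h) \<Rightarrow> (real \<Rightarrow> 'h) \<Rightarrow> (real \<Rightarrow> 'h) \<Rightarrow> (real \<Rightarrow> 'h) \<Rightarrow> bool" where
  "solution \<tau> u v w g \<longleftrightarrow> (\<forall>t\<ge>0. u t \<in> D \<and> v t \<in> D \<and> w t \<in> D \<and> g t \<in> H \<and>
     c\<^sup>2 *\<^sub>R u t + (\<delta> + \<tau> * c\<^sup>2) *\<^sub>R v t \<in> D \<and> r (c\<^sup>2 *\<^sub>R u t + (\<delta> + \<tau> * c\<^sup>2) *\<^sub>R v t) \<in> D \<and>
     \<tau> *\<^sub>R g t + \<alpha> *\<^sub>R w t + r (r (c\<^sup>2 *\<^sub>R u t + (\<delta> + \<tau> * c\<^sup>2) *\<^sub>R v t)) = 0 \<and>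
     ((\<lambda>t. r (u t)) has_vector_derivative r (v t)) (at t within {0..}) \<and>
     ((\<lambda>t. r (v t)) has_vector_derivative r (w t)) (at t within {0..}) \<and>
     (\<tau> \<noteq> 0 \<longrightarrow> (w has_vector_derivative g t) (at t within {0..})))"

lemma
  assumes "solution \<tau> u v w g" and "0 \<le> t"
  shows sol_u: "u t \<in> D" and sol_v: "v t \<in> D" and sol_w: "w t \<in> D" and sol_g: "g t \<in> H"
    and sol_y: "c\<^sup>2 *\<^sub>R u t + (\<delta> + \<tau> * c\<^sup>2) *\<^sub>R v t \<in> D"
    and sol_ry: "r (c\<^sup>2 *\<^sub>R u t + (\<delta> + \<tau> * c\<^sup>2) *\<^sub>R v t) \<in> D"
    and sol_eq: "\<tau> *\<^sub>R g t + \<alpha> *\<^sub>R w t + r (r (c\<^sup>2 *\<^sub>R u t + (\<delta> + \<tau> * c\<^sup>2) *\<^sub>R v t)) = 0"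
    and sol_du: "((\<lambda>t. r (u t)) has_vector_derivative r (v t)) (at t within {0..})"
    and sol_dv: "((\<lambda>t. r (v t)) has_vector_derivative r (w t)) (at t within {0..})"
    and sol_dw: "\<tau> \<noteq> 0 \<Longrightarrow> (w has_vector_derivative g t) (at t within {0..})"
  using assms unfolding solution_def by blast+

text \<open>The operator is applied to the combination, because the generators put only the
  combination into its domain.\<close>

definition stress :: "real \<Rightarrow> (real \<Rightarrow> 'h) \<Rightarrow> (real \<Rightarrow> 'h) \<Rightarrow> real \<Rightarrow> 'h" where
  "stress \<tau> u v t = r (r (c\<^sup>2 *\<^sub>R u t + (\<delta> + \<tau> * c\<^sup>2) *\<^sub>R v t))"

lemma stress_inner:
  assumes s: "solution \<tau> u v w g" and t: "0 \<le> t" and x: "x \<in> D"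
  shows "stress \<tau> u v t \<bullet> x = (c\<^sup>2 *\<^sub>R r (u t) + (\<delta> + \<tau> * c\<^sup>2) *\<^sub>R r (v t)) \<bullet> r x"
  unfolding stress_def unfolding r_sym[OF sol_ry[OF s t] x]
  unfolding r_lin(2)[OF sol_u[OF s t] sol_v[OF s t]] by (rule refl)

text \<open>After smoothing, \<open>u\<close> and \<open>v\<close> separately admit two applications
  of \<open>r\<close>, so the stress splits into its two parts.\<close>

lemma rJ_stress_inner:
  assumes s: "solution \<tau> u v w g" and t: "0 \<le> t" and x: "x \<in> H" and \<epsilon>: "\<epsilon> > 0"
  shows "r (J \<epsilon> (stress \<tau> u v t)) \<bullet> r (J \<epsilon> x)
    = (c\<^sup>2 *\<^sub>R r (r (J \<epsilon> (u t))) + (\<delta> + \<tau> * c\<^sup>2) *\<^sub>R r (r (J \<epsilon> (v t)))) \<bullet> r (r (J \<epsilon> x))"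
proof -
  define b where "b = \<delta> + \<tau> * c\<^sup>2"
  let ?y = "c\<^sup>2 *\<^sub>R u t + b *\<^sub>R v t"
  note y = sol_y[OF s t, folded b_def] sol_ry[OF s t, folded b_def]
  note u = sol_u[OF s t] and v = sol_v[OF s t]
  have st: "stress \<tau> u v t = r (r ?y)" by (simp only: stress_def b_def)
  have "J \<epsilon> (r (r ?y)) = r (r (J \<epsilon> ?y))"
    by (simp only: J_commute[OF \<epsilon> y(2)] J_commute[OF \<epsilon> y(1)])
  moreover have "J \<epsilon> ?y = c\<^sup>2 *\<^sub>R J \<epsilon> (u t) + b *\<^sub>R J \<epsilon> (v t)"
    by (rule J_lin[OF \<epsilon> D_H[OF u] D_H[OF v]])
  moreover have "r (c\<^sup>2 *\<^sub>R J \<epsilon> (u t) + b *\<^sub>R J \<epsilon> (v t)) = c\<^sup>2 *\<^sub>R r (J \<epsilon> (u t)) + b *\<^sub>R r (J \<epsilon> (v t))"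
    by (rule r_lin(2)[OF J_D[OF \<epsilon> D_H[OF u]] J_D[OF \<epsilon> D_H[OF v]]])
  moreover have "r (c\<^sup>2 *\<^sub>R r (J \<epsilon> (u t)) + b *\<^sub>R r (J \<epsilon> (v t))) = c\<^sup>2 *\<^sub>R r (r (J \<epsilon> (u t))) + b *\<^sub>R r (r (J \<epsilon> (v t)))"
    by (rule r_lin(2)[OF rJ_D[OF \<epsilon> D_H[OF u]] rJ_D[OF \<epsilon> D_H[OF v]]])
  ultimately have e: "J \<epsilon> (stress \<tau> u v t) = c\<^sup>2 *\<^sub>R r (r (J \<epsilon> (u t))) + b *\<^sub>R r (r (J \<epsilon> (v t)))"
    by (simp only: st)
  have "stress \<tau> u v t \<in> H" unfolding st by (rule r_H[OF y(2)])
  show ?thesis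
    unfolding r_sym[OF J_D[OF \<epsilon> \<open>stress \<tau> u v t \<in> H\<close>] rJ_D[OF \<epsilon> x]]
    unfolding e b_def by (rule refl)
qed

text \<open>The unsmoothed level, used for uniform boundedness. The derivative of \<open>v\<close>
  in the base norm comes from that of \<open>r (v t)\<close> by the Poincare inequality.\<close>

lemma solution_curve:
  assumes s: "solution \<tau> u v w g" and \<tau>: "0 \<le> \<tau>" "\<tau> \<le> tau_max"
  shows "mgt_curve \<alpha> c \<delta> \<tau> v w g (\<lambda>t. r (u t)) (\<lambda>t. r (v t)) (\<lambda>t. r (w t)) (stress \<tau> u v)"
proof (unfold_locales)
  fix t :: real assume t: "0 \<le> t"
  show "(v has_vector_derivative w t) (at t within {0..})"
  proof (rule has_vector_derivative_dominated[OF sol_dv[OF s t]])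
    fix x :: real assume "x \<in> {0..}"
    then have x: "0 \<le> x" by simp
    have d: "v x - v t \<in> D" and d': "v x - v t - (x - t) *\<^sub>R w t \<in> D"
      by (intro subspace_diff[OF subspace_D] subspace_scale[OF subspace_D] sol_v[OF s x] sol_v[OF s t] sol_w[OF s t])+
    have "r (v x - v t - (x - t) *\<^sub>R w t) = r (v x) - r (v t) - (x - t) *\<^sub>R r (w t)"
      unfolding r_diff[OF d subspace_scale[OF subspace_D sol_w[OF s t]]]
      unfolding r_diff[OF sol_v[OF s x] sol_v[OF s t]] r_scale[OF sol_w[OF s t]] ..
    then show "norm (v x - v t - (x - t) *\<^sub>R w t) \<le> (1 / sqrt m) * norm (r (v x) - r (v t) - (x - t) *\<^sub>R r (w t))"
      using poincare[OF d'] by (simp only:)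
  qed
  show "\<tau> *\<^sub>R g t + \<alpha> *\<^sub>R w t + stress \<tau> u v t = 0" unfolding stress_def by (rule sol_eq[OF s t])
  show "stress \<tau> u v t \<bullet> w t = (c\<^sup>2 *\<^sub>R r (u t) + (\<delta> + \<tau> * c\<^sup>2) *\<^sub>R r (v t)) \<bullet> r (w t)"
    by (rule stress_inner[OF s t sol_w[OF s t]])
  show "stress \<tau> u v t \<bullet> v t = (c\<^sup>2 *\<^sub>R r (u t) + (\<delta> + \<tau> * c\<^sup>2) *\<^sub>R r (v t)) \<bullet> r (v t)"
    by (rule stress_inner[OF s t sol_v[OF s t]])
qed (rule sol_du[OF s] sol_dv[OF s] sol_dw[OF s] \<tau>; assumption)+

lemma J_has_vector_derivative:
  assumes f: "(f has_vector_derivative f') (at t within S)" and H: "\<And>s. s \<in> S \<Longrightarrow> f s \<in> H" "f t \<in> H" "f' \<in> H" and \<epsilon>: "\<epsilon> > 0"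
  shows "((\<lambda>t. J \<epsilon> (f t)) has_vector_derivative J \<epsilon> f') (at t within S)"
    "((\<lambda>t. r (J \<epsilon> (f t))) has_vector_derivative r (J \<epsilon> f')) (at t within S)"
proof -
  have sH: "f s - f t \<in> H" "(s - t) *\<^sub>R f' \<in> H" "f s - f t - (s - t) *\<^sub>R f' \<in> H" if "s \<in> S" for s
    by (intro subspace_diff[OF subspace_H] subspace_scale[OF subspace_H] H that)+
  have J: "J \<epsilon> (f s) - J \<epsilon> (f t) - (s - t) *\<^sub>R J \<epsilon> f' = J \<epsilon> (f s - f t - (s - t) *\<^sub>R f')" if s: "s \<in> S" for s
    using J_diff[OF \<epsilon> sH(1,2)[OF s]] J_diff[OF \<epsilon> H(1)[OF s] H(2)] J_lin[OF \<epsilon> H(3) H(3), of "s - t" 0] by simp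
  show "((\<lambda>t. J \<epsilon> (f t)) has_vector_derivative J \<epsilon> f') (at t within S)"
  proof (rule has_vector_derivative_dominated[OF f])
    fix s assume s: "s \<in> S"
    show "norm (J \<epsilon> (f s) - J \<epsilon> (f t) - (s - t) *\<^sub>R J \<epsilon> f') \<le> 1 * norm (f s - f t - (s - t) *\<^sub>R f')"
      unfolding J[OF s] using norm_J_le[OF \<epsilon> sH(3)[OF s]] by simp
  qed
  show "((\<lambda>t. r (J \<epsilon> (f t))) has_vector_derivative r (J \<epsilon> f')) (at t within S)"
  proof (rule has_vector_derivative_dominated[OF f])
    fix s assume s: "s \<in> S"
    note D = J_D[OF \<epsilon> H(1)[OF s]] J_D[OF \<epsilon> H(2)] J_D[OF \<epsilon> H(3)]
    have "r (J \<epsilon> (f s)) - r (J \<epsilon> (f t)) - (s - t) *\<^sub>R r (J \<epsilon> f') = r (J \<epsilon> (f s) - J \<epsilon> (f t) - (s - t) *\<^sub>R J \<epsilon> f')"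
      unfolding r_diff[OF subspace_diff[OF subspace_D D(1,2)] subspace_scale[OF subspace_D D(3)]]
      unfolding r_diff[OF D(1,2)] r_scale[OF D(3)] ..
    then show "norm (r (J \<epsilon> (f s)) - r (J \<epsilon> (f t)) - (s - t) *\<^sub>R r (J \<epsilon> f')) \<le> (1 / sqrt \<epsilon>) * norm (f s - f t - (s - t) *\<^sub>R f')"
      unfolding J[OF s] using norm_rJ_le[OF \<epsilon> sH(3)[OF s]] by (simp only:)
  qed
qed

text \<open>Applying \<open>R (I + \<epsilon> R\<^sup>2)\<^sup>-\<^sup>1\<close> to a solution makes it regular enough to be tested one half
  power of \<open>A\<close> higher.\<close>

lemma rJ_solution_curve:
  assumes s: "solution \<tau> u v w g" and \<tau>: "0 \<le> \<tau>" "\<tau> \<le> tau_max" and \<epsilon>: "\<epsilon> > 0"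
  shows "mgt_curve \<alpha> c \<delta> \<tau> (smooth\<^sub>1 \<epsilon> v) (smooth\<^sub>1 \<epsilon> w) (smooth\<^sub>1 \<epsilon> g)
    (smooth\<^sub>2 \<epsilon> u) (smooth\<^sub>2 \<epsilon> v) (smooth\<^sub>2 \<epsilon> w) (smooth\<^sub>1 \<epsilon> (stress \<tau> u v))"
proof (unfold_locales)
  note su = sol_u[OF s] and sv = sol_v[OF s] and sw = sol_w[OF s] and sg = sol_g[OF s]
  fix t :: real assume t: "0 \<le> t"
  note jd = J_has_vector_derivative[OF _ _ _ _ \<epsilon>, where S = "{0..}" and t = t, simplified atLeast_iff]
  \<comment> \<open>Derivatives are known with \<open>r\<close> inside \<open>J\<close>, while the
    curve has it outside. \<open>J_commute\<close> identifies the two on nonnegative times, where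
    the values are known to lie in the domain.\<close>
  have tr: "(g has_vector_derivative g') (at t within {0..})"
    if "(f has_vector_derivative f') (at t within {0..})" "\<And>s. 0 \<le> s \<Longrightarrow> f s = g s" "f' = g'" for f g :: "real \<Rightarrow> 'h" and f' g'
    by (rule has_vector_derivative_transform[OF _ _ that(1)[unfolded that(3)]]) (use t that(2) in auto)
  show "((\<lambda>t. r (J \<epsilon> (v t))) has_vector_derivative r (J \<epsilon> (w t))) (at t within {0..})"
    by (rule tr[OF jd(1)[OF sol_dv[OF s t] r_H[OF sv] r_H[OF sv[OF t]] r_H[OF sw[OF t]]]])
      (simp_all only: J_commute[OF \<epsilon>] sv sw t)
  show "((\<lambda>t. r (r (J \<epsilon> (u t)))) has_vector_derivative r (r (J \<epsilon> (v t)))) (at t within {0..})"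
    by (rule tr[OF jd(2)[OF sol_du[OF s t] r_H[OF su] r_H[OF su[OF t]] r_H[OF sv[OF t]]]])
      (simp_all only: J_commute[OF \<epsilon>] su sv t)
  show "((\<lambda>t. r (r (J \<epsilon> (v t)))) has_vector_derivative r (r (J \<epsilon> (w t)))) (at t within {0..})"
    by (rule tr[OF jd(2)[OF sol_dv[OF s t] r_H[OF sv] r_H[OF sv[OF t]] r_H[OF sw[OF t]]]])
      (simp_all only: J_commute[OF \<epsilon>] sv sw t)
  show "((\<lambda>t. r (J \<epsilon> (w t))) has_vector_derivative r (J \<epsilon> (g t))) (at t within {0..})" if "\<tau> \<noteq> 0"
    by (rule jd(2)[OF sol_dw[OF s t that] D_H[OF sw] D_H[OF sw[OF t]] sg[OF t]])
  show "\<tau> *\<^sub>R r (J \<epsilon> (g t)) + \<alpha> *\<^sub>R r (J \<epsilon> (w t)) + r (J \<epsilon> (stress \<tau> u v t)) = 0"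
  proof -
    have st: "stress \<tau> u v t \<in> H" unfolding stress_def by (rule r_H[OF sol_ry[OF s t]])
    note H = sg[OF t] D_H[OF sw[OF t]]
    have gw: "\<tau> *\<^sub>R g t + \<alpha> *\<^sub>R w t \<in> H" using H by (intro subspace_add[OF subspace_H] subspace_scale[OF subspace_H])
    have "\<tau> *\<^sub>R r (J \<epsilon> (g t)) + \<alpha> *\<^sub>R r (J \<epsilon> (w t)) = r (J \<epsilon> (\<tau> *\<^sub>R g t + \<alpha> *\<^sub>R w t))"
      unfolding J_lin[OF \<epsilon> H] r_lin(2)[OF J_D[OF \<epsilon> H(1)] J_D[OF \<epsilon> H(2)]] ..
    moreover have "stress \<tau> u v t = (-1) *\<^sub>R (\<tau> *\<^sub>R g t + \<alpha> *\<^sub>R w t) + 0 *\<^sub>R (\<tau> *\<^sub>R g t + \<alpha> *\<^sub>R w t)"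
      using sol_eq[OF s t, folded stress_def] by (simp add: add_eq_0_iff2 add_eq_0_iff)
    moreover have "r (J \<epsilon> ((-1) *\<^sub>R (\<tau> *\<^sub>R g t + \<alpha> *\<^sub>R w t) + 0 *\<^sub>R (\<tau> *\<^sub>R g t + \<alpha> *\<^sub>R w t))) = (-1) *\<^sub>R r (J \<epsilon> (\<tau> *\<^sub>R g t + \<alpha> *\<^sub>R w t)) + 0 *\<^sub>R r (J \<epsilon> (\<tau> *\<^sub>R g t + \<alpha> *\<^sub>R w t))"
      unfolding J_lin[OF \<epsilon> gw gw] r_lin(2)[OF J_D[OF \<epsilon> gw] J_D[OF \<epsilon> gw]] ..
    ultimately have "\<tau> *\<^sub>R r (J \<epsilon> (g t)) + \<alpha> *\<^sub>R r (J \<epsilon> (w t)) + r (J \<epsilon> (stress \<tau> u v t))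
        = r (J \<epsilon> (\<tau> *\<^sub>R g t + \<alpha> *\<^sub>R w t)) + ((-1) *\<^sub>R r (J \<epsilon> (\<tau> *\<^sub>R g t + \<alpha> *\<^sub>R w t)) + 0 *\<^sub>R r (J \<epsilon> (\<tau> *\<^sub>R g t + \<alpha> *\<^sub>R w t)))"
      by (simp only:)
    then show ?thesis by simp
  qed
qed (intro \<tau> rJ_stress_inner[OF s _ _ \<epsilon>] D_H sol_w[OF s] sol_v[OF s]; assumption)+

lemma rJ_solution_pair:
  assumes s: "solution \<tau> u v w g" and s0: "solution 0 u\<^sub>0 v\<^sub>0 w\<^sub>0 g\<^sub>0" and \<tau>: "0 \<le> \<tau>" "\<tau> \<le> tau_max"
    and init: "u 0 = u\<^sub>0 0" "v 0 = v\<^sub>0 0" and \<epsilon>: "\<epsilon> > 0"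
  shows "mgt_pair \<alpha> c \<delta> \<tau> (smooth\<^sub>1 \<epsilon> v) (smooth\<^sub>1 \<epsilon> w) (smooth\<^sub>1 \<epsilon> g)
    (smooth\<^sub>2 \<epsilon> u) (smooth\<^sub>2 \<epsilon> v) (smooth\<^sub>2 \<epsilon> w) (smooth\<^sub>1 \<epsilon> (stress \<tau> u v))
    (smooth\<^sub>1 \<epsilon> v\<^sub>0) (smooth\<^sub>1 \<epsilon> w\<^sub>0) (smooth\<^sub>1 \<epsilon> g\<^sub>0)
    (smooth\<^sub>2 \<epsilon> u\<^sub>0) (smooth\<^sub>2 \<epsilon> v\<^sub>0) (smooth\<^sub>2 \<epsilon> w\<^sub>0) (smooth\<^sub>1 \<epsilon> (stress 0 u\<^sub>0 v\<^sub>0))"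
proof (intro mgt_pair.intro mgt_pair_axioms.intro)
  have 0: "0 \<le> (0::real)" "0 \<le> tau_max" using tau_max_pos by simp_all
  show "mgt_curve \<alpha> c \<delta> \<tau> (smooth\<^sub>1 \<epsilon> v) (smooth\<^sub>1 \<epsilon> w) (smooth\<^sub>1 \<epsilon> g)
    (smooth\<^sub>2 \<epsilon> u) (smooth\<^sub>2 \<epsilon> v) (smooth\<^sub>2 \<epsilon> w) (smooth\<^sub>1 \<epsilon> (stress \<tau> u v))"
    by (rule rJ_solution_curve[OF s \<tau> \<epsilon>])
  show "mgt_curve \<alpha> c \<delta> 0 (smooth\<^sub>1 \<epsilon> v\<^sub>0) (smooth\<^sub>1 \<epsilon> w\<^sub>0) (smooth\<^sub>1 \<epsilon> g\<^sub>0)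
    (smooth\<^sub>2 \<epsilon> u\<^sub>0) (smooth\<^sub>2 \<epsilon> v\<^sub>0) (smooth\<^sub>2 \<epsilon> w\<^sub>0) (smooth\<^sub>1 \<epsilon> (stress 0 u\<^sub>0 v\<^sub>0))"
    by (rule rJ_solution_curve[OF s0 0 \<epsilon>])
  show "r (J \<epsilon> (v 0)) = r (J \<epsilon> (v\<^sub>0 0))" "r (r (J \<epsilon> (u 0))) = r (r (J \<epsilon> (u\<^sub>0 0)))"
    by (simp_all only: init)
  fix t :: real assume t: "0 \<le> t"
  show "r (J \<epsilon> (stress \<tau> u v t)) \<bullet> r (J \<epsilon> (v\<^sub>0 t))
      = (c\<^sup>2 *\<^sub>R r (r (J \<epsilon> (u t))) + (\<delta> + \<tau> * c\<^sup>2) *\<^sub>R r (r (J \<epsilon> (v t)))) \<bullet> r (r (J \<epsilon> (v\<^sub>0 t)))"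
    by (rule rJ_stress_inner[OF s t D_H[OF sol_v[OF s0 t]] \<epsilon>])
  show "r (J \<epsilon> (stress 0 u\<^sub>0 v\<^sub>0 t)) \<bullet> r (J \<epsilon> (v t))
      = (c\<^sup>2 *\<^sub>R r (r (J \<epsilon> (u\<^sub>0 t))) + \<delta> *\<^sub>R r (r (J \<epsilon> (v\<^sub>0 t)))) \<bullet> r (r (J \<epsilon> (v t)))"
    using rJ_stress_inner[OF s0 t D_H[OF sol_v[OF s t]] \<epsilon>] by simp
qed

text \<open>Coercivity constant times upper constant; 1 + 1/m replaces the base norm of the initial
  velocity by its energy norm.\<close>

definition energy_const :: real where
  "energy_const = (2 / c\<^sup>2 + 2 * \<alpha> / \<delta> + 4 * c\<^sup>2 / \<delta>\<^sup>2) * (upper_const * (1 + 1 / m))"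

lemma energy_const_nonneg: "0 \<le> energy_const"
  using \<alpha> c \<delta> m upper_const_nonneg by (simp add: energy_const_def)

lemma solution_bound:
  assumes s: "solution \<tau> u v w g" and \<tau>: "0 \<le> \<tau>" "\<tau> \<le> tau_max" and t: "0 \<le> t"
  shows "(norm (r (u t)))\<^sup>2 + (norm (r (v t)))\<^sup>2
    \<le> energy_const * ((norm (r (u 0)))\<^sup>2 + (norm (r (v 0)))\<^sup>2 + \<tau> * (norm (w 0))\<^sup>2)"
proof -
  define B where "B = 2 / c\<^sup>2 + 2 * \<alpha> / \<delta> + 4 * c\<^sup>2 / \<delta>\<^sup>2"
  have B: "0 \<le> B" using \<alpha> c \<delta> by (simp add: B_def)
  interpret mgt_curve \<alpha> c \<delta> \<tau> v w g "\<lambda>t. r (u t)" "\<lambda>t. r (v t)" "\<lambda>t. r (w t)" "stress \<tau> u v"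
    by (rule solution_curve[OF s \<tau>])
  define P Q W where "P = r (u 0) \<bullet> r (u 0)" and "Q = r (v 0) \<bullet> r (v 0)" and "W = \<tau> * (w 0 \<bullet> w 0)"
  have nn: "0 \<le> P" "0 \<le> Q" "0 \<le> W" using \<tau> by (simp_all add: P_def Q_def W_def)
  have z: "(0::real) \<le> 0" by simp
  have v0: "v 0 \<bullet> v 0 \<le> (1 / m) * Q" unfolding Q_def by (rule poincare_sq[OF sol_v[OF s z]])
  have "(norm (r (u t)))\<^sup>2 + (norm (r (v t)))\<^sup>2 \<le> B * lyap t"
    unfolding power2_norm_eq_inner lyap_def B_def by (rule lyapunov_coercive[OF \<tau>])
  also have "\<dots> \<le> B * lyap 0" by (rule mult_left_mono[OF lyap_le_initial[OF t] B])
  also have "\<dots> \<le> B * (upper_const * (W + v 0 \<bullet> v 0 + P + Q))"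
    unfolding lyap_def P_def Q_def W_def by (rule mult_left_mono[OF lyapunov_le[OF \<tau>] B])
  also have "\<dots> \<le> B * (upper_const * ((1 + 1 / m) * (P + Q + W)))"
  proof (intro mult_left_mono B upper_const_nonneg)
    have "0 \<le> (1 / m) * (P + W)" using nn m by simp
    then show "W + v 0 \<bullet> v 0 + P + Q \<le> (1 + 1 / m) * (P + Q + W)"
      using v0 by (simp add: distrib_left distrib_right add_divide_distrib)
  qed
  also have "\<dots> = B * (upper_const * (1 + 1 / m)) * (P + Q + W)" by (simp only: mult.assoc)
  finally show ?thesis
    unfolding P_def Q_def W_def power2_norm_eq_inner energy_const_def B_def .
qed

text \<open>The first factor reads off the two norms from (\<alpha>/4)|a|^2 + (c^2/2)|b|^2, with 1/m
  for the extra Poincare step on \<open>u\<close>. Then come the factor of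
  \<open>difference_bound\<close> and the initial size of the two functionals.\<close>

definition rate_const :: real where
  "rate_const = (1 / m * (2 / c\<^sup>2) + 4 / \<alpha>)
     * ((2 + \<alpha> * c\<^sup>2 / (8 * \<delta>)) * (2 * (upper_const * (1 + tau_max + 1 / m))))"

lemma rate_const_nonneg: "0 \<le> rate_const"
  using \<alpha> c \<delta> m tau_max_pos upper_const_nonneg by (simp add: rate_const_def)

text \<open>\<open>difference_bound\<close> for the smoothed pair controls \<open>J\<close> of the
  difference of \<open>r v\<close> directly, and that of \<open>r u\<close> after one Poincare
  inequality. The bound is free of \<epsilon>, so \<epsilon> may tend to 0.\<close>

lemma solution_difference:
  assumes s: "solution \<tau> u v w g" and s0: "solution 0 u\<^sub>0 v\<^sub>0 w\<^sub>0 g\<^sub>0" and \<tau>: "0 \<le> \<tau>" "\<tau> \<le> tau_max"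
    and init: "u 0 = u\<^sub>0 0" "v 0 = v\<^sub>0 0" and reg: "r (u 0) \<in> D" "r (v 0) \<in> D" and t: "0 \<le> t"
  shows "(norm (r (u t) - r (u\<^sub>0 t)))\<^sup>2 + (norm (r (v t) - r (v\<^sub>0 t)))\<^sup>2
    \<le> rate_const * \<tau> * ((norm (r (r (u 0))))\<^sup>2 + (norm (r (r (v 0))))\<^sup>2 + (norm (r (w 0)))\<^sup>2)"
proof -
  define C where "C = upper_const"
  define K where "K = 2 + \<alpha> * c\<^sup>2 / (8 * \<delta>)"
  define F where "F = 1 + tau_max + 1 / m"
  define B where "B = 1 / m * (2 / c\<^sup>2) + 4 / \<alpha>"
  have K: "0 \<le> K" using \<alpha> \<delta> by (simp add: K_def)
  have C: "0 \<le> C" unfolding C_def by (rule upper_const_nonneg)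
  define P Q W where "P = (norm (r (r (u 0))))\<^sup>2" and "Q = (norm (r (r (v 0))))\<^sup>2" and "W = (norm (r (w 0)))\<^sup>2"
  have nn: "0 \<le> P" "0 \<le> Q" "0 \<le> W" by (simp_all add: P_def Q_def W_def)
  have z: "(0::real) \<le> 0" by simp
  note u0 = sol_u[OF s z] and v0 = sol_v[OF s z] and w0 = sol_w[OF s z]
  define E where "E = K * \<tau> * (2 * (C * (F * (P + Q + W))))"
  note H = r_H[OF sol_u[OF s t]] r_H[OF sol_v[OF s t]] r_H[OF sol_u[OF s0 t]] r_H[OF sol_v[OF s0 t]]
  have bound: "(norm (J \<epsilon> (r (u t) - r (u\<^sub>0 t))))\<^sup>2 + (norm (J \<epsilon> (r (v t) - r (v\<^sub>0 t))))\<^sup>2 \<le> B * E" if \<epsilon>: "0 < \<epsilon>" for \<epsilon>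
  proof -
    interpret mgt_pair \<alpha> c \<delta> \<tau> "smooth\<^sub>1 \<epsilon> v" "smooth\<^sub>1 \<epsilon> w" "smooth\<^sub>1 \<epsilon> g"
      "smooth\<^sub>2 \<epsilon> u" "smooth\<^sub>2 \<epsilon> v" "smooth\<^sub>2 \<epsilon> w" "smooth\<^sub>1 \<epsilon> (stress \<tau> u v)"
      "smooth\<^sub>1 \<epsilon> v\<^sub>0" "smooth\<^sub>1 \<epsilon> w\<^sub>0" "smooth\<^sub>1 \<epsilon> g\<^sub>0"
      "smooth\<^sub>2 \<epsilon> u\<^sub>0" "smooth\<^sub>2 \<epsilon> v\<^sub>0" "smooth\<^sub>2 \<epsilon> w\<^sub>0" "smooth\<^sub>1 \<epsilon> (stress 0 u\<^sub>0 v\<^sub>0)"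
      by (rule rJ_solution_pair[OF s s0 \<tau> init \<epsilon>])
    have W: "(norm (r (J \<epsilon> (w 0))))\<^sup>2 \<le> W"
      unfolding W_def J_commute[OF \<epsilon> w0, symmetric] by (intro power_mono norm_J_le[OF \<epsilon> r_H[OF w0]] norm_ge_zero)
    have P: "(norm (r (r (J \<epsilon> (u 0)))))\<^sup>2 \<le> P"
      unfolding P_def J_commute[OF \<epsilon> u0, symmetric] J_commute[OF \<epsilon> reg(1), symmetric]
      by (intro power_mono norm_J_le[OF \<epsilon> r_H[OF reg(1)]] norm_ge_zero)
    have Q: "(norm (r (r (J \<epsilon> (v 0)))))\<^sup>2 \<le> Q"
      unfolding Q_def J_commute[OF \<epsilon> v0, symmetric] J_commute[OF \<epsilon> reg(2), symmetric]
      by (intro power_mono norm_J_le[OF \<epsilon> r_H[OF reg(2)]] norm_ge_zero)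
    have "(norm (r (J \<epsilon> (v 0))))\<^sup>2 \<le> (1 / m) * (norm (r (r (J \<epsilon> (v 0)))))\<^sup>2"
      unfolding power2_norm_eq_inner by (rule poincare_sq[OF rJ_D[OF \<epsilon> D_H[OF v0]]])
    also have "\<dots> \<le> (1 / m) * Q" using Q m by (intro mult_left_mono) auto
    finally have V: "(norm (r (J \<epsilon> (v 0))))\<^sup>2 \<le> (1 / m) * Q" .
    have main: "\<sigma> * x + (norm (r (J \<epsilon> (v 0))))\<^sup>2 + (norm (r (r (J \<epsilon> (u 0)))))\<^sup>2 + (norm (r (r (J \<epsilon> (v 0)))))\<^sup>2 \<le> F * (P + Q + W)"
      if x: "\<sigma> * x \<le> tau_max * W" for \<sigma> x
    proof -
      have "F * (P + Q + W) = P + Q + W + tau_max * P + tau_max * Q + tau_max * W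
          + (1 / m) * P + (1 / m) * Q + (1 / m) * W"
        by (simp add: F_def distrib_left distrib_right)
      moreover have "0 \<le> tau_max * P" "0 \<le> tau_max * Q" "0 \<le> (1 / m) * P" "0 \<le> (1 / m) * W"
        using nn m tau_max_pos by simp_all
      ultimately show ?thesis using x P Q V nn by linarith
    qed
    have "m.lyap 0 \<le> C * (\<tau> * (norm (r (J \<epsilon> (w 0))))\<^sup>2 + (norm (r (J \<epsilon> (v 0))))\<^sup>2 + (norm (r (r (J \<epsilon> (u 0)))))\<^sup>2 + (norm (r (r (J \<epsilon> (v 0)))))\<^sup>2)"
      unfolding m.lyap_def power2_norm_eq_inner C_def by (rule lyapunov_le[OF \<tau>])
    also have "\<dots> \<le> C * (F * (P + Q + W))"
      by (intro mult_left_mono C main mult_mono \<tau> W) (use tau_max_pos in auto)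
    finally have 1: "m.lyap 0 \<le> C * (F * (P + Q + W))" .
    \<comment> \<open>The initial acceleration of the limit solution is multiplied by 0; its size,
      unrelated to the data \<open>W\<close>, does no harm.\<close>
    have "l.lyap 0 \<le> C * (0 * (norm (r (J \<epsilon> (w\<^sub>0 0))))\<^sup>2 + (norm (r (J \<epsilon> (v 0))))\<^sup>2 + (norm (r (r (J \<epsilon> (u 0)))))\<^sup>2 + (norm (r (r (J \<epsilon> (v 0)))))\<^sup>2)"
      unfolding l.lyap_def power2_norm_eq_inner init C_def by (rule lyapunov_le[OF l.\<tau>])
    also have "\<dots> \<le> C * (F * (P + Q + W))"
      by (intro mult_left_mono C main) (use tau_max_pos nn in auto)
    finally have 2: "l.lyap 0 \<le> C * (F * (P + Q + W))" .
    define a where "a = r (J \<epsilon> (v t)) - r (J \<epsilon> (v\<^sub>0 t))"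
    define b where "b = r (r (J \<epsilon> (u t))) - r (r (J \<epsilon> (u\<^sub>0 t)))"
    have "\<alpha> / 4 * (a \<bullet> a) + c\<^sup>2 / 2 * (b \<bullet> b) \<le> K * \<tau> * (m.lyap 0 + l.lyap 0)"
      unfolding a_def b_def K_def by (rule difference_bound[OF t])
    also have "\<dots> \<le> K * \<tau> * (C * (F * (P + Q + W)) + C * (F * (P + Q + W)))"
      using K \<tau> by (intro mult_left_mono add_mono 1 2) auto
    also have "\<dots> = E" by (simp only: E_def mult_2)
    finally have E: "\<alpha> / 4 * (a \<bullet> a) + c\<^sup>2 / 2 * (b \<bullet> b) \<le> E" .
    moreover have "0 \<le> \<alpha> / 4 * (a \<bullet> a)" "0 \<le> c\<^sup>2 / 2 * (b \<bullet> b)" using \<alpha> by simp_all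
    ultimately have "\<alpha> / 4 * (a \<bullet> a) \<le> E" "c\<^sup>2 / 2 * (b \<bullet> b) \<le> E" by linarith+
    then have a: "a \<bullet> a \<le> 4 / \<alpha> * E" and b: "b \<bullet> b \<le> 2 / c\<^sup>2 * E"
      using \<alpha> c by (simp_all add: field_simps)
    note JD = J_D[OF \<epsilon> D_H[OF sol_u[OF s t]]] J_D[OF \<epsilon> D_H[OF sol_u[OF s0 t]]]
      and rJD = rJ_D[OF \<epsilon> D_H[OF sol_u[OF s t]]] rJ_D[OF \<epsilon> D_H[OF sol_u[OF s0 t]]]
    have ja: "J \<epsilon> (r (v t) - r (v\<^sub>0 t)) = a"
      unfolding a_def J_diff[OF \<epsilon> H(2,4)] J_commute[OF \<epsilon> sol_v[OF s t]] J_commute[OF \<epsilon> sol_v[OF s0 t]] by (rule refl)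
    have ju: "J \<epsilon> (r (u t) - r (u\<^sub>0 t)) = r (J \<epsilon> (u t)) - r (J \<epsilon> (u\<^sub>0 t))"
      unfolding J_diff[OF \<epsilon> H(1,3)] J_commute[OF \<epsilon> sol_u[OF s t]] J_commute[OF \<epsilon> sol_u[OF s0 t]] by (rule refl)
    have "(norm (J \<epsilon> (r (u t) - r (u\<^sub>0 t))))\<^sup>2 \<le> 1 / m * (b \<bullet> b)"
      unfolding ju power2_norm_eq_inner b_def r_diff[OF rJD, symmetric]
      by (rule poincare_sq[OF subspace_diff[OF subspace_D rJD]])
    also have "\<dots> \<le> 1 / m * (2 / c\<^sup>2 * E)" using m by (intro mult_left_mono b) auto
    finally have "(norm (J \<epsilon> (r (u t) - r (u\<^sub>0 t))))\<^sup>2 \<le> 1 / m * (2 / c\<^sup>2 * E)" .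
    moreover have "(norm (J \<epsilon> (r (v t) - r (v\<^sub>0 t))))\<^sup>2 \<le> 4 / \<alpha> * E"
      unfolding ja power2_norm_eq_inner by (rule a)
    moreover have "B * E = 1 / m * (2 / c\<^sup>2 * E) + 4 / \<alpha> * E" by (simp add: B_def distrib_right)
    ultimately show ?thesis by linarith
  qed
  have ev: "\<forall>\<^sub>F \<epsilon> in at_right 0. (norm (J \<epsilon> (r (u t) - r (u\<^sub>0 t))))\<^sup>2 + (norm (J \<epsilon> (r (v t) - r (v\<^sub>0 t))))\<^sup>2 \<le> B * E"
    unfolding eventually_at_filter by (intro always_eventually) (simp add: bound)
  have "((\<lambda>\<epsilon>. (norm (J \<epsilon> (r (u t) - r (u\<^sub>0 t))))\<^sup>2 + (norm (J \<epsilon> (r (v t) - r (v\<^sub>0 t))))\<^sup>2)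
      \<longlongrightarrow> (norm (r (u t) - r (u\<^sub>0 t)))\<^sup>2 + (norm (r (v t) - r (v\<^sub>0 t)))\<^sup>2) (at_right 0)"
    by (intro tendsto_add tendsto_power tendsto_norm J_tendsto subspace_diff[OF subspace_H] H)
  then have "(norm (r (u t) - r (u\<^sub>0 t)))\<^sup>2 + (norm (r (v t) - r (v\<^sub>0 t)))\<^sup>2 \<le> B * E"
    by (rule tendsto_upperbound[OF _ ev]) simp
  also have "B * E = B * (K * (2 * (C * F))) * \<tau> * (P + Q + W)" by (simp add: E_def)
  finally show ?thesis
    unfolding P_def Q_def W_def rate_const_def B_def K_def F_def C_def .
qed

section \<open>Phase spaces and generators expressed through the square root\<close>

lemma A_domain: "x \<in> Domain (R O R) \<longleftrightarrow> x \<in> D \<and> r x \<in> D"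
  and A_app: "x \<in> D \<Longrightarrow> r x \<in> D \<Longrightarrow> app (R O R) x = r (r x)"
  and A32_domain: "x \<in> Domain ((R O R) O R) \<longleftrightarrow> x \<in> D \<and> r x \<in> D \<and> r (r x) \<in> D"
proof -
  have R: "(x, y) \<in> R \<longleftrightarrow> x \<in> D \<and> y = r x" for x y
    using r_in r_eq by blast
  have RR: "(x, y) \<in> R O R \<longleftrightarrow> x \<in> D \<and> r x \<in> D \<and> y = r (r x)" for x y
    unfolding relcomp_unfold mem_Collect_eq case_prod_conv R by metis
  show "x \<in> Domain (R O R) \<longleftrightarrow> x \<in> D \<and> r x \<in> D" unfolding Domain_iff[of x "R O R"] RR by metis
  show "app (R O R) x = r (r x)" if "x \<in> D" "r x \<in> D"
    unfolding app_def[of "R O R"] RR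
  proof (rule the_equality)
    show "x \<in> D \<and> r x \<in> D \<and> r (r x) = r (r x)" using that by (intro conjI refl)
    show "y = r (r x)" if "x \<in> D \<and> r x \<in> D \<and> y = r (r x)" for y using that by (elim conjE)
  qed
  show "x \<in> Domain ((R O R) O R) \<longleftrightarrow> x \<in> D \<and> r x \<in> D \<and> r (r x) \<in> D"
  proof
    assume "x \<in> Domain ((R O R) O R)"
    then obtain z where "(x, z) \<in> (R O R) O R" unfolding Domain_iff[of x "(R O R) O R"] by (elim exE)
    then obtain y z where "(x, y) \<in> R O R" "(y, z) \<in> R"
      unfolding relcomp_unfold[of "R O R" R] mem_Collect_eq case_prod_conv by (elim exE conjE)
    then show "x \<in> D \<and> r x \<in> D \<and> r (r x) \<in> D" unfolding RR R by (elim conjE) simp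
  next
    assume x: "x \<in> D \<and> r x \<in> D \<and> r (r x) \<in> D"
    then have "(x, r (r x)) \<in> R O R" "(r (r x), r (r (r x))) \<in> R" unfolding RR R by simp_all
    then show "x \<in> Domain ((R O R) O R)" by (rule DomainI[OF relcompI])
  qed
qed

abbreviation mgt_group where
  "mgt_group \<tau> \<equiv> C0_group_generated_by (HH0 H R) (norm_HH0 R) (gen_tau H (R O R) R \<alpha> c \<delta> \<tau>)"

abbreviation limit_semigroup where
  "limit_semigroup \<equiv> C0_semigroup_generated_by (HH00 R) (norm_HH00 R) (gen_limit (R O R) R \<alpha> c \<delta>)"

lemma graph_iff:
  "((u, v, w), (u', v', w')) \<in> {((u, v, w), (v, w, F u v w)) | u v w. P u v w}
    \<longleftrightarrow> P u v w \<and> u' = v \<and> v' = w \<and> w' = F u v w"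
  "((u, v), (u', v')) \<in> {((u, v), (v, G u v)) | u v. Q u v} \<longleftrightarrow> Q u v \<and> u' = v \<and> v' = G u v"
  by auto

lemma gen_tau_iff:
  "((u, v, w), (u', v', w')) \<in> gen_tau H (R O R) R \<alpha> c \<delta> \<tau> \<longleftrightarrow>
    u \<in> D \<and> v \<in> D \<and> w \<in> D \<and> c\<^sup>2 *\<^sub>R u + (\<delta> + \<tau> * c\<^sup>2) *\<^sub>R v \<in> D \<and> r (c\<^sup>2 *\<^sub>R u + (\<delta> + \<tau> * c\<^sup>2) *\<^sub>R v) \<in> D \<and>
    u' = v \<and> v' = w \<and> w' = - ((1 / \<tau>) *\<^sub>R r (r (c\<^sup>2 *\<^sub>R u + (\<delta> + \<tau> * c\<^sup>2) *\<^sub>R v))) - (\<alpha> / \<tau>) *\<^sub>R w"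
proof -
  have "((u, v, w), (u', v', w')) \<in> gen_tau H (R O R) R \<alpha> c \<delta> \<tau> \<longleftrightarrow>
    (u \<in> D \<and> v \<in> D \<and> w \<in> H) \<and> w \<in> D \<and> c\<^sup>2 *\<^sub>R u + (\<delta> + \<tau> * c\<^sup>2) *\<^sub>R v \<in> Domain (R O R) \<and>
    u' = v \<and> v' = w \<and> w' = - ((1 / \<tau>) *\<^sub>R app (R O R) (c\<^sup>2 *\<^sub>R u + (\<delta> + \<tau> * c\<^sup>2) *\<^sub>R v)) - (\<alpha> / \<tau>) *\<^sub>R w"
    unfolding gen_tau_def Let_def HH0_def graph_iff mem_Times_iff fst_conv snd_conv by metis
  then show ?thesis unfolding A_domain
    by (rule trans) (intro iffI; elim conjE; intro conjI; (assumption | erule D_H | simp only: A_app))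
qed

lemma gen_limit_iff:
  "((u, v), (u', v')) \<in> gen_limit (R O R) R \<alpha> c \<delta> \<longleftrightarrow>
    u \<in> D \<and> v \<in> D \<and> c\<^sup>2 *\<^sub>R u + \<delta> *\<^sub>R v \<in> D \<and> r (c\<^sup>2 *\<^sub>R u + \<delta> *\<^sub>R v) \<in> D \<and> r (r (c\<^sup>2 *\<^sub>R u + \<delta> *\<^sub>R v)) \<in> D \<and>
    u' = v \<and> v' = - ((1 / \<alpha>) *\<^sub>R r (r (c\<^sup>2 *\<^sub>R u + \<delta> *\<^sub>R v)))"
proof -
  have "((u, v), (u', v')) \<in> gen_limit (R O R) R \<alpha> c \<delta> \<longleftrightarrow>
    (u \<in> D \<and> v \<in> D) \<and> c\<^sup>2 *\<^sub>R u + \<delta> *\<^sub>R v \<in> Domain ((R O R) O R) \<and>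
    u' = v \<and> v' = - ((1 / \<alpha>) *\<^sub>R app (R O R) (c\<^sup>2 *\<^sub>R u + \<delta> *\<^sub>R v))"
    unfolding gen_limit_def HH00_def graph_iff mem_Times_iff fst_conv snd_conv by metis
  then show ?thesis unfolding A32_domain
    by (rule trans) (intro iffI; elim conjE; intro conjI; (assumption | simp only: A_app))
qed

abbreviation \<Phi>\<^sub>3 :: "'h \<times> 'h \<times> 'h \<Rightarrow> 'h \<times> 'h \<times> 'h" where "\<Phi>\<^sub>3 \<equiv> \<lambda>(u, v, w). (r u, r v, w)"
abbreviation \<Phi>\<^sub>2 :: "'h \<times> 'h \<Rightarrow> 'h \<times> 'h" where "\<Phi>\<^sub>2 \<equiv> \<lambda>(u, v). (r u, r v)"

lemma normed_HH0: "normed_by (HH0 H R) (norm_HH0 R) \<Phi>\<^sub>3"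
proof
  show "subspace (HH0 H R)" unfolding HH0_def by (intro subspace_Times subspace_D subspace_H)
  show "\<Phi>\<^sub>3 (a *\<^sub>R x + b *\<^sub>R y) = a *\<^sub>R \<Phi>\<^sub>3 x + b *\<^sub>R \<Phi>\<^sub>3 y" if "x \<in> HH0 H R" "y \<in> HH0 H R" for x y a b
  proof -
    obtain u v w u' v' w' where e: "x = (u, v, w)" "y = (u', v', w')" by (metis prod_cases3)
    have "u \<in> D" "v \<in> D" "u' \<in> D" "v' \<in> D" using that unfolding e HH0_def mem_Times_iff fst_conv snd_conv by blast+
    then show ?thesis unfolding e by (simp add: r_lin(2))
  qed
  show "norm_HH0 R x = norm (\<Phi>\<^sub>3 x)" for x
    by (cases x) (simp add: norm_HH0_def norm_Pair)
qed

lemma normed_HH00: "normed_by (HH00 R) (norm_HH00 R) \<Phi>\<^sub>2"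
proof
  show "subspace (HH00 R)" unfolding HH00_def by (intro subspace_Times subspace_D)
  show "\<Phi>\<^sub>2 (a *\<^sub>R x + b *\<^sub>R y) = a *\<^sub>R \<Phi>\<^sub>2 x + b *\<^sub>R \<Phi>\<^sub>2 y" if "x \<in> HH00 R" "y \<in> HH00 R" for x y a b
  proof -
    obtain u v u' v' where e: "x = (u, v)" "y = (u', v')" by (metis surj_pair)
    have "u \<in> D" "v \<in> D" "u' \<in> D" "v' \<in> D" using that unfolding e HH00_def mem_Times_iff fst_conv snd_conv by blast+
    then show ?thesis unfolding e by (simp add: r_lin(2))
  qed
  show "norm_HH00 R x = norm (\<Phi>\<^sub>2 x)" for x
    by (cases x) (simp add: norm_HH00_def norm_Pair)
qed

text \<open>By the Poincare inequality the sequence itself is Cauchy, and closedness identifies the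
  limit. This gives the completeness that Baire's theorem needs.\<close>

lemma r_Cauchy_limit:
  assumes x: "\<And>n. x n \<in> D" and C: "Cauchy (\<lambda>n. r (x n))"
  obtains a where "a \<in> D" "(\<lambda>n. r (x n)) \<longlonglongrightarrow> r a"
proof -
  have "(\<forall>n. r (x n) \<in> H) \<and> Cauchy (\<lambda>n. r (x n))" using r_H[OF x] C by simp
  then obtain b where b: "(\<lambda>n. r (x n)) \<longlonglongrightarrow> b"
    using complete_H[unfolded complete_def, THEN spec, of "\<lambda>n. r (x n)"] by (elim impE bexE)
  have "Cauchy x"
  proof (rule CauchyI)
    fix e :: real assume e: "0 < e"
    have "0 < e * sqrt m" using e m by simp
    then obtain M where M: "\<And>i j. i \<ge> M \<Longrightarrow> j \<ge> M \<Longrightarrow> norm (r (x i) - r (x j)) < e * sqrt m"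
      using CauchyD[OF C] by meson
    have "norm (x i - x j) < e" if "i \<ge> M" "j \<ge> M" for i j
    proof -
      have "norm (x i - x j) \<le> (1 / sqrt m) * norm (r (x i) - r (x j))"
        using poincare[OF subspace_diff[OF subspace_D x x], of i j] unfolding r_diff[OF x x] .
      also have "\<dots> < (1 / sqrt m) * (e * sqrt m)" using M[OF that] m by (intro mult_strict_left_mono) simp_all
      finally show ?thesis using m by simp
    qed
    then show "\<exists>M. \<forall>i\<ge>M. \<forall>j\<ge>M. norm (x i - x j) < e" by blast
  qed
  moreover have "\<forall>n. x n \<in> H" using D_H[OF x] by simp
  ultimately obtain a where a: "x \<longlonglongrightarrow> a"
    using complete_H[unfolded complete_def, THEN spec, of x] by (elim impE bexE) simp_all
  show thesis
    using that[OF r_closed(1)[OF x a b]] b unfolding r_closed(2)[OF x a b] by simp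
qed

lemma complete_HH00: "complete (\<Phi>\<^sub>2 ` HH00 R)"
  unfolding complete_def
proof (intro allI impI, elim conjE)
  fix f assume f: "\<forall>n. f n \<in> \<Phi>\<^sub>2 ` HH00 R" and C: "Cauchy f"
  have "\<forall>n. \<exists>u v. u \<in> D \<and> v \<in> D \<and> f n = (r u, r v)" using f unfolding HH00_def by fastforce
  then obtain u v where uv: "\<And>n. u n \<in> D" "\<And>n. v n \<in> D" "\<And>n. f n = (r (u n), r (v n))" by metis
  have "Cauchy (\<lambda>n. r (u n))" "Cauchy (\<lambda>n. r (v n))"
    using Cauchy_fst[OF C] Cauchy_snd[OF C] by (simp_all add: uv)
  then obtain a b where a: "a \<in> D" "(\<lambda>n. r (u n)) \<longlonglongrightarrow> r a" and b: "b \<in> D" "(\<lambda>n. r (v n)) \<longlonglongrightarrow> r b"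
    using r_Cauchy_limit[of u] r_Cauchy_limit[of v] uv(1,2) by metis
  have "f = (\<lambda>n. (r (u n), r (v n)))" using uv(3) by (rule ext)
  then have "f \<longlonglongrightarrow> \<Phi>\<^sub>2 (a, b)" using tendsto_Pair[OF a(2) b(2)] by simp
  moreover have "(a, b) \<in> HH00 R" unfolding HH00_def by (rule SigmaI[OF a(1) b(1)])
  ultimately show "\<exists>l\<in>\<Phi>\<^sub>2 ` HH00 R. f \<longlonglongrightarrow> l" by (intro bexI[OF _ imageI])
qed

end

section \<open>Density and convergence\<close>

lemma (in normed_by) N_triangle:
  assumes "x \<in> X" "y \<in> X"
  shows "N (x + y) \<le> N x + N y" "N (x - y) \<le> N x + N y"
  using assms by (simp_all add: N_eq X_add X_diff \<Phi>_add \<Phi>_diff norm_triangle_ineq norm_triangle_ineq4)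

context mgt_problem
begin

section \<open>From orbits to solutions\<close>

lemma HH0_iff: "(u, v, w) \<in> HH0 H R \<longleftrightarrow> u \<in> D \<and> v \<in> D \<and> w \<in> H"
  unfolding HH0_def mem_Times_iff fst_conv snd_conv by (rule refl)

lemma HH00_iff: "(u, v) \<in> HH00 R \<longleftrightarrow> u \<in> D \<and> v \<in> D"
  unfolding HH00_def mem_Times_iff fst_conv snd_conv by (rule refl)

lemma HH2_iff: "(u, v, w) \<in> HH2 (R O R) R \<longleftrightarrow> (u \<in> D \<and> r u \<in> D) \<and> (v \<in> D \<and> r v \<in> D) \<and> w \<in> D"
  unfolding HH2_def mem_Times_iff fst_conv snd_conv A_domain by (rule refl)

lemma proj_HH00: "x \<in> HH0 H R \<Longrightarrow> proj_HH00 x \<in> HH00 R"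
  by (cases x) (simp only: proj_HH00_def prod.case HH0_iff HH00_iff)

lemma proj_diff: "proj_HH00 (x - y) = proj_HH00 x - proj_HH00 y"
  by (cases x; cases y) (simp add: proj_HH00_def)

lemma norm_proj_le: "norm_HH00 R (proj_HH00 x) \<le> norm_HH0 R x"
  by (cases x) (simp add: proj_HH00_def norm_HH00_def norm_HH0_def)

lemma combination_regular:
  assumes "u \<in> D" "r u \<in> D" "v \<in> D" "r v \<in> D"
  shows "a *\<^sub>R u + b *\<^sub>R v \<in> D" "r (a *\<^sub>R u + b *\<^sub>R v) \<in> D" "r (r (a *\<^sub>R u + b *\<^sub>R v)) = a *\<^sub>R r (r u) + b *\<^sub>R r (r v)"
proof -
  show "a *\<^sub>R u + b *\<^sub>R v \<in> D" by (rule r_lin(1)[OF assms(1,3)])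
  show "r (a *\<^sub>R u + b *\<^sub>R v) \<in> D" unfolding r_lin(2)[OF assms(1,3)] by (rule r_lin(1)[OF assms(2,4)])
  show "r (r (a *\<^sub>R u + b *\<^sub>R v)) = a *\<^sub>R r (r u) + b *\<^sub>R r (r v)"
    unfolding r_lin(2)[OF assms(1,3)] by (rule r_lin(2)[OF assms(2,4)])
qed

text \<open>For \<open>HH2\<close> data each of \<open>u\<^sub>0\<close>, \<open>v\<^sub>0\<close>
  lies in the domain of A, hence so does their combination for every \<tau>, and the orbit is
  classical. \<open>g\<close> is the last component of the orbit of the generator's value.\<close>

lemma group_solution:
  assumes S: "mgt_group \<tau> S" and \<tau>: "0 < \<tau>"
    and x: "(u\<^sub>0, v\<^sub>0, w\<^sub>0) \<in> HH2 (R O R) R"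
  obtains u v w g where "solution \<tau> u v w g" "\<And>t. S t (u\<^sub>0, v\<^sub>0, w\<^sub>0) = (u t, v t, w t)"
    "u 0 = u\<^sub>0" "v 0 = v\<^sub>0" "w 0 = w\<^sub>0"
proof -
  interpret N: normed_by "HH0 H R" "norm_HH0 R" \<Phi>\<^sub>3 by (rule normed_HH0)
  have C0: "C0_on UNIV (HH0 H R) (norm_HH0 R) S" and gen: "generator_on UNIV (HH0 H R) (norm_HH0 R) S = gen_tau H (R O R) R \<alpha> c \<delta> \<tau>"
    using S by (simp_all only: C0_group_generated_by_def)
  have reg: "u\<^sub>0 \<in> D" "r u\<^sub>0 \<in> D" "v\<^sub>0 \<in> D" "r v\<^sub>0 \<in> D" "w\<^sub>0 \<in> D" using x unfolding HH2_iff by blast+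
  define x\<^sub>0 where "x\<^sub>0 = (u\<^sub>0, v\<^sub>0, w\<^sub>0)"
  define z where "z = - ((1 / \<tau>) *\<^sub>R r (r (c\<^sup>2 *\<^sub>R u\<^sub>0 + (\<delta> + \<tau> * c\<^sup>2) *\<^sub>R v\<^sub>0))) - (\<alpha> / \<tau>) *\<^sub>R w\<^sub>0"
  define y\<^sub>0 where "y\<^sub>0 = (v\<^sub>0, w\<^sub>0, z)"
  have xy: "(x\<^sub>0, y\<^sub>0) \<in> gen_tau H (R O R) R \<alpha> c \<delta> \<tau>"
    unfolding x\<^sub>0_def y\<^sub>0_def gen_tau_iff z_def using reg combination_regular[OF reg(1-4)] by blast
  define u v w g where "u t = fst (S t x\<^sub>0)" and "v t = fst (snd (S t x\<^sub>0))" and "w t = snd (snd (S t x\<^sub>0))"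
    and "g t = snd (snd (S t y\<^sub>0))" for t
  have Sx: "S t x\<^sub>0 = (u t, v t, w t)" for t by (simp add: u_def v_def w_def)
  have "(S t x\<^sub>0, S t y\<^sub>0) \<in> gen_tau H (R O R) R \<alpha> c \<delta> \<tau>" for t
    using N.generator_orbit[OF C0 xy[folded gen] UNIV_I disjI1[OF refl]] unfolding gen .
  then have "((u t, v t, w t), (fst (S t y\<^sub>0), fst (snd (S t y\<^sub>0)), g t)) \<in> gen_tau H (R O R) R \<alpha> c \<delta> \<tau>" for t
    unfolding Sx g_def prod.collapse .
  note G = this[unfolded gen_tau_iff]
  have Sy: "S t y\<^sub>0 = (v t, w t, g t)" for t
    using G[of t] unfolding g_def by (metis prod.collapse)
  have "((\<lambda>t. \<Phi>\<^sub>3 (S t x\<^sub>0)) has_vector_derivative \<Phi>\<^sub>3 (S t y\<^sub>0)) (at t)" for t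
    by (rule N.group_orbit_derivative[OF C0 xy[folded gen]])
  then have "((\<lambda>t. (r (u t), r (v t), w t)) has_vector_derivative (r (v t), r (w t), g t)) (at t within {0..})" for t
    unfolding Sx Sy prod.case by (rule has_vector_derivative_at_within)
  note d = bounded_linear.has_vector_derivative[OF bounded_linear_fst this]
    bounded_linear.has_vector_derivative[OF bounded_linear_snd this]
  note d2 = bounded_linear.has_vector_derivative[OF bounded_linear_fst d(2)]
    bounded_linear.has_vector_derivative[OF bounded_linear_snd d(2)]
  note d' = d(1)[unfolded fst_conv] d2[unfolded snd_conv fst_conv]
  have gH: "g t \<in> H" for t
  proof -
    have "y\<^sub>0 \<in> HH0 H R" using xy[folded gen] unfolding generator_on_def by blast
    then have "S t y\<^sub>0 \<in> HH0 H R" by (rule N.S_X[OF C0 UNIV_I])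
    then show ?thesis unfolding Sy HH0_iff by blast
  qed
  have e: "\<tau> *\<^sub>R g t + \<alpha> *\<^sub>R w t + r (r (c\<^sup>2 *\<^sub>R u t + (\<delta> + \<tau> * c\<^sup>2) *\<^sub>R v t)) = 0" for t
  proof -
    have "g t = - ((1 / \<tau>) *\<^sub>R r (r (c\<^sup>2 *\<^sub>R u t + (\<delta> + \<tau> * c\<^sup>2) *\<^sub>R v t))) - (\<alpha> / \<tau>) *\<^sub>R w t"
      using G[of t] by blast
    then show ?thesis using \<tau> by (simp add: scaleR_diff_right)
  qed
  show thesis
  proof (rule that)
    show "solution \<tau> u v w g" unfolding solution_def using G d' gH e by blast
    show "S t (u\<^sub>0, v\<^sub>0, w\<^sub>0) = (u t, v t, w t)" for t using Sx unfolding x\<^sub>0_def .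
    have "x\<^sub>0 \<in> HH0 H R" unfolding x\<^sub>0_def HH0_iff using reg D_H by blast
    then have "(u 0, v 0, w 0) = x\<^sub>0" using N.S_0[OF C0] Sx[of 0] by metis
    then show "u 0 = u\<^sub>0" "v 0 = v\<^sub>0" "w 0 = w\<^sub>0" by (simp_all add: x\<^sub>0_def)
  qed
qed

text \<open>The limit generator asks for one more power of \<open>r\<close> than \<open>HH2\<close>
  provides; the extra hypotheses are what the resolvent delivers.\<close>

lemma semigroup_solution:
  assumes S: "limit_semigroup S"
    and reg: "u\<^sub>0 \<in> D" "r u\<^sub>0 \<in> D" "r (r u\<^sub>0) \<in> D" "v\<^sub>0 \<in> D" "r v\<^sub>0 \<in> D" "r (r v\<^sub>0) \<in> D"
  obtains u v w g where "solution 0 u v w g" "\<And>t. 0 \<le> t \<Longrightarrow> S t (u\<^sub>0, v\<^sub>0) = (u t, v t)"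
    "u 0 = u\<^sub>0" "v 0 = v\<^sub>0"
proof -
  interpret N: normed_by "HH00 R" "norm_HH00 R" \<Phi>\<^sub>2 by (rule normed_HH00)
  have C0: "C0_on {0..} (HH00 R) (norm_HH00 R) S" and gen: "generator_on {0..} (HH00 R) (norm_HH00 R) S = gen_limit (R O R) R \<alpha> c \<delta>"
    using S by (simp_all only: C0_semigroup_generated_by_def)
  define x\<^sub>0 where "x\<^sub>0 = (u\<^sub>0, v\<^sub>0)"
  define z where "z = - ((1 / \<alpha>) *\<^sub>R r (r (c\<^sup>2 *\<^sub>R u\<^sub>0 + \<delta> *\<^sub>R v\<^sub>0)))"
  define y\<^sub>0 where "y\<^sub>0 = (v\<^sub>0, z)"
  have "r (r (c\<^sup>2 *\<^sub>R u\<^sub>0 + \<delta> *\<^sub>R v\<^sub>0)) \<in> D"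
    unfolding combination_regular(3)[OF reg(1,2,4,5)] by (rule r_lin(1)[OF reg(3,6)])
  then have xy: "(x\<^sub>0, y\<^sub>0) \<in> gen_limit (R O R) R \<alpha> c \<delta>"
    unfolding x\<^sub>0_def y\<^sub>0_def gen_limit_iff z_def using reg combination_regular[OF reg(1,2,4,5)] by blast
  define u v w where "u t = fst (S t x\<^sub>0)" and "v t = snd (S t x\<^sub>0)" and "w t = snd (S t y\<^sub>0)" for t
  have Sx: "S t x\<^sub>0 = (u t, v t)" for t by (simp add: u_def v_def)
  have "(S t x\<^sub>0, S t y\<^sub>0) \<in> gen_limit (R O R) R \<alpha> c \<delta>" if "0 \<le> t" for t
    using N.generator_orbit[OF C0 xy[folded gen] _ disjI2[OF refl]] that unfolding gen by simp
  then have "((u t, v t), (fst (S t y\<^sub>0), w t)) \<in> gen_limit (R O R) R \<alpha> c \<delta>" if "0 \<le> t" for t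
    using that unfolding Sx w_def prod.collapse by blast
  note G = this[unfolded gen_limit_iff]
  have Sy: "S t y\<^sub>0 = (v t, w t)" if "0 \<le> t" for t
    using G[OF that] unfolding w_def by (metis prod.collapse)
  have "((\<lambda>t. \<Phi>\<^sub>2 (S t x\<^sub>0)) has_vector_derivative \<Phi>\<^sub>2 (S t y\<^sub>0)) (at t within {0..})" if "0 \<le> t" for t
    by (rule N.semigroup_orbit_derivative[OF C0 complete_HH00 xy[folded gen] that])
  then have "((\<lambda>t. (r (u t), r (v t))) has_vector_derivative (r (v t), r (w t))) (at t within {0..})" if "0 \<le> t" for t
    using that unfolding Sx by (simp only: Sy prod.case)
  note d = bounded_linear.has_vector_derivative[OF bounded_linear_fst this, unfolded fst_conv]
    bounded_linear.has_vector_derivative[OF bounded_linear_snd this, unfolded snd_conv]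
  have w: "w t = - ((1 / \<alpha>) *\<^sub>R r (r (c\<^sup>2 *\<^sub>R u t + \<delta> *\<^sub>R v t)))" if "0 \<le> t" for t
    using G[OF that] by blast
  have wD: "w t \<in> D" if t: "0 \<le> t" for t
  proof -
    have "r (r (c\<^sup>2 *\<^sub>R u t + \<delta> *\<^sub>R v t)) \<in> D" using G[OF t] by blast
    then have "(- 1 / \<alpha>) *\<^sub>R r (r (c\<^sup>2 *\<^sub>R u t + \<delta> *\<^sub>R v t)) \<in> D" by (rule subspace_scale[OF subspace_D])
    then show ?thesis unfolding w[OF t] by simp
  qed
  have e: "0 *\<^sub>R (0::'h) + \<alpha> *\<^sub>R w t + r (r (c\<^sup>2 *\<^sub>R u t + (\<delta> + 0 * c\<^sup>2) *\<^sub>R v t)) = 0" if "0 \<le> t" for t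
    unfolding w[OF that] using \<alpha> by simp
  \<comment> \<open>At \<tau> = 0 the value of \<open>g\<close> is free; the zero function lies in
    \<open>H\<close>.\<close>
  have s: "solution 0 u v w (\<lambda>_. 0)"
    unfolding solution_def
  proof (intro allI impI conjI)
    fix t :: real assume t: "0 \<le> t"
    show "u t \<in> D" "v t \<in> D" "c\<^sup>2 *\<^sub>R u t + (\<delta> + 0 * c\<^sup>2) *\<^sub>R v t \<in> D" "r (c\<^sup>2 *\<^sub>R u t + (\<delta> + 0 * c\<^sup>2) *\<^sub>R v t) \<in> D"
      unfolding mult_zero_left add_0_right using G[OF t] by blast+
    show "(0::'h) \<in> H" by (rule subspace_0[OF subspace_H])
  qed (use wD e d in \<open>simp_all only: simp_thms\<close>)
  show thesis
  proof (rule that[OF s])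
    show "S t (u\<^sub>0, v\<^sub>0) = (u t, v t)" for t using Sx unfolding x\<^sub>0_def .
    have "x\<^sub>0 \<in> HH00 R" unfolding x\<^sub>0_def HH00_iff using reg by blast
    then have "(u 0, v 0) = x\<^sub>0" using N.S_0[OF C0] Sx[of 0] by metis
    then show "u 0 = u\<^sub>0" "v 0 = v\<^sub>0" by (simp_all add: x\<^sub>0_def)
  qed
qed

section \<open>Smoothing of initial data and uniform bounds\<close>

definition smooth :: "real \<Rightarrow> 'h \<times> 'h \<times> 'h \<Rightarrow> 'h \<times> 'h \<times> 'h" where
  "smooth \<epsilon> = (\<lambda>(u, v, w). (J \<epsilon> u, J \<epsilon> v, J \<epsilon> w))"

lemma smooth_HH2: "0 < \<epsilon> \<Longrightarrow> x \<in> HH0 H R \<Longrightarrow> smooth \<epsilon> x \<in> HH2 (R O R) R"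
  by (cases x) (simp only: smooth_def prod.case HH0_iff HH2_iff J_D rJ_D D_H simp_thms)

lemma smooth_HH0: "0 < \<epsilon> \<Longrightarrow> x \<in> HH0 H R \<Longrightarrow> smooth \<epsilon> x \<in> HH0 H R"
  by (cases x) (simp only: smooth_def prod.case HH0_iff J_D J_H D_H simp_thms)

lemma norm_smooth_HH0_le:
  assumes \<epsilon>: "0 < \<epsilon>" and x: "x \<in> HH0 H R"
  shows "norm_HH0 R (smooth \<epsilon> x) \<le> norm_HH0 R x"
proof -
  obtain u v w where e: "x = (u, v, w)" by (metis prod_cases3)
  have u: "u \<in> D" and v: "v \<in> D" and w: "w \<in> H" using x unfolding e HH0_iff by blast+
  show ?thesis
    unfolding e smooth_def norm_HH0_def prod.case J_commute[OF \<epsilon> u, symmetric] J_commute[OF \<epsilon> v, symmetric]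
    by (intro real_sqrt_le_mono add_mono power_mono norm_J_le[OF \<epsilon>] r_H u v w norm_ge_zero)
qed

lemma norm_smooth_HH2_le:
  assumes \<epsilon>: "0 < \<epsilon>" and x: "x \<in> HH2 (R O R) R"
  shows "norm_HH2 (R O R) R (smooth \<epsilon> x) \<le> norm_HH2 (R O R) R x"
proof -
  obtain u v w where e: "x = (u, v, w)" by (metis prod_cases3)
  have u: "u \<in> D" "r u \<in> D" and v: "v \<in> D" "r v \<in> D" and w: "w \<in> D" using x unfolding e HH2_iff by blast+
  have A: "app (R O R) (J \<epsilon> y) = J \<epsilon> (app (R O R) y)" if y: "y \<in> D" "r y \<in> D" for y
    unfolding A_app[OF y] A_app[OF J_D[OF \<epsilon> D_H[OF y(1)]] rJ_D[OF \<epsilon> D_H[OF y(1)]]]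
      J_commute[OF \<epsilon> y(2)] J_commute[OF \<epsilon> y(1)] by (rule refl)
  have AH: "app (R O R) y \<in> H" if y: "y \<in> D" "r y \<in> D" for y
    unfolding A_app[OF y] by (rule r_H[OF y(2)])
  show ?thesis
    unfolding e smooth_def norm_HH2_def prod.case A[OF u] A[OF v] J_commute[OF \<epsilon> w, symmetric]
    by (intro real_sqrt_le_mono add_mono power_mono norm_J_le[OF \<epsilon>] AH r_H u v w norm_ge_zero)
qed

lemma smooth_tendsto:
  assumes x: "x \<in> HH0 H R"
  shows "((\<lambda>\<epsilon>. norm_HH0 R (x - smooth \<epsilon> x)) \<longlongrightarrow> 0) (at_right 0)"
proof -
  obtain u v w where e: "x = (u, v, w)" by (metis prod_cases3)
  have u: "u \<in> D" and v: "v \<in> D" and w: "w \<in> H" using x unfolding e HH0_iff by blast+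
  have "((\<lambda>\<epsilon>. sqrt ((norm (r u - J \<epsilon> (r u)))\<^sup>2 + (norm (r v - J \<epsilon> (r v)))\<^sup>2 + (norm (w - J \<epsilon> w))\<^sup>2))
    \<longlongrightarrow> sqrt ((norm (r u - r u))\<^sup>2 + (norm (r v - r v))\<^sup>2 + (norm (w - w))\<^sup>2)) (at_right 0)"
    by (intro tendsto_real_sqrt tendsto_add tendsto_power tendsto_norm tendsto_diff tendsto_const J_tendsto r_H u v w)
  moreover have "\<forall>\<^sub>F \<epsilon> in at_right 0. sqrt ((norm (r u - J \<epsilon> (r u)))\<^sup>2 + (norm (r v - J \<epsilon> (r v)))\<^sup>2 + (norm (w - J \<epsilon> w))\<^sup>2)
      = norm_HH0 R (x - smooth \<epsilon> x)"
    unfolding eventually_at_filter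
  proof (intro always_eventually allI impI)
    fix \<epsilon> :: real assume "\<epsilon> \<in> {0<..}"
    then have \<epsilon>: "0 < \<epsilon>" by simp
    show "sqrt ((norm (r u - J \<epsilon> (r u)))\<^sup>2 + (norm (r v - J \<epsilon> (r v)))\<^sup>2 + (norm (w - J \<epsilon> w))\<^sup>2) = norm_HH0 R (x - smooth \<epsilon> x)"
      unfolding e smooth_def prod.case diff_Pair norm_HH0_def
        r_diff[OF u J_D[OF \<epsilon> D_H[OF u]]] r_diff[OF v J_D[OF \<epsilon> D_H[OF v]]] J_commute[OF \<epsilon> u] J_commute[OF \<epsilon> v] by (rule refl)
  qed
  ultimately have "((\<lambda>\<epsilon>. norm_HH0 R (x - smooth \<epsilon> x)) \<longlongrightarrow> sqrt ((norm (r u - r u))\<^sup>2 + (norm (r v - r v))\<^sup>2 + (norm (w - w))\<^sup>2)) (at_right 0)"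
    by (rule Lim_transform_eventually)
  then show ?thesis by simp
qed

text \<open>B only has to be independent of \<epsilon>. A crude bound for the operator at one fixed
  time and one fixed \<tau> is therefore enough to extend a sharp estimate from regular
  data.\<close>

lemma le_by_smoothing:
  assumes "x \<in> HH0 H R" and le: "\<And>\<epsilon>. 0 < \<epsilon> \<Longrightarrow> a \<le> B * norm_HH0 R (x - smooth \<epsilon> x) + b"
  shows "a \<le> b"
proof -
  have "((\<lambda>\<epsilon>. B * norm_HH0 R (x - smooth \<epsilon> x) + b) \<longlongrightarrow> B * 0 + b) (at_right 0)"
    by (intro tendsto_add tendsto_mult tendsto_const smooth_tendsto assms)
  moreover have "\<forall>\<^sub>F \<epsilon> in at_right 0. a \<le> B * norm_HH0 R (x - smooth \<epsilon> x) + b"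
    unfolding eventually_at_filter by (intro always_eventually) (simp add: le)
  ultimately have "a \<le> B * 0 + b" by (rule tendsto_lowerbound) simp
  then show ?thesis by simp
qed

text \<open>The projection is essential: \<open>solution_bound\<close> is uniform in \<tau> for
  \<open>u\<close> and \<open>v\<close> only.\<close>

lemma group_bound:
  assumes S: "mgt_group \<tau> S"
    and \<tau>: "0 < \<tau>" "\<tau> \<le> tau_max" and x: "x \<in> HH0 H R" and t: "0 \<le> t"
  shows "norm_HH00 R (proj_HH00 (S t x)) \<le> sqrt (energy_const * (1 + tau_max)) * norm_HH0 R x"
proof -
  interpret N: normed_by "HH0 H R" "norm_HH0 R" \<Phi>\<^sub>3 by (rule normed_HH0)
  interpret N2: normed_by "HH00 R" "norm_HH00 R" \<Phi>\<^sub>2 by (rule normed_HH00)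
  define M where "M = sqrt (energy_const * (1 + tau_max))"
  have M: "0 \<le> M" "M\<^sup>2 = energy_const * (1 + tau_max)"
    using energy_const_nonneg tau_max_pos by (simp_all add: M_def)
  have C0: "C0_on UNIV (HH0 H R) (norm_HH0 R) S" using S by (simp only: C0_group_generated_by_def)
  have reg: "norm_HH00 R (proj_HH00 (S t y)) \<le> M * norm_HH0 R y" if y: "y \<in> HH2 (R O R) R" for y
  proof -
    obtain u\<^sub>0 v\<^sub>0 w\<^sub>0 where e: "y = (u\<^sub>0, v\<^sub>0, w\<^sub>0)" by (metis prod_cases3)
    obtain u v w g where s: "solution \<tau> u v w g" and Sy: "\<And>t. S t (u\<^sub>0, v\<^sub>0, w\<^sub>0) = (u t, v t, w t)"
      and init: "u 0 = u\<^sub>0" "v 0 = v\<^sub>0" "w 0 = w\<^sub>0"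
      using group_solution[OF S \<tau>(1) y[unfolded e]] by metis
    define P Q W where "P = (norm (r u\<^sub>0))\<^sup>2" and "Q = (norm (r v\<^sub>0))\<^sup>2" and "W = (norm w\<^sub>0)\<^sup>2"
    have nn: "0 \<le> P" "0 \<le> Q" "0 \<le> W" by (simp_all add: P_def Q_def W_def)
    have "(norm (r (u t)))\<^sup>2 + (norm (r (v t)))\<^sup>2 \<le> energy_const * (P + Q + \<tau> * W)"
      using solution_bound[OF s less_imp_le[OF \<tau>(1)] \<tau>(2) t] unfolding init P_def Q_def W_def .
    also have "\<dots> \<le> energy_const * ((1 + tau_max) * (P + Q + W))"
    proof (rule mult_left_mono[OF _ energy_const_nonneg])
      have "\<tau> * W \<le> tau_max * W" by (rule mult_right_mono[OF \<tau>(2) nn(3)])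
      moreover have "0 \<le> tau_max * P" "0 \<le> tau_max * Q" using nn tau_max_pos by simp_all
      moreover have "(1 + tau_max) * (P + Q + W) = P + Q + W + tau_max * P + tau_max * Q + tau_max * W"
        by (simp add: distrib_left distrib_right)
      ultimately show "P + Q + \<tau> * W \<le> (1 + tau_max) * (P + Q + W)" using nn by linarith
    qed
    also have "\<dots> = M\<^sup>2 * (P + Q + W)" by (simp only: M(2) mult.assoc)
    finally have "sqrt ((norm (r (u t)))\<^sup>2 + (norm (r (v t)))\<^sup>2) \<le> sqrt (M\<^sup>2 * (P + Q + W))" by (rule real_sqrt_le_mono)
    then show ?thesis
      using M(1) unfolding e Sy proj_HH00_def norm_HH00_def norm_HH0_def prod.case P_def Q_def W_def
      by (simp add: real_sqrt_mult)
  qed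
  obtain B where B: "0 \<le> B" "\<And>y. y \<in> HH0 H R \<Longrightarrow> norm_HH0 R (S t y) \<le> B * norm_HH0 R y"
    using N.S_bound_nonneg[OF C0 UNIV_I, of t] by blast
  show ?thesis
    unfolding M_def[symmetric]
  proof (rule le_by_smoothing[OF x])
    fix \<epsilon> :: real assume \<epsilon>: "0 < \<epsilon>"
    note sx = smooth_HH0[OF \<epsilon> x] and dx = N.X_diff[OF x smooth_HH0[OF \<epsilon> x]]
    have "S t x = S t (x - smooth \<epsilon> x) + S t (smooth \<epsilon> x)"
      unfolding N.S_diff[OF C0 UNIV_I x sx] by simp
    then have "proj_HH00 (S t x) = proj_HH00 (S t (x - smooth \<epsilon> x)) + proj_HH00 (S t (smooth \<epsilon> x))"
      by (cases "S t (x - smooth \<epsilon> x)"; cases "S t (smooth \<epsilon> x)") (simp add: proj_HH00_def)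
    then have "norm_HH00 R (proj_HH00 (S t x)) \<le> norm_HH00 R (proj_HH00 (S t (x - smooth \<epsilon> x))) + norm_HH00 R (proj_HH00 (S t (smooth \<epsilon> x)))"
      using N2.N_triangle(1)[OF proj_HH00[OF N.S_X[OF C0 UNIV_I dx, of t]] proj_HH00[OF N.S_X[OF C0 UNIV_I sx, of t]]] by (simp only:)
    also have "norm_HH00 R (proj_HH00 (S t (x - smooth \<epsilon> x))) \<le> B * norm_HH0 R (x - smooth \<epsilon> x)"
      by (rule order_trans[OF norm_proj_le B(2)[OF dx]])
    also have "norm_HH00 R (proj_HH00 (S t (smooth \<epsilon> x))) \<le> M * norm_HH0 R x"
      by (rule order_trans[OF reg[OF smooth_HH2[OF \<epsilon> x]] mult_left_mono[OF norm_smooth_HH0_le[OF \<epsilon> x] M(1)]])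
    finally show "norm_HH00 R (proj_HH00 (S t x)) \<le> B * norm_HH0 R (x - smooth \<epsilon> x) + M * norm_HH0 R x" by simp
  qed
qed

lemma semigroup_bound:
  assumes S: "limit_semigroup S"
    and x: "x \<in> HH00 R" and t: "0 \<le> t"
  shows "norm_HH00 R (S t x) \<le> sqrt energy_const * norm_HH00 R x"
proof -
  interpret N: normed_by "HH00 R" "norm_HH00 R" \<Phi>\<^sub>2 by (rule normed_HH00)
  have C0: "C0_on {0..} (HH00 R) (norm_HH00 R) S" using S by (simp only: C0_semigroup_generated_by_def)
  have tJ: "t \<in> {0..}" using t by simp
  obtain a b where e: "x = (a, b)" by (metis surj_pair)
  have ab: "a \<in> D" "b \<in> D" using x unfolding e HH00_iff by blast+
  obtain B where B: "0 \<le> B" "\<And>y. y \<in> HH00 R \<Longrightarrow> norm_HH00 R (S t y) \<le> B * norm_HH00 R y"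
    using N.S_bound_nonneg[OF C0 tJ] by blast
  \<comment> \<open>A zero third component embeds the pair, so that the density argument for triples
    applies.\<close>
  have x3: "(a, b, 0) \<in> HH0 H R" unfolding HH0_iff using ab subspace_0[OF subspace_H] by blast
  have norm3: "norm_HH0 R (a, b, 0) = norm_HH00 R x" unfolding e by (simp add: norm_HH0_def norm_HH00_def)
  show "norm_HH00 R (S t x) \<le> sqrt energy_const * norm_HH00 R x"
  proof (rule le_by_smoothing[OF x3])
    fix \<epsilon> :: real assume \<epsilon>: "0 < \<epsilon>"
    define y where "y = (J \<epsilon> a, J \<epsilon> b)"
    note Ja = J_D[OF \<epsilon> D_H[OF ab(1)]] rJ_D[OF \<epsilon> D_H[OF ab(1)]] rrJ_D[OF \<epsilon> ab(1)]
      and Jb = J_D[OF \<epsilon> D_H[OF ab(2)]] rJ_D[OF \<epsilon> D_H[OF ab(2)]] rrJ_D[OF \<epsilon> ab(2)]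
    have y: "y \<in> HH00 R" unfolding y_def HH00_iff using Ja Jb by blast
    obtain u v w g where s: "solution 0 u v w g" and Sy: "\<And>t. 0 \<le> t \<Longrightarrow> S t (J \<epsilon> a, J \<epsilon> b) = (u t, v t)"
      and init: "u 0 = J \<epsilon> a" "v 0 = J \<epsilon> b"
      using semigroup_solution[OF S Ja Jb] by metis
    have "(norm (r (u t)))\<^sup>2 + (norm (r (v t)))\<^sup>2 \<le> energy_const * ((norm (r (J \<epsilon> a)))\<^sup>2 + (norm (r (J \<epsilon> b)))\<^sup>2 + 0 * (norm (w 0))\<^sup>2)"
      using solution_bound[OF s order_refl less_imp_le[OF tau_max_pos] t] unfolding init .
    then have "sqrt ((norm (r (u t)))\<^sup>2 + (norm (r (v t)))\<^sup>2) \<le> sqrt (energy_const * ((norm (r (J \<epsilon> a)))\<^sup>2 + (norm (r (J \<epsilon> b)))\<^sup>2))"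
      by (intro real_sqrt_le_mono) simp
    then have 1: "norm_HH00 R (S t y) \<le> sqrt energy_const * norm_HH00 R y"
      unfolding y_def Sy[OF t] norm_HH00_def prod.case by (simp add: real_sqrt_mult)
    have le: "norm_HH00 R y \<le> norm_HH00 R x"
      unfolding y_def e norm_HH00_def prod.case J_commute[OF \<epsilon> ab(1), symmetric] J_commute[OF \<epsilon> ab(2), symmetric]
      by (intro real_sqrt_le_mono add_mono power_mono norm_J_le[OF \<epsilon>] r_H ab norm_ge_zero)
    have "proj_HH00 ((a, b, 0) - smooth \<epsilon> (a, b, 0)) = x - y"
      by (simp add: proj_HH00_def smooth_def e y_def)
    then have 2: "norm_HH00 R (x - y) \<le> norm_HH0 R ((a, b, 0) - smooth \<epsilon> (a, b, 0))"
      using norm_proj_le by metis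
    note dx = N.X_diff[OF x y]
    have "S t x = S t (x - y) + S t y" unfolding N.S_diff[OF C0 tJ x y] by simp
    then have "norm_HH00 R (S t x) \<le> norm_HH00 R (S t (x - y)) + norm_HH00 R (S t y)"
      using N.N_triangle(1)[OF N.S_X[OF C0 tJ dx] N.S_X[OF C0 tJ y]] by (simp only:)
    also have "norm_HH00 R (S t (x - y)) \<le> B * norm_HH0 R ((a, b, 0) - smooth \<epsilon> (a, b, 0))"
      by (rule order_trans[OF B(2)[OF dx] mult_left_mono[OF 2 B(1)]])
    also have "norm_HH00 R (S t y) \<le> sqrt energy_const * norm_HH00 R x"
      by (rule order_trans[OF 1 mult_left_mono[OF le]]) (use energy_const_nonneg in simp)
    finally show "norm_HH00 R (S t x) \<le> B * norm_HH0 R ((a, b, 0) - smooth \<epsilon> (a, b, 0)) + sqrt energy_const * norm_HH00 R x" by simp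
  qed
qed

lemma regular_difference:
  assumes S: "mgt_group \<tau> S"
    and S0: "limit_semigroup S\<^sub>0"
    and \<tau>: "0 < \<tau>" "\<tau> \<le> tau_max" and x: "x \<in> HH2 (R O R) R"
    and x3: "proj_HH00 x \<in> Domain ((R O R) O R) \<times> Domain ((R O R) O R)" and t: "0 \<le> t"
  shows "norm_HH00 R (proj_HH00 (S t x) - S\<^sub>0 t (proj_HH00 x)) \<le> sqrt (rate_const * \<tau>) * norm_HH2 (R O R) R x"
proof -
  obtain a b d where e: "x = (a, b, d)" by (metis prod_cases3)
  have p: "proj_HH00 x = (a, b)" unfolding e proj_HH00_def prod.case by (rule refl)
  have ab: "a \<in> D" "r a \<in> D" "r (r a) \<in> D" "b \<in> D" "r b \<in> D" "r (r b) \<in> D"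
    using x3 unfolding p mem_Times_iff fst_conv snd_conv A32_domain by blast+
  obtain u v w g where s: "solution \<tau> u v w g" and Sx: "\<And>t. S t (a, b, d) = (u t, v t, w t)"
    and init: "u 0 = a" "v 0 = b" "w 0 = d"
    using group_solution[OF S \<tau>(1) x[unfolded e]] by metis
  obtain u\<^sub>0 v\<^sub>0 w\<^sub>0 g\<^sub>0 where s0: "solution 0 u\<^sub>0 v\<^sub>0 w\<^sub>0 g\<^sub>0" and Sx0: "\<And>t. 0 \<le> t \<Longrightarrow> S\<^sub>0 t (a, b) = (u\<^sub>0 t, v\<^sub>0 t)"
    and init0: "u\<^sub>0 0 = a" "v\<^sub>0 0 = b"
    using semigroup_solution[OF S0 ab] by metis
  have "(norm (r (u t) - r (u\<^sub>0 t)))\<^sup>2 + (norm (r (v t) - r (v\<^sub>0 t)))\<^sup>2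
      \<le> rate_const * \<tau> * ((norm (r (r a)))\<^sup>2 + (norm (r (r b)))\<^sup>2 + (norm (r d))\<^sup>2)"
    using solution_difference[OF s s0 less_imp_le[OF \<tau>(1)] \<tau>(2) _ _ _ _ t] unfolding init init0 using ab by blast
  then have "sqrt ((norm (r (u t) - r (u\<^sub>0 t)))\<^sup>2 + (norm (r (v t) - r (v\<^sub>0 t)))\<^sup>2)
      \<le> sqrt (rate_const * \<tau> * ((norm (r (r a)))\<^sup>2 + (norm (r (r b)))\<^sup>2 + (norm (r d))\<^sup>2))"
    by (rule real_sqrt_le_mono)
  then show ?thesis
    unfolding p unfolding e Sx Sx0[OF t] proj_HH00_def prod.case diff_Pair norm_HH00_def norm_HH2_def
      r_diff[OF sol_u[OF s t] sol_u[OF s0 t]] r_diff[OF sol_v[OF s t] sol_v[OF s0 t]]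
      A_app[OF ab(1,2)] A_app[OF ab(4,5)] real_sqrt_mult[of "rate_const * \<tau>"] .
qed

theorem vanishing_relaxation:
  assumes S: "\<And>\<tau>. 0 < \<tau> \<Longrightarrow>
      C0_group_generated_by (HH0 H R) (norm_HH0 R) (gen_tau H (R O R) R \<alpha> c \<delta> \<tau>) (S \<tau>)"
    and S0: "C0_semigroup_generated_by (HH00 R) (norm_HH00 R) (gen_limit (R O R) R \<alpha> c \<delta>) S\<^sub>0"
  shows "\<exists>\<tau>\<^sub>0>0. \<exists>C. \<forall>x\<in>HH2 (R O R) R. \<forall>\<tau>\<in>{0<..\<tau>\<^sub>0}. \<forall>t\<ge>0.
      (norm_HH00 R (proj_HH00 (S \<tau> t x) - S\<^sub>0 t (proj_HH00 x)))\<^sup>2 \<le> C * \<tau> * (norm_HH2 (R O R) R x)\<^sup>2"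
    and "x \<in> HH0 H R \<Longrightarrow> uniform_limit {0..}
      (\<lambda>\<tau> t. norm_HH00 R (proj_HH00 (S \<tau> t x) - S\<^sub>0 t (proj_HH00 x))) (\<lambda>t. 0) (at_right 0)"
proof -
  interpret N: normed_by "HH0 H R" "norm_HH0 R" \<Phi>\<^sub>3 by (rule normed_HH0)
  interpret N2: normed_by "HH00 R" "norm_HH00 R" \<Phi>\<^sub>2 by (rule normed_HH00)
  let ?A = "R O R"
  let ?d = "\<lambda>\<tau> t x. proj_HH00 (S \<tau> t x) - S\<^sub>0 t (proj_HH00 x)"
  define C M M' where "C = rate_const" and "M = sqrt (energy_const * (1 + tau_max))" and "M' = sqrt energy_const"
  have C: "0 \<le> C" unfolding C_def by (rule rate_const_nonneg)
  have M': "0 \<le> M'" using energy_const_nonneg by (simp add: M'_def)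
  have C0: "C0_on {0..} (HH00 R) (norm_HH00 R) S\<^sub>0" using S0 by (simp only: C0_semigroup_generated_by_def)
  have C\<tau>: "C0_on UNIV (HH0 H R) (norm_HH0 R) (S \<tau>)" if "0 < \<tau>" for \<tau>
    using S[OF that] by (simp only: C0_group_generated_by_def)
  \<comment> \<open>The rough part x - \<open>smooth \<epsilon> x\<close> is handled by the uniform
    bounds, the smooth part by the rate. Both claims follow from this with different orders of
    limits.\<close>
  have split: "norm_HH00 R (?d \<tau> t x) \<le> (M + M') * norm_HH0 R (x - smooth \<epsilon> x) + sqrt (C * \<tau>) * norm_HH2 ?A R (smooth \<epsilon> x)"
    if \<tau>: "0 < \<tau>" "\<tau> \<le> tau_max" and x: "x \<in> HH0 H R" and t: "0 \<le> t" and \<epsilon>: "0 < \<epsilon>" for \<tau> t x \<epsilon>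
  proof -
    define y where "y = smooth \<epsilon> x"
    have y: "y \<in> HH0 H R" unfolding y_def by (rule smooth_HH0[OF \<epsilon> x])
    note dx = N.X_diff[OF x y] and px = proj_HH00[OF x] and py = proj_HH00[OF y]
    have tJ: "t \<in> {0..}" using t by simp
    note pd = proj_HH00[OF dx]
    note P1 = proj_HH00[OF N.S_X[OF C\<tau>[OF \<tau>(1)] UNIV_I dx, of t]]
      and P2 = N2.S_X[OF C0 tJ pd]
      and P3 = N2.X_diff[OF proj_HH00[OF N.S_X[OF C\<tau>[OF \<tau>(1)] UNIV_I y, of t]] N2.S_X[OF C0 tJ py]]
    have "?d \<tau> t x = (proj_HH00 (S \<tau> t (x - y)) - S\<^sub>0 t (proj_HH00 (x - y))) + ?d \<tau> t y"
      unfolding N.S_diff[OF C\<tau>[OF \<tau>(1)] UNIV_I x y] proj_diff N2.S_diff[OF C0 tJ px py] by simp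
    then have "norm_HH00 R (?d \<tau> t x)
        \<le> norm_HH00 R (proj_HH00 (S \<tau> t (x - y)) - S\<^sub>0 t (proj_HH00 (x - y))) + norm_HH00 R (?d \<tau> t y)"
      using N2.N_triangle(1)[OF N2.X_diff[OF P1 P2] P3] by (simp only:)
    also have "norm_HH00 R (proj_HH00 (S \<tau> t (x - y)) - S\<^sub>0 t (proj_HH00 (x - y)))
        \<le> norm_HH00 R (proj_HH00 (S \<tau> t (x - y))) + norm_HH00 R (S\<^sub>0 t (proj_HH00 (x - y)))"
      by (rule N2.N_triangle(2)[OF P1 P2])
    also have "norm_HH00 R (proj_HH00 (S \<tau> t (x - y))) \<le> M * norm_HH0 R (x - y)" 
      unfolding M_def by (rule group_bound[OF S[OF \<tau>(1)] \<tau> dx t])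
    also have "norm_HH00 R (S\<^sub>0 t (proj_HH00 (x - y))) \<le> M' * norm_HH0 R (x - y)"
      by (rule order_trans[OF semigroup_bound[OF S0 pd t, folded M'_def] mult_left_mono[OF norm_proj_le M']])
    also have "norm_HH00 R (?d \<tau> t y) \<le> sqrt (C * \<tau>) * norm_HH2 ?A R y"
    unfolding C_def
    proof (rule regular_difference[OF S[OF \<tau>(1)] S0 \<tau> _ _ t])
      show "y \<in> HH2 ?A R" unfolding y_def by (rule smooth_HH2[OF \<epsilon> x])
      obtain a b d where e: "x = (a, b, d)" by (metis prod_cases3)
      have ab: "a \<in> D" "b \<in> D" using x unfolding e HH0_iff by blast+
      have "proj_HH00 y = (J \<epsilon> a, J \<epsilon> b)" unfolding y_def e smooth_def proj_HH00_def prod.case by (rule refl)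
      then show "proj_HH00 y \<in> Domain (?A O R) \<times> Domain (?A O R)"
        unfolding mem_Times_iff A32_domain
        using J_D[OF \<epsilon> D_H[OF ab(1)]] rJ_D[OF \<epsilon> D_H[OF ab(1)]] rrJ_D[OF \<epsilon> ab(1)]
          J_D[OF \<epsilon> D_H[OF ab(2)]] rJ_D[OF \<epsilon> D_H[OF ab(2)]] rrJ_D[OF \<epsilon> ab(2)] by (simp only: fst_conv snd_conv simp_thms)
    qed
    finally show ?thesis unfolding y_def by (simp add: distrib_right)
  qed
  \<comment> \<open>Here \<tau> is fixed and \<epsilon> tends to 0; smoothing does not increase the
    \<open>HH2\<close> norm.\<close>
  have rate: "norm_HH00 R (?d \<tau> t x) \<le> sqrt (C * \<tau>) * norm_HH2 ?A R x"
    if \<tau>: "0 < \<tau>" "\<tau> \<le> tau_max" and x: "x \<in> HH2 ?A R" and t: "0 \<le> t" for \<tau> t x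
  proof -
    obtain a b d where e: "x = (a, b, d)" by (metis prod_cases3)
    have x0: "x \<in> HH0 H R" using x unfolding e HH2_iff HH0_iff using D_H by blast
    show ?thesis
    proof (rule le_by_smoothing[OF x0])
      fix \<epsilon> :: real assume \<epsilon>: "0 < \<epsilon>"
      have "sqrt (C * \<tau>) * norm_HH2 ?A R (smooth \<epsilon> x) \<le> sqrt (C * \<tau>) * norm_HH2 ?A R x"
        using C \<tau>(1) by (intro mult_left_mono norm_smooth_HH2_le[OF \<epsilon> x]) simp
      then show "norm_HH00 R (?d \<tau> t x) \<le> (M + M') * norm_HH0 R (x - smooth \<epsilon> x) + sqrt (C * \<tau>) * norm_HH2 ?A R x"
        using split[OF \<tau> x0 t \<epsilon>] by linarith
    qed
  qed
  have nonneg: "0 \<le> norm_HH00 R y" for y by (cases y) (simp add: norm_HH00_def)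
  show "\<exists>\<tau>\<^sub>0>0. \<exists>C. \<forall>x\<in>HH2 (R O R) R. \<forall>\<tau>\<in>{0<..\<tau>\<^sub>0}. \<forall>t\<ge>0. (norm_HH00 R (?d \<tau> t x))\<^sup>2 \<le> C * \<tau> * (norm_HH2 (R O R) R x)\<^sup>2"
  proof (rule exI[of _ tau_max], rule conjI[OF tau_max_pos], rule exI[of _ C], intro ballI allI impI)
    fix x \<tau> and t :: real
    assume x: "x \<in> HH2 ?A R" and \<tau>: "\<tau> \<in> {0<..tau_max}" and t: "0 \<le> t"
    have "(norm_HH00 R (?d \<tau> t x))\<^sup>2 \<le> (sqrt (C * \<tau>) * norm_HH2 ?A R x)\<^sup>2"
      using \<tau> by (intro power_mono rate x t nonneg) auto
    then show "(norm_HH00 R (?d \<tau> t x))\<^sup>2 \<le> C * \<tau> * (norm_HH2 ?A R x)\<^sup>2"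
      using C \<tau> by (simp add: power_mult_distrib)
  qed
  show "uniform_limit {0..} (\<lambda>\<tau> t. norm_HH00 R (?d \<tau> t x)) (\<lambda>t. 0) (at_right 0)" if x: "x \<in> HH0 H R"
  proof (rule uniform_limitI)
    fix e :: real assume e: "0 < e"
    have "((\<lambda>\<epsilon>. (M + M') * norm_HH0 R (x - smooth \<epsilon> x)) \<longlongrightarrow> (M + M') * 0) (at_right 0)"
      by (intro tendsto_mult tendsto_const smooth_tendsto x)
    then have "\<forall>\<^sub>F \<epsilon> in at_right 0. (M + M') * norm_HH0 R (x - smooth \<epsilon> x) < e / 2"
      using e by (intro order_tendstoD) auto
    then have "\<forall>\<^sub>F \<epsilon> in at_right 0. 0 < \<epsilon> \<and> (M + M') * norm_HH0 R (x - smooth \<epsilon> x) < e / 2"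
      using eventually_at_right_less[of "0::real"] by eventually_elim simp
    \<comment> \<open>Here \<epsilon> is fixed first. The \<open>HH2\<close> norm of the smoothed
      data may be huge, but it is a constant when \<tau> tends to 0.\<close>
    then obtain \<epsilon> where \<epsilon>: "0 < \<epsilon>" "(M + M') * norm_HH0 R (x - smooth \<epsilon> x) < e / 2"
      using eventually_happens[of _ "at_right (0::real)"] by force
    have "((\<lambda>\<tau>. sqrt (C * \<tau>) * norm_HH2 ?A R (smooth \<epsilon> x)) \<longlongrightarrow> sqrt (C * 0) * norm_HH2 ?A R (smooth \<epsilon> x)) (at_right 0)"
      by (intro tendsto_intros)
    then have "\<forall>\<^sub>F \<tau> in at_right 0. sqrt (C * \<tau>) * norm_HH2 ?A R (smooth \<epsilon> x) < e / 2"
      using e by (intro order_tendstoD) auto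
    moreover have "\<forall>\<^sub>F \<tau> in at_right 0. \<tau> < tau_max"
      using tau_max_pos by (intro order_tendstoD(2)[OF tendsto_ident_at])
    moreover have "\<forall>\<^sub>F \<tau> in at_right (0::real). 0 < \<tau>" by (rule eventually_at_right_less)
    ultimately show "\<forall>\<^sub>F \<tau> in at_right 0. \<forall>t\<in>{0..}. dist (norm_HH00 R (?d \<tau> t x)) 0 < e"
    proof eventually_elim
      case (elim \<tau>)
      show ?case
      proof
        fix t :: real assume "t \<in> {0..}"
        then have "norm_HH00 R (?d \<tau> t x) < e"
          using split[OF elim(3) less_imp_le[OF elim(2)] x _ \<epsilon>(1), of t] elim(1) \<epsilon>(2) by simp
        then show "dist (norm_HH00 R (?d \<tau> t x)) 0 < e" using nonneg[of "?d \<tau> t x"] by simp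
      qed
    qed
  qed
qed

end

section \<open>Specialisation to the Dirichlet Laplacian\<close>

theorem theorem2p4:
  fixes \<Omega> :: "(real^'n::finite) set"
    and A R :: "((real^'n) l2 \<times> (real^'n) l2) set"
    and \<alpha> c \<delta> :: real
    and T\<^sub>\<tau> :: "real \<Rightarrow> real \<Rightarrow> (real^'n) l2 \<times> (real^'n) l2 \<times> (real^'n) l2
                    \<Rightarrow> (real^'n) l2 \<times> (real^'n) l2 \<times> (real^'n) l2"
    and T\<^sub>0 :: "real \<Rightarrow> (real^'n) l2 \<times> (real^'n) l2 \<Rightarrow> (real^'n) l2 \<times> (real^'n) l2"
  assumes dim: "CARD('n) = 2 \<or> CARD('n) = 3"
    and domain: "bounded_C2_domain \<Omega>"
    and A: "A = dirichlet_laplacian \<Omega>"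
    and R: "is_sqrt_operator (L2 \<Omega>) A R"
    and pos: "\<alpha> > 0" "c > 0" "\<delta> > 0"
    and T\<^sub>\<tau>: "\<And>\<tau>. \<tau> > 0 \<Longrightarrow>
           C0_group_generated_by (HH0 (L2 \<Omega>) R) (norm_HH0 R) (gen_tau (L2 \<Omega>) A R \<alpha> c \<delta> \<tau>) (T\<^sub>\<tau> \<tau>)"
    and T\<^sub>0: "C0_semigroup_generated_by (HH00 R) (norm_HH00 R) (gen_limit A R \<alpha> c \<delta>) T\<^sub>0"
  shows "(\<exists>\<tau>\<^sub>0>0. \<forall>T>0. \<exists>C. \<forall>U\<^sub>0\<in>HH2 A R. \<forall>\<tau>\<in>{0<..\<tau>\<^sub>0}. \<forall>t\<in>{0..T}.
             (norm_HH00 R (proj_HH00 (T\<^sub>\<tau> \<tau> t U\<^sub>0) - T\<^sub>0 t (proj_HH00 U\<^sub>0)))\<^sup>2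
               \<le> C * \<tau> * (norm_HH2 A R U\<^sub>0)\<^sup>2)
       \<and> (\<forall>U\<^sub>0\<in>HH0 (L2 \<Omega>) R.
             uniform_limit {0..}
               (\<lambda>\<tau> t. norm_HH00 R (proj_HH00 (T\<^sub>\<tau> \<tau> t U\<^sub>0) - T\<^sub>0 t (proj_HH00 U\<^sub>0)))
               (\<lambda>t. 0) (at_right 0))"
proof -
  have sa: "self_adjoint_on (L2 \<Omega>) R" and RR: "R O R = A" using R by (simp_all only: is_sqrt_operator_def)
  have \<Omega>: "\<Omega> \<in> sets borel" using domain by (auto simp: bounded_C2_domain_def)
  interpret S: self_adjoint_operator "L2 \<Omega>" R
    by (rule self_adjoint_operator.intro[OF subspace_L2 complete_L2[OF \<Omega>] sa])
  obtain m where m: "m > 0" "\<And>u f. (u, f) \<in> dirichlet_laplacian \<Omega> \<Longrightarrow> m * (norm u)\<^sup>2 \<le> f \<bullet> u"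
    using dirichlet_laplacian_coercive[OF domain] by blast
  interpret mgt_problem "L2 \<Omega>" R m \<alpha> c \<delta>
  proof
    fix x assume x: "x \<in> Domain R" "app R x \<in> Domain R"
    have "(x, app R (app R x)) \<in> R O R" by (rule relcompI[OF S.r_in[OF x(1)] S.r_in[OF x(2)]])
    then show "m * (norm x)\<^sup>2 \<le> app R (app R x) \<bullet> x" by (intro m(2)) (simp only: RR A)
  qed (use m pos in simp_all)
  note main = vanishing_relaxation[where S = T\<^sub>\<tau>, unfolded RR, OF T\<^sub>\<tau> T\<^sub>0]
  obtain \<tau>\<^sub>0 C where "\<tau>\<^sub>0 > 0" and C: "\<And>x \<tau> t. x \<in> HH2 A R \<Longrightarrow> \<tau> \<in> {0<..\<tau>\<^sub>0} \<Longrightarrow> 0 \<le> t \<Longrightarrow>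
      (norm_HH00 R (proj_HH00 (T\<^sub>\<tau> \<tau> t x) - T\<^sub>0 t (proj_HH00 x)))\<^sup>2 \<le> C * \<tau> * (norm_HH2 A R x)\<^sup>2"
    using main(1) by metis
  show ?thesis
  proof (intro conjI ballI main(2))
    show "\<exists>\<tau>\<^sub>0>0. \<forall>T>0. \<exists>C. \<forall>U\<^sub>0\<in>HH2 A R. \<forall>\<tau>\<in>{0<..\<tau>\<^sub>0}. \<forall>t\<in>{0..T}.
             (norm_HH00 R (proj_HH00 (T\<^sub>\<tau> \<tau> t U\<^sub>0) - T\<^sub>0 t (proj_HH00 U\<^sub>0)))\<^sup>2 \<le> C * \<tau> * (norm_HH2 A R U\<^sub>0)\<^sup>2"
      \<comment> \<open>C was obtained before T is introduced, so the same constant is the witness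
        for every T.\<close>
      by (rule exI[of _ \<tau>\<^sub>0], rule conjI[OF \<open>\<tau>\<^sub>0 > 0\<close>], intro allI impI, rule exI[of _ C], intro ballI C) simp_all
  qed
qed

end
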